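(* Fix $z\in\mathbb{C}$ with $-1<\operatorname{Re} z<1$. As $\alpha\to\infty$, \begin{align*} &\frac{1}{\pi^{\frac{z+3}{2}}}\int_{0}^{\infty}\Gamma\left(\frac{z-1+it}{4}\right)\Gamma\left(\frac{z-1-it}{4}\right)\Xi\left(\frac{t+iz}{2}\right)\Xi\left(\frac{t-iz}{2}\right)\frac{\cos\left(\tfrac12 t\log\alpha\right)}{t^2+(z+1)^2}\,dt\\ &\sim-\frac{\Gamma(z)\zeta(z)\alpha^{\frac{z-1}{2}}}{(2\pi)^z}-\frac{\Gamma(z+1)\zeta(z+1)}{2\alpha^{\frac{z+1}{2}}(2\pi)^z}+2\alpha^{\frac{z+1}{2}}\sum_{m=0}^{\infty}\frac{(-1)^m}{(2\pi\alpha)^{2m+z+2}}\Gamma(2m+2+z)\zeta(2m+2)\zeta(2m+z+2). \end{align*}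
   Context: $\Xi(t):=\xi(\tfrac12+it)$, where $\xi(s)=\frac12 s(s-1)\pi^{-s/2}\Gamma(s/2)\zeta(s)$ is Riemann's $\xi$-function; $\zeta$ is the Riemann zeta function. *)

theory Defs
  imports "HOL-Analysis.Analysis" "HOL-Library.Landau_Symbols"
begin

text \<open>
  The analytic continuation of \<open>\<Sum>n\<ge>1. n\<^sup>-\<^sup>s\<close> to the plane minus the pole at \<open>1\<close>. The value at the
  pole is fixed to be \<open>0\<close>, which makes the described function unique.
\<close>

definition riemann_zeta :: "complex \<Rightarrow> complex" where
  "riemann_zeta = (THE f. f holomorphic_on (- {1}) \<and> f 1 = 0 \<and>
     (\<forall>s. Re s > 1 \<longrightarrow> (\<lambda>n. 1 / of_nat (Suc n) powr s) sums f s))"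

definition riemann_xi_formula :: "complex \<Rightarrow> complex" where
  "riemann_xi_formula s =
     1/2 * s * (s - 1) * of_real pi powr (- s / 2) * Gamma (s / 2) * riemann_zeta s"

text \<open>
  The formula has removable singularities at \<open>1\<close> (pole of zeta) and at \<open>0, -2, -4, \<dots>\<close> (poles of
  the Gamma factor); the entire function \<open>\<xi>\<close> takes the limit values there.
\<close>

definition riemann_xi :: "complex \<Rightarrow> complex" where
  "riemann_xi s =
     (if s = 1 \<or> s / 2 \<in> \<int>\<^sub>\<le>\<^sub>0 then Lim (at s) riemann_xi_formula else riemann_xi_formula s)"

definition riemann_Xi :: "complex \<Rightarrow> complex" where
  "riemann_Xi t = riemann_xi (1/2 + \<i> * t)"

definition xi_integrand :: "complex \<Rightarrow> real \<Rightarrow> real \<Rightarrow> complex" where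
  "xi_integrand z \<alpha> t =
     Gamma ((z - 1 + \<i> * of_real t) / 4) * Gamma ((z - 1 - \<i> * of_real t) / 4) *
     riemann_Xi ((of_real t + \<i> * z) / 2) * riemann_Xi ((of_real t - \<i> * z) / 2) *
     (of_real (cos (1/2 * t * ln \<alpha>)) / ((of_real t)\<^sup>2 + (z + 1)\<^sup>2))"

definition xi_integral :: "complex \<Rightarrow> real \<Rightarrow> complex" where
  "xi_integral z \<alpha> =
     1 / of_real pi powr ((z + 3) / 2) * (LBINT t:{0..}. xi_integrand z \<alpha> t)"

definition leading_formula :: "real \<Rightarrow> complex \<Rightarrow> complex" where
  "leading_formula \<alpha> z =
     - (Gamma z * riemann_zeta z * of_real \<alpha> powr ((z - 1) / 2) / of_real (2 * pi) powr z)
     - Gamma (z + 1) * riemann_zeta (z + 1) /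
         (2 * of_real \<alpha> powr ((z + 1) / 2) * of_real (2 * pi) powr z)"

text \<open>
  At \<open>z = 0\<close> the poles of \<open>\<Gamma>(z)\<close> and \<open>\<zeta>(z + 1)\<close> cancel, and the two terms together are read as
  their limit.
\<close>

definition leading_terms :: "complex \<Rightarrow> real \<Rightarrow> complex" where
  "leading_terms z \<alpha> = (if z = 0 then Lim (at 0) (leading_formula \<alpha>) else leading_formula \<alpha> z)"

definition series_term :: "complex \<Rightarrow> nat \<Rightarrow> real \<Rightarrow> complex" where
  "series_term z m \<alpha> =
     2 * of_real \<alpha> powr ((z + 1) / 2) *
     ((- 1) ^ m / of_real (2 * pi * \<alpha>) powr (2 * of_nat m + z + 2) *
      Gamma (2 * of_nat m + 2 + z) * riemann_zeta (2 * of_nat m + 2) *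
      riemann_zeta (2 * of_nat m + z + 2))"

text \<open>
  \<open>f \<sim> g + (\<Sum>m. u m)\<close> at infinity in the sense of Poincare: the series, which need not converge,
  is truncated after any term, and the error is of smaller order than the last term kept.
\<close>

definition has_asymptotic_expansion ::
  "(real \<Rightarrow> complex) \<Rightarrow> (real \<Rightarrow> complex) \<Rightarrow> (nat \<Rightarrow> real \<Rightarrow> complex) \<Rightarrow> bool" where
  "has_asymptotic_expansion f g u \<longleftrightarrow>
     (\<forall>N. (\<lambda>x. f x - (g x + (\<Sum>m\<le>N. u m x))) \<in> o[at_top](u N))"

end

theory Submission
  imports Defs "HOL-Complex_Analysis.Complex_Analysis"
begin

text \<open>
  Put \<open>w = (1 + z + i t) / 2\<close>. The reflection and duplication formulas of the Gamma function turn the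
  integrand into \<open>\<pi>\<close>-powers times \<open>(2 \<pi>)\<^sup>-\<^sup>w K(w) cos (t log \<alpha> / 2)\<close> with
  \<open>K(w) = \<Gamma>(w) \<zeta>(w) \<zeta>(w - z) / sin (\<pi> (w - z) / 2)\<close>. By the functional equation of \<open>\<zeta>\<close> the factor in front
  of the cosine is even in \<open>t\<close>, so the integral equals \<open>\<alpha>\<close>-powers times the Mellin-Barnes integral of
  \<open>(2 \<pi> \<alpha>)\<^sup>-\<^sup>w K(w)\<close> along \<open>Re w = (1 + Re z) / 2\<close>. Moving the line to \<open>Re w = Re z + 2 N + 3\<close> picks up
  the residues at \<open>1\<close> and \<open>1 + z\<close> (the leading terms) and at \<open>z + 2\<close>, \<open>z + 4\<close>, \<open>\<dots>\<close>, \<open>z + 2 N + 2\<close> (the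
  series), and the remaining integral is smaller by a factor \<open>1 / \<alpha>\<close> than the last term. As the line moves
  to the right of \<open>0\<close>, the decay of \<open>1 / sin\<close> against polynomial bounds for \<open>\<zeta>\<close> suffices; the Gamma
  factor only needs \<open>|\<Gamma>(w)| \<le> \<Gamma>(Re w)\<close>.

  The functional equation is obtained on \<open>-1 < s < 0\<close> by Tonelli from the trapezoidal rule for
  \<open>\<Sum>n. n\<^sup>-\<^sup>s\<close> and the partial fractions of \<open>coth\<close>, and continued analytically.
\<close>

section \<open>The zeta function to the right of \<open>-1\<close>\<close>

text \<open>\<open>riemann_zeta\<close> is a definite description, so nothing about it is available
  until a function with the required properties is found on the whole plane and shown to be unique.
  The functional equation therefore has two roles: it supplies the continuation to the left
  half-plane, and later the evenness in \<open>t\<close>. The trapezoidal rule, one order better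
  than a rectangle rule, pushes convergence past \<open>Re s = 0\<close> to
  \<open>Re s > -1\<close>; on the real segment between \<open>-1\<close> and \<open>0\<close> all
  terms and integrands have constant sign, so sums and integrals can be exchanged without any
  integrability argument. The expansion is a relative statement: for every truncation the error must
  be small against the last term kept. A vanishing coefficient would force the error itself to
  vanish for large \<open>\<alpha>\<close>, so the proof needs that zeta has no zeros in
  \<open>Re s > 1\<close>, where both zeta arguments of every term lie. At \<open>z = 0\<close> the
  points \<open>1\<close> and \<open>1 + z\<close> coincide. Summing residues over the set
  \<open>{1, 1 + z}\<close> keeps the contour argument uniform in \<open>z\<close>; only the
  evaluation of the leading terms splits into cases.\<close>

text \<open>
  The error of the trapezoidal rule for \<open>x powr (- s)\<close> on \<open>[n, n + 1]\<close>. For \<open>n = 0\<close> the convention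
  \<open>0 powr w = 0\<close> makes it \<open>1 / 2 + 1 / (s - 1)\<close>, so that the sum over all \<open>n\<close> is exactly \<open>\<zeta>(s)\<close>.
\<close>

definition zeta_trap :: "nat \<Rightarrow> complex \<Rightarrow> complex" where
  "zeta_trap n s = (of_nat n powr (-s) + of_nat (Suc n) powr (-s)) / 2
     - (of_nat (Suc n) powr (1 - s) - of_nat n powr (1 - s)) / (1 - s)"

definition zeta_em :: "complex \<Rightarrow> complex" where
  "zeta_em s = (\<Sum>n. zeta_trap n s)"

text \<open>On \<open>[n, n + h]\<close> the error \<open>E h\<close> of the rule satisfies
  \<open>E 0 = 0\<close>, \<open>E' 0 = 0\<close> and \<open>E'' h = h / 2 * f'' (n + h)\<close> for
  \<open>f x = x powr (- s)\<close>. Two applications of the mean value inequality from the left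
  endpoint give the bound; \<open>Re s > -2\<close> makes \<open>norm (f'' x)\<close> largest at
  \<open>x = n\<close>.\<close>

lemma norm_zeta_trap_le:
  fixes s :: complex
  assumes n: "n \<ge> 1" and s: "Re s > -2" "s \<noteq> 1"
  shows "norm (zeta_trap n s) \<le> norm (s * (s + 1)) / 2 * real n powr (- Re s - 2)"
proof -
  \<comment> \<open>The unit segment as a subset of the complex plane, so that the mean value
    inequality for complex derivatives applies along it.\<close>
  define S where "S = {h::complex. Im h = 0 \<and> 0 \<le> Re h \<and> Re h \<le> 1}"
  have cvx: "convex S"
  proof -
    have "S = ({h. Im h \<le> 0} \<inter> {h. Im h \<ge> 0}) \<inter> ({h. Re h \<ge> 0} \<inter> {h. Re h \<le> 1})"
      by (auto simp: S_def)
    thus ?thesis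
      by (auto intro!: convex_Int convex_halfspace_Re_ge convex_halfspace_Re_le
          convex_halfspace_Im_ge convex_halfspace_Im_le)
  qed
  define x where "x = (\<lambda>h::complex. of_nat n + h)"
  define M where "M = norm (s * (s + 1)) * real n powr (- Re s - 2)"
  have M0: "M \<ge> 0" by (simp add: M_def)
  have notin: "x h \<notin> \<real>\<^sub>\<le>\<^sub>0" if "h \<in> S" for h
    using that n by (auto simp: S_def x_def complex_nonpos_Reals_iff)
  have xof: "x h = of_real (real n + Re h)" if "h \<in> S" for h
    using that by (auto simp: S_def x_def complex_eq_iff)
  have nM: "norm (s * (s + 1) * x h powr (-s - 2)) \<le> M" if "h \<in> S" for h
  proof -
    have "norm (x h powr (-s-2)) = (real n + Re h) powr (- Re s - 2)"
      using that n unfolding xof[OF that] by (subst norm_powr_real_powr) (auto simp: S_def)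
    also have "\<dots> \<le> real n powr (- Re s - 2)"
      using that n s by (intro powr_mono2') (auto simp: S_def)
    finally show ?thesis
      by (simp add: M_def norm_mult mult_left_mono)
  qed
  define E where "E = (\<lambda>h. h / 2 * (of_nat n powr (-s) + x h powr (-s))
     - (x h powr (1 - s) - of_nat n powr (1 - s)) / (1 - s))"
  define E1 where "E1 = (\<lambda>h. (of_nat n powr (-s) - x h powr (-s)) / 2 - s * h / 2 * x h powr (-s-1))"
  define E2 where "E2 = (\<lambda>h. h / 2 * (s * (s + 1) * x h powr (-s - 2)))"
  have dE: "(E has_field_derivative E1 h) (at h within S)" if "h \<in> S" for h
    unfolding E_def E1_def x_def
    using notin[OF that] s
    by (auto intro!: derivative_eq_intros simp: x_def divide_simps) (auto simp: algebra_simps)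
  have dE1: "(E1 has_field_derivative E2 h) (at h within S)" if "h \<in> S" for h
    unfolding E2_def E1_def x_def
    using notin[OF that] s
    by (auto intro!: derivative_eq_intros simp: x_def divide_simps algebra_simps)
  have S0: "0 \<in> S" and S1: "1 \<in> S" by (auto simp: S_def)
  have hS: "norm h \<le> 1" if "h \<in> S" for h
    using that by (auto simp: S_def cmod_def)
  have nE2: "norm (E2 h) \<le> M / 2" if "h \<in> S" for h
  proof -
    have "norm (E2 h) = norm h / 2 * norm (s * (s + 1) * x h powr (-s - 2))"
      by (simp add: E2_def norm_mult norm_divide)
    also have "\<dots> \<le> 1 / 2 * M"
      by (intro mult_mono nM that) (use hS[OF that] in auto)
    finally show ?thesis by simp
  qed
  have nE1: "norm (E1 h) \<le> M / 2" if "h \<in> S" for h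
  proof -
    have "norm (E1 h - E1 0) \<le> M / 2 * norm (h - 0)"
      by (rule field_differentiable_bound[OF cvx dE1 nE2 that S0])
    also have "\<dots> \<le> M / 2 * 1"
      by (intro mult_left_mono) (use hS[OF that] M0 in auto)
    also have "E1 0 = 0" by (simp add: E1_def x_def)
    finally show ?thesis by simp
  qed
  have "norm (E 1 - E 0) \<le> M / 2 * norm (1 - 0 :: complex)"
    by (rule field_differentiable_bound[OF cvx dE nE1 S1 S0])
  moreover have "E 0 = 0" by (simp add: E_def x_def)
  moreover have "E 1 = zeta_trap n s" by (simp add: E_def x_def zeta_trap_def add.commute)
  ultimately show ?thesis by (simp add: M_def)
qed

lemma summable_zeta_trap:
  assumes "Re s > -1" "s \<noteq> 1"
  shows "summable (\<lambda>n. zeta_trap n s)"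
proof -
  have "summable (\<lambda>n. norm (s * (s + 1)) / 2 * real n powr (- Re s - 2))"
    using assms by (intro summable_mult) (simp add: summable_real_powr_iff)
  thus ?thesis
  proof (rule summable_comparison_test[rotated], intro exI[of _ 1] allI impI)
    fix n :: nat assume "n \<ge> 1"
    thus "norm (zeta_trap n s) \<le> norm (s * (s + 1)) / 2 * real n powr (- Re s - 2)"
      using assms by (intro norm_zeta_trap_le) auto
  qed
qed

lemma holomorphic_zeta_trap: "zeta_trap n holomorphic_on -{1}"
  unfolding zeta_trap_def by (cases "n = 0") (auto intro!: holomorphic_intros)

lemma holomorphic_zeta_em: "zeta_em holomorphic_on ({s. Re s > -1} - {1})"
proof -
  let ?S = "{s. Re s > -1} - {1::complex}"
  have op: "open ?S" by (intro open_Diff open_halfspace_Re_gt) auto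
  have fd: "zeta_trap n field_differentiable (at x)" if "x \<in> ?S" for n x
    using that by (intro holomorphic_on_imp_differentiable_at[OF holomorphic_zeta_trap]) auto
  have loc: "\<exists>d h. 0 < d \<and> summable h \<and> range h \<subseteq> \<real>\<^sub>\<ge>\<^sub>0 \<and>
      (\<forall>\<^sub>F n in sequentially. \<forall>y\<in>ball x d \<inter> ?S. norm (zeta_trap n y) \<le> cmod (h n))"
    if x: "x \<in> ?S" for x
  proof -
    from x op obtain e where e: "e > 0" "ball x e \<subseteq> ?S" using openE by blast
    \<comment> \<open>At most half the distance from \<open>x\<close> to the line
      \<open>Re = -1\<close>: on the ball \<open>Re y \<ge> r > -1\<close>, so
      \<open>n powr (- r - 2)\<close> is a summable majorant.\<close>
    define d where "d = min e ((Re x + 1) / 2)"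
    have d: "d > 0" using e x by (auto simp: d_def)
    define r where "r = (Re x + 1) / 2 - 1"
    define B where "B = (norm x + d) * (norm x + d + 1) / 2"
    have B: "norm (zeta_trap n y) \<le> B * real n powr (- r - 2)"
      if "n \<ge> 1" "y \<in> ball x d \<inter> ?S" for n y
    proof -
      have y: "y \<in> ?S" "dist x y < d" using that by auto
      have "\<bar>Re (x - y)\<bar> \<le> norm (x - y)" by (rule abs_Re_le_cmod)
      hence "Re y \<ge> r" using y(2) by (auto simp: d_def r_def dist_norm field_simps)
      have ny: "norm y \<le> norm x + d"
        using y(2) norm_triangle_sub[of y x] by (simp add: dist_norm norm_minus_commute)
      have ny1: "norm (y + 1) \<le> norm x + d + 1"
        using ny norm_triangle_ineq[of y 1] by simp
      have "norm (zeta_trap n y) \<le> norm (y * (y + 1)) / 2 * real n powr (- Re y - 2)"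
        using y that by (intro norm_zeta_trap_le) auto
      also have "\<dots> \<le> B * real n powr (- r - 2)"
        unfolding B_def norm_mult
        by (intro mult_mono divide_right_mono ny ny1 powr_mono) (use \<open>Re y \<ge> r\<close> that ny d in auto)
      finally show ?thesis .
    qed
    define h where "h = (\<lambda>n. complex_of_real (B * real n powr (- r - 2)))"
    have "B \<ge> 0" using d by (auto simp: B_def)
    have "summable h"
      unfolding h_def summable_of_real_iff using x
      by (intro summable_mult) (simp add: summable_real_powr_iff r_def)
    moreover have "range h \<subseteq> \<real>\<^sub>\<ge>\<^sub>0"
      using \<open>B \<ge> 0\<close> by (auto simp: h_def)
    moreover have "\<forall>\<^sub>F n in sequentially. \<forall>y\<in>ball x d \<inter> ?S. norm (zeta_trap n y) \<le> norm (h n)"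
      using eventually_ge_at_top[of 1]
    proof eventually_elim
      case (elim n)
      thus ?case using B[of n] \<open>B \<ge> 0\<close> by (auto simp: h_def norm_mult)
    qed
    ultimately show ?thesis using d by (intro exI[of _ d] exI[of _ h] conjI) auto
  qed
  obtain g where g: "\<forall>x\<in>?S. ((\<lambda>n. zeta_trap n x) sums g x) \<and> g field_differentiable (at x)"
    using series_differentiable_comparison_complex[OF op fd loc] by blast
  have "g holomorphic_on ?S"
    unfolding holomorphic_on_open[OF op] using g by (auto simp: field_differentiable_def)
  moreover have "zeta_em x = g x" if "x \<in> ?S" for x
    using g that by (auto simp: zeta_em_def sums_iff)
  ultimately show ?thesis by (subst holomorphic_cong[OF refl]) auto
qed

text \<open>The term \<open>n = 0\<close> of the trapezoidal series is exactly
  \<open>1 / 2 + 1 / (s - 1)\<close> and carries the pole. The rest stays bounded up to the pole,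
  which serves twice: for polynomial growth at large height and for removing the singularity at
  \<open>1\<close>.\<close>

lemma norm_zeta_em_diff_le:
  assumes c: "c > -1"
  obtains Z where "Z \<ge> 0"
    and "\<And>s. Re s \<ge> c \<Longrightarrow> s \<noteq> 1 \<Longrightarrow> norm (zeta_em s - (1 / 2 + 1 / (s - 1))) \<le> Z * (1 + norm s)\<^sup>2"
proof -
  define Z where "Z = (\<Sum>n. real (Suc n) powr (- c - 2))"
  have summ: "summable (\<lambda>n. real (Suc n) powr (- c - 2))"
    using c by (subst summable_Suc_iff) (simp add: summable_real_powr_iff)
  have Z0: "Z \<ge> 0" unfolding Z_def by (intro suminf_nonneg summ) auto
  show ?thesis
  proof (rule that[OF Z0])
    fix s assume s: "Re s \<ge> c" "s \<noteq> 1"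
    have sm: "summable (\<lambda>n. zeta_trap n s)" using s c by (intro summable_zeta_trap) auto
    have le: "norm (zeta_trap (Suc n) s) \<le> norm (s * (s + 1)) / 2 * real (Suc n) powr (- c - 2)" for n
    proof -
      have "norm (zeta_trap (Suc n) s) \<le> norm (s * (s + 1)) / 2 * real (Suc n) powr (- Re s - 2)"
        using s c by (intro norm_zeta_trap_le) auto
      also have "\<dots> \<le> norm (s * (s + 1)) / 2 * real (Suc n) powr (- c - 2)"
        using s by (intro mult_left_mono powr_mono) auto
      finally show ?thesis .
    qed
    have "norm (\<Sum>n. zeta_trap (Suc n) s) \<le> (\<Sum>n. norm (s * (s + 1)) / 2 * real (Suc n) powr (- c - 2))"
      by (rule norm_suminf_le[OF le]) (intro summable_mult summ)
    also have "\<dots> = Z * (norm (s * (s + 1)) / 2)"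
      unfolding Z_def by (subst suminf_mult[OF summ]) (rule mult.commute)
    also have "norm (s * (s + 1)) / 2 \<le> (1 + norm s)\<^sup>2"
    proof -
      have "norm (s * (s + 1)) \<le> (1 + norm s) * (1 + norm s)"
        unfolding norm_mult using norm_triangle_ineq[of s 1] by (intro mult_mono) auto
      thus ?thesis by (simp add: power2_eq_square) (smt (verit) norm_ge_zero)
    qed
    finally have "norm (\<Sum>n. zeta_trap (Suc n) s) \<le> Z * (1 + norm s)\<^sup>2"
      using Z0 by (simp add: mult_left_mono)
    moreover have "zeta_em s = zeta_trap 0 s + (\<Sum>n. zeta_trap (Suc n) s)"
      using suminf_split_head[OF sm] by (simp add: zeta_em_def)
    moreover have "zeta_trap 0 s = 1 / 2 + 1 / (s - 1)"
      using s by (simp add: zeta_trap_def divide_simps) (simp add: algebra_simps)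
    ultimately show "norm (zeta_em s - (1 / 2 + 1 / (s - 1))) \<le> Z * (1 + norm s)\<^sup>2" by simp
  qed
qed

lemma zeta_em_sums:
  assumes s: "Re s > 1"
  shows "(\<lambda>n. 1 / of_nat (Suc n) powr s) sums zeta_em s"
proof -
  have s1: "s \<noteq> 1" using s by auto
  have sm: "(\<lambda>n. zeta_trap n s) sums zeta_em s"
    unfolding zeta_em_def using s s1 by (intro summable_sums summable_zeta_trap) auto
  have tend: "(\<lambda>n. of_nat n powr w :: complex) \<longlonglongrightarrow> 0" if "Re w < 0" for w
  proof -
    have "(\<lambda>n. real n powr Re w) \<longlonglongrightarrow> 0"
      using that by (intro tendsto_neg_powr filterlim_real_sequentially)
    moreover have "norm (of_nat n powr w :: complex) = real n powr Re w" if "n > 0" for n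
      using that norm_powr_real_powr[of "of_nat n" w] by auto
    ultimately have "(\<lambda>n. norm (of_nat n powr w :: complex)) \<longlonglongrightarrow> 0"
      by (elim Lim_transform_eventually) (auto intro!: eventually_mono[OF eventually_gt_at_top[of 0]])
    thus ?thesis by (rule tendsto_norm_zero_cancel)
  qed
  \<comment> \<open>The integrals in \<open>zeta_trap\<close> telescope and each inner power is
    counted in two halves; what remains at the upper end tends to \<open>0\<close> for
    \<open>Re s > 1\<close>. Nothing remains at the lower end, by
    \<open>0 powr w = 0\<close>.\<close>
  have partial: "(\<Sum>k<n. 1 / of_nat (Suc k) powr s) = (\<Sum>k<n. zeta_trap k s)
      + of_nat n powr (-s) / 2 + of_nat n powr (1 - s) / (1 - s)" for n
  proof (induction n)
    case (Suc n)
    have "1 / of_nat (Suc n) powr s = of_nat (Suc n) powr (-s)"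
      by (simp add: powr_minus field_simps)
    moreover have "zeta_trap n s = of_nat n powr (-s) / 2 + of_nat (Suc n) powr (-s) / 2
        - of_nat (Suc n) powr (1 - s) / (1 - s) + of_nat n powr (1 - s) / (1 - s)"
      by (simp add: zeta_trap_def add_divide_distrib diff_divide_distrib)
    ultimately show ?case using Suc by simp
  qed auto
  have "(\<lambda>n. (\<Sum>k<n. zeta_trap k s) + of_nat n powr (-s) / 2 + of_nat n powr (1 - s) / (1 - s))
          \<longlonglongrightarrow> zeta_em s + 0 / 2 + 0 / (1 - s)"
    using s s1 by (intro tendsto_intros tend sm[unfolded sums_def]) auto
  thus ?thesis unfolding sums_def partial by simp
qed

section \<open>The functional equation on the real segment\<close>

text \<open>The logarithmic derivative of Euler's reflection formula for
  \<open>Gamma\<close>.\<close>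

lemma Digamma_reflection:
  fixes z :: complex
  assumes z: "z \<notin> \<int>"
  shows "Digamma (1 - z) - Digamma z = of_real pi * cot (of_real pi * z)"
proof -
  have z1: "z \<notin> \<int>\<^sub>\<le>\<^sub>0" "1 - z \<notin> \<int>\<^sub>\<le>\<^sub>0"
  proof -
    show "z \<notin> \<int>\<^sub>\<le>\<^sub>0" using z nonpos_Ints_Int by blast
    show "1 - z \<notin> \<int>\<^sub>\<le>\<^sub>0"
    proof
      assume "1 - z \<in> \<int>\<^sub>\<le>\<^sub>0"
      hence "1 - (1 - z) \<in> \<int>" by (intro Ints_diff Ints_1 nonpos_Ints_Int)
      thus False using z by simp
    qed
  qed
  have s0: "sin (of_real pi * z) \<noteq> 0"
  proof
    assume "sin (of_real pi * z) = 0"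
    then obtain n :: int where "of_real pi * z = of_real (of_int n * pi)"
      unfolding sin_eq_0 by auto
    hence "z = of_int n" by simp
    thus False using z by simp
  qed
  have "((\<lambda>w. Gamma w * Gamma (1 - w)) has_field_derivative
      Gamma z * Gamma (1 - z) * (Digamma z - Digamma (1 - z))) (at z)"
    using z1 by (auto intro!: derivative_eq_intros simp: algebra_simps)
  moreover have "((\<lambda>w. of_real pi / sin (of_real pi * w)) has_field_derivative
      - (of_real pi * (cos (of_real pi * z) * of_real pi) / (sin (of_real pi * z))\<^sup>2)) (at z)"
    using s0 by (auto intro!: derivative_eq_intros simp: power2_eq_square field_simps)
  ultimately have "Gamma z * Gamma (1 - z) * (Digamma z - Digamma (1 - z)) =
      - (of_real pi * (cos (of_real pi * z) * of_real pi) / (sin (of_real pi * z))\<^sup>2)"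
    unfolding Gamma_reflection_complex by (rule DERIV_unique)
  hence "Digamma z - Digamma (1 - z) =
      - (of_real pi * (cos (of_real pi * z) * of_real pi) / (sin (of_real pi * z))\<^sup>2)
        / (of_real pi / sin (of_real pi * z))"
    unfolding Gamma_reflection_complex using s0
    by (metis divide_eq_0_iff nonzero_mult_div_cancel_left of_real_eq_0_iff pi_neq_zero)
  also have "\<dots> = - (of_real pi * cot (of_real pi * z))"
    using s0 by (simp add: cot_def power2_eq_square)
  finally show ?thesis by (simp add: algebra_simps)
qed

text \<open>These are the partial fractions of the cotangent at the imaginary point
  \<open>z = \<i> x / (2 pi)\<close>; the limit is \<open>coth (x / 2) / 2 - 1 / x\<close>. They
  come from the series of \<open>Digamma (1 + z)\<close> and \<open>Digamma (1 - z)\<close>, whose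
  difference is known by reflection.\<close>

lemma coth_partial_fractions:
  fixes x :: real
  assumes x: "x > 0"
  shows "(\<lambda>k. 2 * x / (x\<^sup>2 + (2 * pi * real (Suc k))\<^sup>2)) sums
     ((1 + exp (-x)) / (2 * (1 - exp (-x))) - 1 / x)"
proof -
  define y where "y = x / (2 * pi)"
  have y: "y > 0" using x by (simp add: y_def)
  define z where "z = \<i> * of_real y"
  have zI: "z \<notin> \<int>" using y by (auto simp: z_def complex_is_Int_iff)
  have z0: "z \<noteq> 0" "1 + z \<noteq> 0" "1 - z \<noteq> 0"
    using y by (auto simp: z_def complex_eq_iff)
  have S1: "(\<lambda>k. inverse (of_nat (Suc k)) - inverse (1 + z + of_nat k)) sums (Digamma (1 + z) + euler_mascheroni)"
    using summable_sums[OF summable_Digamma[OF z0(2)]] by (simp add: Digamma_def)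
  have S2: "(\<lambda>k. inverse (of_nat (Suc k)) - inverse (1 - z + of_nat k)) sums (Digamma (1 - z) + euler_mascheroni)"
    using summable_sums[OF summable_Digamma[OF z0(3)]] by (simp add: Digamma_def)
  have "(\<lambda>k. inverse (1 + z + of_nat k) - inverse (1 - z + of_nat k)) sums (Digamma (1 - z) - Digamma (1 + z))"
    using sums_diff[OF S2 S1] by (simp add: algebra_simps)
  moreover have "Digamma (1 + z) = Digamma z + 1 / z"
    using Digamma_plus1[of z] z0 by (simp add: add.commute)
  ultimately have S: "(\<lambda>k. inverse (1 + z + of_nat k) - inverse (1 - z + of_nat k)) sums
      (of_real pi * cot (of_real pi * z) - 1 / z)"
    using Digamma_reflection[OF zI] by (simp add: algebra_simps)
  have cot: "of_real pi * cot (of_real pi * z) = -\<i> * of_real (pi * (1 + exp (-x)) / (1 - exp (-x)))"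
  proof -
    have piz: "of_real pi * z = \<i> * of_real (x / 2)" by (simp add: z_def y_def)
    have ii: "\<i> * (\<i> * of_real (x / 2)) = (of_real (- (x / 2)) :: complex)"
      by (simp flip: mult.assoc)
    have ii': "- (\<i> * (\<i> * of_real (x / 2))) = (of_real (x / 2) :: complex)"
      unfolding ii by simp
    have "exp (\<i> * (\<i> * of_real (x / 2))) = complex_of_real (exp (- (x/2)))"
         "exp (- (\<i> * (\<i> * of_real (x / 2)))) = complex_of_real (exp (x/2))"
      unfolding ii' unfolding ii by (simp_all only: exp_of_real)
    hence sc: "sin (\<i> * of_real (x / 2)) = -\<i> * of_real ((exp (-(x/2)) - exp (x/2)) / 2)"
          "cos (\<i> * of_real (x / 2)) = of_real ((exp (-(x/2)) + exp (x/2)) / 2)"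
      by (simp_all add: sin_exp_eq cos_exp_eq field_simps)
    have ne: "exp (-(x/2)) - exp (x/2) \<noteq> 0" "1 - exp (-x) \<noteq> 0" using x by auto
    have "(exp (-(x/2)) + exp (x/2)) / (exp (-(x/2)) - exp (x/2)) = - ((1 + exp (-x)) / (1 - exp (-x)))"
    proof -
      have "exp (-(x/2)) + exp (x/2) = exp (x/2) * (1 + exp (-x))"
           "exp (-(x/2)) - exp (x/2) = exp (x/2) * (exp (-x) - 1)"
        by (simp_all add: algebra_simps flip: exp_add)
      thus ?thesis using ne by (simp add: divide_simps) (simp add: algebra_simps)
    qed
    moreover have "cot (of_real pi * z) = \<i> * of_real ((exp (-(x/2)) + exp (x/2)) / (exp (-(x/2)) - exp (x/2)))"
      unfolding piz cot_def sc using ne by (simp add: divide_simps flip: of_real_add of_real_diff)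
    ultimately show ?thesis by simp
  qed
  have lim: "\<i> / of_real (2 * pi) * (of_real pi * cot (of_real pi * z) - 1 / z) =
      of_real ((1 + exp (-x)) / (2 * (1 - exp (-x))) - 1 / x)"
    unfolding cot using x by (simp add: z_def y_def field_simps)
  have tm: "\<i> / of_real (2 * pi) * (inverse (1 + z + of_nat k) - inverse (1 - z + of_nat k)) =
      of_real (2 * x / (x\<^sup>2 + (2 * pi * real (Suc k))\<^sup>2))" for k
  proof -
    define m where "m = real (Suc k)"
    have m: "m > 0" by (simp add: m_def)
    have d: "of_real m + z \<noteq> 0" "of_real m - z \<noteq> 0" using y m by (auto simp: z_def complex_eq_iff)
    have "inverse (1 + z + of_nat k) - inverse (1 - z + of_nat k) = inverse (of_real m + z) - inverse (of_real m - z)"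
      by (simp add: m_def algebra_simps)
    also have "\<dots> = - 2 * z / (of_real (m\<^sup>2) - z\<^sup>2)"
    proof -
      have "of_real (m\<^sup>2) - z\<^sup>2 = (of_real m + z) * (of_real m - z)"
        by (simp add: algebra_simps power2_eq_square)
      thus ?thesis using d by (simp add: inverse_eq_divide diff_frac_eq)
    qed
    also have "z\<^sup>2 = - of_real (y\<^sup>2)" by (simp add: z_def power_mult_distrib)
    finally have *: "inverse (1 + z + of_nat k) - inverse (1 - z + of_nat k) = - 2 * z / of_real (m\<^sup>2 + y\<^sup>2)"
      by simp
    have "\<i> / of_real (2 * pi) * (- 2 * z / of_real (m\<^sup>2 + y\<^sup>2)) = of_real (2 * y / (2 * pi * (m\<^sup>2 + y\<^sup>2)))"
      by (simp add: z_def)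
    also have "2 * y / (2 * pi * (m\<^sup>2 + y\<^sup>2)) = 2 * x / (x\<^sup>2 + (2 * pi * m)\<^sup>2)"
    proof -
      define A where "A = x\<^sup>2 + (2 * pi * m)\<^sup>2"
      have "m\<^sup>2 + y\<^sup>2 = A / (2 * pi)\<^sup>2"
        by (simp add: A_def y_def field_simps power2_eq_square)
      moreover have "A > 0" using x by (simp add: A_def add_pos_nonneg)
      ultimately have "2 * y / (2 * pi * (m\<^sup>2 + y\<^sup>2)) = 2 * x / A"
        by (simp add: y_def power2_eq_square)
      thus ?thesis by (simp add: A_def)
    qed
    finally show ?thesis unfolding * m_def .
  qed
  have "(\<lambda>k. \<i> / of_real (2 * pi) * (inverse (1 + z + of_nat k) - inverse (1 - z + of_nat k))) sums
      (\<i> / of_real (2 * pi) * (of_real pi * cot (of_real pi * z) - 1 / z))"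
    by (rule sums_mult[OF S])
  thus ?thesis unfolding lim tm by (simp only: sums_of_real_iff)
qed

section \<open>Integrals evaluated in closed form for the Tonelli argument\<close>

lemma nn_integral_Gamma_scaled:
  fixes s y :: real
  assumes s: "s > 0" and y: "y > 0"
  shows "(\<integral>\<^sup>+t. ennreal (indicator {0..} t * (t powr (s - 1) * exp (- (y * t)))) \<partial>lborel)
     = ennreal (Gamma s * y powr (- s))"
proof -
  let ?f = "\<lambda>t. ennreal (indicator {0..} t * (t powr (s - 1) * exp (- (y * t))))"
  have "(\<integral>\<^sup>+t. ?f t \<partial>lborel) = ennreal \<bar>1 / y\<bar> * (\<integral>\<^sup>+t. ?f (0 + 1 / y * t) \<partial>lborel)"
    using y by (intro nn_integral_real_affine) auto
  also have "(\<integral>\<^sup>+t. ?f (0 + 1 / y * t) \<partial>lborel) =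
      (\<integral>\<^sup>+t. ennreal (y powr (1 - s)) * ennreal (indicator {0..} t * t powr (s - 1) / exp t) \<partial>lborel)"
  proof (intro nn_integral_cong)
    fix t :: real
    show "?f (0 + 1 / y * t) = ennreal (y powr (1 - s)) * ennreal (indicator {0..} t * t powr (s - 1) / exp t)"
    proof (cases "t \<ge> 0")
      case True
      have "(t / y) powr (s - 1) = t powr (s - 1) * y powr (1 - s)"
        using True y powr_minus[of y "s - 1"] by (simp add: powr_divide field_simps)
      thus ?thesis using True y
        by (simp add: exp_minus field_simps flip: ennreal_mult)
    next
      case False
      hence "\<not> t / y \<ge> 0" using y by (simp add: divide_simps)
      thus ?thesis using False by simp
    qed
  qed
  also have "\<dots> = ennreal (y powr (1 - s)) * ennreal (Gamma s)"
    by (subst nn_integral_cmult) (auto simp: Gamma_conv_nn_integral_real[OF s])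
  also have "ennreal \<bar>1 / y\<bar> * \<dots> = ennreal (1 / y * (y powr (1 - s) * Gamma s))"
    using y Gamma_real_pos[OF s] ennreal_mult[of "y powr (1 - s)" "Gamma s"]
      ennreal_mult[of "1 / y" "y powr (1 - s) * Gamma s"] by auto
  also have "1 / y * (y powr (1 - s) * Gamma s) = Gamma s * y powr (- s)"
    using y by (simp add: powr_diff powr_minus field_simps)
  finally show ?thesis .
qed

text \<open>\<open>u (1 - u) / 2\<close> is the Peano kernel of the trapezoidal rule, here applied
  to \<open>x powr a\<close>, whose second derivative is \<open>- a (1 - a) x powr (a - 2)\<close>.
  The nonnegative integrand shows the sign of the error and prepares Tonelli.\<close>

lemma has_integral_trapezoid_remainder:
  fixes a :: real
  assumes a: "0 < a" "a < 1"
  shows "((\<lambda>u. u * (1 - u) / 2 * (real n + u) powr (a - 2)) has_integral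
     ((((real n + 1) powr (1 + a) - real n powr (1 + a)) / (1 + a) - (real n powr a + (real n + 1) powr a) / 2)
       / (a * (1 - a)))) {0..1}"
proof -
  \<comment> \<open>The antiderivative from two integrations by parts. The product
    \<open>u * (real n + u) powr (a - 1)\<close> stays grouped because for \<open>n = 0\<close> only
    the product is continuous at \<open>u = 0\<close>, where it equals \<open>u powr a\<close>; the
    derivative is taken in the interior only.\<close>
  define P where "P = (\<lambda>u. ((1 - u) * (- a / 2) * (u * (real n + u) powr (a - 1)) + (1 - 2 * u) / 2 * (real n + u) powr a
      + (real n + u) powr (1 + a) / (1 + a)) / (a * (1 - a)))"
  have c1: "continuous_on {0..1} (\<lambda>u. u * (real n + u) powr (a - 1))"
  proof (cases "n = 0")
    case True
    have c: "continuous_on {0..1} (\<lambda>u. u powr a)"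
      using a by (intro continuous_on_powr' continuous_intros) auto
    show ?thesis
    proof (rule continuous_on_eq[OF c])
      fix u :: real assume "u \<in> {0..1}"
      thus "u powr a = u * (real n + u) powr (a - 1)"
        using True by (cases "u = 0") (auto simp: powr_diff)
    qed
  next
    case False
    thus ?thesis by (intro continuous_intros) auto
  qed
  have c2: "continuous_on {0..1} (\<lambda>u. (real n + u) powr b)" if "b > 0" for b
    by (rule continuous_on_powr') (use that in \<open>auto intro!: continuous_intros\<close>)
  have "((\<lambda>u. u * (1 - u) / 2 * (real n + u) powr (a - 2)) has_integral (P 1 - P 0)) {0..1}"
  proof (rule fundamental_theorem_of_calculus_interior)
    show "continuous_on {0..1} P"
      unfolding P_def using a
      by (intro c1 c2 continuous_on_add continuous_on_mult continuous_on_divide continuous_on_diff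
          continuous_on_const continuous_on_id) auto
    fix u :: real assume u: "u \<in> {0<..<1}"
    define v where "v = real n + u"
    have v: "v > 0" using u by (auto simp: v_def)
    define k where "k = (\<lambda>b u. (real n + u) powr b)"
    have k: "(k b has_real_derivative b * v powr (b - 1)) (at u)" for b
      unfolding k_def v_def using v unfolding v_def by (auto intro!: derivative_eq_intros)
    have k1: "(k (a - 1) has_real_derivative (a - 1) * v powr (a - 2)) (at u)"
      using k[of "a - 1"] by simp
    have k3: "((\<lambda>u. k (1 + a) u / (1 + a)) has_real_derivative v powr a) (at u)"
      using DERIV_cdivide[OF k[of "1 + a"], of "1 + a"] a by simp
    have "((\<lambda>u. (1 - u) * (- a / 2) * (u * k (a - 1) u) + (1 - 2 * u) / 2 * k a u + k (1 + a) u / (1 + a))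
        has_real_derivative a * (1 - a) * (u * (1 - u) / 2 * v powr (a - 2))) (at u)"
      by (rule derivative_eq_intros k k1 k3 refl | simp)+
         (simp add: k_def v_def algebra_simps)
    from DERIV_cdivide[OF this, of "a * (1 - a)"]
    have "(P has_real_derivative u * (1 - u) / 2 * v powr (a - 2)) (at u)"
      using a unfolding P_def k_def by simp
    thus "(P has_vector_derivative u * (1 - u) / 2 * (real n + u) powr (a - 2)) (at u)"
      by (simp add: has_real_derivative_iff_has_vector_derivative v_def)
  qed simp
  also have "P 1 - P 0 = ((((real n + 1) powr (1 + a) - real n powr (1 + a)) / (1 + a) - (real n powr a + (real n + 1) powr a) / 2)
       / (a * (1 - a)))"
    by (simp add: P_def diff_divide_distrib add_divide_distrib)
  finally show ?thesis .
qed

text \<open>The Peano kernel against an exponential. The value is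
  \<open>(1 - exp (- x)) / x\<^sup>2\<close> times \<open>coth (x / 2) / 2 - 1 / x\<close>, so that
  the geometric series over \<open>exp (- x) ^ n\<close> later cancels the factor
  \<open>1 - exp (- x)\<close>.\<close>

lemma has_integral_trapezoid_exp:
  fixes x :: real
  assumes x: "x > 0"
  shows "((\<lambda>u. u * (1 - u) / 2 * exp (- (x * u))) has_integral
     (((1 + exp (-x)) / 2 - (1 - exp (-x)) / x) / x\<^sup>2)) {0..1}"
proof -
  define P where "P = (\<lambda>u. (- (u * (1 - u) / 2 * x) - (1 - 2 * u) / 2 + 1 / x) * exp (- (x * u)) / x\<^sup>2)"
  have "((\<lambda>u. u * (1 - u) / 2 * exp (- (x * u))) has_integral (P 1 - P 0)) {0..1}"
  proof (rule fundamental_theorem_of_calculus)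
    fix u :: real
    have "(P has_real_derivative u * (1 - u) / 2 * exp (- (x * u))) (at u within {0..1})"
      unfolding P_def using x
      by (auto intro!: derivative_eq_intros simp: field_simps power2_eq_square)
    thus "(P has_vector_derivative u * (1 - u) / 2 * exp (- (x * u))) (at u within {0..1})"
      by (simp add: has_real_derivative_iff_has_vector_derivative)
  qed simp
  also have "P 1 - P 0 = (((1 + exp (-x)) / 2 - (1 - exp (-x)) / x) / x\<^sup>2)"
    using x by (simp add: P_def field_simps)
  finally show ?thesis .
qed

text \<open>The substitution \<open>t = c^2 / (c^2 + x^2)\<close> turns the integral into
  \<open>Beta p q\<close> with \<open>p + q = 1\<close>, which reflection evaluates as
  \<open>pi / sin (pi p)\<close>. The case \<open>a = 0\<close>, \<open>c = 1\<close> is used again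
  for the integrability of \<open>1 / (1 + x^2)\<close>.\<close>

lemma nn_integral_Beta_rational:
  fixes a c :: real
  assumes a: "-1 < a" "a < 1" and c: "c > 0"
  shows "(\<integral>\<^sup>+x. ennreal (indicator {0<..} x * (2 * x powr (-a) / (x\<^sup>2 + c\<^sup>2))) \<partial>lborel)
     = ennreal (c powr (- a - 1) * pi / cos (pi * a / 2))"
proof -
  define p where "p = (1 + a) / 2"
  define q where "q = (1 - a) / 2"
  have pq: "p > 0" "q > 0" "p + q = 1" using a by (auto simp: p_def q_def field_simps)
  define g where "g = (\<lambda>x::real. c\<^sup>2 / (c\<^sup>2 + x\<^sup>2))"
  define g' where "g' = (\<lambda>x::real. - (2 * x * c\<^sup>2) / (c\<^sup>2 + x\<^sup>2)\<^sup>2)"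
  define f where "f = (\<lambda>t::real. t powr (p - 1) * (1 - t) powr (q - 1))"
  have pos: "c\<^sup>2 + x\<^sup>2 > 0" for x using c by (simp add: add_pos_nonneg)
  have img: "g ` {0<..} = {0<..<1}"
  proof (intro equalityI subsetI)
    fix t assume "t \<in> g ` {0<..}"
    thus "t \<in> {0<..<1}" using c pos by (auto simp: g_def divide_simps)
  next
    fix t :: real assume t: "t \<in> {0<..<1}"
    have "c * sqrt ((1 - t) / t) \<in> {0<..}" using t c by auto
    moreover have "g (c * sqrt ((1 - t) / t)) = t"
    proof -
      have "c\<^sup>2 + (c * sqrt ((1 - t) / t))\<^sup>2 = c\<^sup>2 / t"
        using t by (simp add: power_mult_distrib field_simps)
      thus ?thesis using c t by (simp add: g_def)
    qed
    ultimately show "t \<in> g ` {0<..}" by (metis image_eqI)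
  qed
  have "f integrable_on {0..1}" "integral {0..1} f = Beta p q"
    using has_integral_Beta_real[OF pq(1,2)] unfolding f_def
    by (auto simp: integrable_on_def integral_unique)
  hence fi: "(f has_integral Beta p q) {0<..<1}"
    using has_integral_open_interval[of f "Beta p q" 0 1] by (auto simp: has_integral_iff)
  have fa: "f absolutely_integrable_on {0<..<1}"
    using fi by (intro nonnegative_absolutely_integrable_1) (auto simp: f_def)
  have "(\<lambda>x. \<bar>g' x\<bar> * f (g x)) absolutely_integrable_on {0<..} \<and>
        integral {0<..} (\<lambda>x. \<bar>g' x\<bar> * f (g x)) = Beta p q"
  proof (rule has_absolute_integral_change_of_variables_1'[of "{0<..}" g g' f "Beta p q", THEN iffD2])
    show "(g has_field_derivative g' x) (at x within {0<..})" for x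
      unfolding g_def g'_def using pos[of x] c
      by (auto intro!: derivative_eq_intros simp: power2_eq_square field_simps)
    show "inj_on g {0<..}"
    proof (rule inj_onI)
      fix x y :: real assume "x \<in> {0<..}" "y \<in> {0<..}" "g x = g y"
      hence "c\<^sup>2 * (c\<^sup>2 + x\<^sup>2) = c\<^sup>2 * (c\<^sup>2 + y\<^sup>2)" using pos[of x] pos[of y]
        unfolding g_def by (simp add: field_simps)
      hence "x\<^sup>2 = y\<^sup>2" using c by simp
      thus "x = y" using \<open>x \<in> _\<close> \<open>y \<in> _\<close> by (simp add: power2_eq_iff)
    qed
    show "f absolutely_integrable_on g ` {0<..} \<and> integral (g ` {0<..}) f = Beta p q"
      using fa fi img by (auto simp: integral_unique)
  qed auto
  hence hi: "((\<lambda>x. \<bar>g' x\<bar> * f (g x)) has_integral Beta p q) {0<..}"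
    by (auto simp: has_integral_iff set_lebesgue_integral_eq_integral(1))
  have eq: "\<bar>g' x\<bar> * f (g x) = c powr (1 + a) * (2 * x powr (-a) / (x\<^sup>2 + c\<^sup>2))" if x: "x > 0" for x
  proof -
    define D where "D = c\<^sup>2 + x\<^sup>2"
    have D: "D > 0" using pos[of x] unfolding D_def .
    have 1: "1 - g x = x\<^sup>2 / D" using D x c by (simp add: g_def D_def divide_simps)
    have 2: "g x = c\<^sup>2 / D" by (simp add: g_def D_def)
    have sq: "(w\<^sup>2) powr r = w powr (2 * r)" if "w > 0" for w r :: real
      using that by (simp add: powr_powr flip: powr_numeral)
    have "f (g x) = (c powr (2 * (p - 1)) / D powr (p - 1)) * (x powr (2 * (q - 1)) / D powr (q - 1))"
      unfolding f_def 1 unfolding 2 using D c x by (simp add: powr_divide sq)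
    also have "\<dots> = c powr (a - 1) * x powr (- a - 1) * (1 / (D powr (p - 1) * D powr (q - 1)))"
    proof -
      have "2 * (p - 1) = a - 1" "2 * (q - 1) = - a - 1" by (simp_all add: p_def q_def)
      thus ?thesis by (simp only: times_divide_times_eq mult_1_right) simp
    qed
    also have "D powr (p - 1) * D powr (q - 1) = 1 / D"
    proof -
      have "D powr (p - 1) * D powr (q - 1) = D powr (p + q - 2)" by (simp flip: powr_add)
      also have "\<dots> = D powr (- 1)" using pq by simp
      finally show ?thesis using D by (simp add: powr_minus_divide)
    qed
    finally have "f (g x) = c powr (a - 1) * x powr (- a - 1) * D" by simp
    moreover have "\<bar>g' x\<bar> = 2 * x * c\<^sup>2 / D\<^sup>2" using x by (simp add: g'_def D_def abs_mult)
    moreover have "c powr (1 + a) = c\<^sup>2 * c powr (a - 1)"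
      using c by (simp add: powr_add powr_diff power2_eq_square)
    moreover have "x powr (- a) = x * x powr (- a - 1)"
      using x by (simp add: powr_diff)
    moreover have "x\<^sup>2 + c\<^sup>2 = D" by (simp add: D_def add.commute)
    ultimately show ?thesis using D by (simp add: power2_eq_square)
  qed
  have "((\<lambda>x. c powr (1 + a) * (2 * x powr (-a) / (x\<^sup>2 + c\<^sup>2))) has_integral Beta p q) {0<..}"
    by (rule has_integral_eq[OF _ hi]) (use eq in auto)
  hence "((\<lambda>x. c powr (- a - 1) * (c powr (1 + a) * (2 * x powr (-a) / (x\<^sup>2 + c\<^sup>2)))) has_integral
      (c powr (- a - 1) * Beta p q)) {0<..}"
    by (rule has_integral_mult_right)
  moreover have "c powr (- a - 1) * (c powr (1 + a) * r) = r" for r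
    using c by (simp add: powr_diff powr_add powr_minus field_simps)
  ultimately have "((\<lambda>x. 2 * x powr (-a) / (x\<^sup>2 + c\<^sup>2)) has_integral (c powr (- a - 1) * Beta p q)) {0<..}"
    by simp
  hence "(\<integral>\<^sup>+x. ennreal (indicator {0<..} x * (2 * x powr (-a) / (x\<^sup>2 + c\<^sup>2))) \<partial>lborel)
      = ennreal (c powr (- a - 1) * Beta p q)"
    by (intro nn_integral_has_integral_lebesgue) auto
  also have "Beta p q = pi / cos (pi * a / 2)"
  proof -
    have "complex_of_real (Gamma p * Gamma q) = Gamma (of_real p) * Gamma (1 - of_real p)"
    proof -
      have "q = 1 - p" using pq by simp
      thus ?thesis by (simp flip: Gamma_complex_of_real)
    qed
    also have "\<dots> = of_real (pi / sin (pi * p))"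
      by (subst Gamma_reflection_complex) (simp flip: sin_of_real)
    finally have "Gamma p * Gamma q = pi / sin (pi * p)" by (simp only: of_real_eq_iff)
    moreover have "sin (pi * p) = cos (pi * a / 2)"
      using sin_add[of "pi / 2" "pi * a / 2"] by (simp add: p_def field_simps)
    ultimately show ?thesis using pq by (simp add: Beta_def)
  qed
  finally show ?thesis by simp
qed


text \<open>
  Two iterated integrals of \<open>x\<^sup>1\<^sup>-\<^sup>a u (1 - u) / 2 exp (- (n + u) x)\<close>, summed over \<open>n\<close>: integrating over
  \<open>x\<close> first gives the trapezoidal errors at \<open>s = - a\<close>, integrating over \<open>u\<close> first gives
  \<open>x\<^sup>-\<^sup>a\<^sup>-\<^sup>1 (coth (x / 2) / 2 - 1 / x)\<close>, whose partial fractions integrate to the terms of \<open>\<zeta>(1 + a)\<close>.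
\<close>

lemma zeta_em_reflection_real:
  fixes a :: real
  assumes a: "0 < a" "a < 1"
  shows "zeta_em (of_real (- a)) * of_real (Gamma (2 - a)) =
     - (of_real (a * (1 - a) * (2 * pi) powr (- a - 1) * pi / cos (pi * a / 2)) * zeta_em (of_real (1 + a)))"
proof -
  define t where "t = (\<lambda>n. ((real n + 1) powr (1 + a) - real n powr (1 + a)) / (1 + a)
      - (real n powr a + (real n + 1) powr a) / 2)"
  define R where "R = (\<lambda>n u. u * (1 - u) / 2 * (real n + u) powr (a - 2))"
  define G where "G = (\<lambda>x::real. (1 + exp (-x)) / (2 * (1 - exp (-x))) - 1 / x)"
  define W where "W = (\<lambda>n u x. ennreal (indicator {0..1} u * (u * (1 - u) / 2)) *
      ennreal (indicator {0<..} x * (x powr (1 - a) * exp (- ((real n + u) * x)))))"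
  define V where "V = (\<lambda>k x. ennreal (indicator {0<..} x * (2 * x powr (-a) / (x\<^sup>2 + (2 * pi * real (Suc k))\<^sup>2))))"
  have aa: "a * (1 - a) > 0" using a by simp
  have R_int: "(R n has_integral (t n / (a * (1 - a)))) {0..1}" for n
    using has_integral_trapezoid_remainder[OF a, of n] by (simp add: R_def t_def)
  have R_nn: "R n u \<ge> 0" if "u \<in> {0..1}" for n u
    using that by (auto simp: R_def)
  have t_nn: "t n \<ge> 0" for n
  proof -
    have "t n / (a * (1 - a)) \<ge> 0" using has_integral_nonneg[OF R_int R_nn] .
    thus ?thesis using aa by (simp add: zero_le_divide_iff)
  qed
  have zt: "zeta_trap n (of_real (- a)) = of_real (- t n)" for n
  proof -
    have "complex_of_real (real n) powr of_real b = of_real (real n powr b)" for b n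
      by (rule powr_of_real) auto
    from this[of n a] this[of "Suc n" a] this[of n "1 + a"] this[of "Suc n" "1 + a"]
    show ?thesis by (simp add: zeta_trap_def t_def add.commute)
  qed
  have t_sums: "t sums (- Re (zeta_em (of_real (- a))))" and z_real: "zeta_em (of_real (- a)) = of_real (Re (zeta_em (of_real (- a))))"
  proof -
    have "summable (\<lambda>n. zeta_trap n (of_real (- a)))"
      using a by (intro summable_zeta_trap) (auto simp: complex_eq_iff)
    hence "(\<lambda>n. of_real (- t n)) sums zeta_em (of_real (- a))"
      unfolding zt zeta_em_def by (rule summable_sums)
    from sums_Re[OF this] sums_Im[OF this]
    have 1: "(\<lambda>n. - t n) sums Re (zeta_em (of_real (- a)))" and 2: "(\<lambda>n. 0) sums Im (zeta_em (of_real (- a)))"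
      by simp_all
    show "t sums (- Re (zeta_em (of_real (- a))))" using sums_minus[OF 1] by simp
    show "zeta_em (of_real (- a)) = of_real (Re (zeta_em (of_real (- a))))"
      using 2 by (simp add: complex_eq_iff sums_iff)
  qed
  have G_sums: "(\<lambda>k. 2 * x / (x\<^sup>2 + (2 * pi * real (Suc k))\<^sup>2)) sums G x" if "x > 0" for x
    using coth_partial_fractions[OF that] by (simp add: G_def)

  have W_x: "(\<integral>\<^sup>+x. W n u x \<partial>lborel) = ennreal (Gamma (2 - a)) * ennreal (indicator {0..1} u * R n u)" for n u
  proof (cases "u \<in> {0..1} \<and> u \<noteq> 0")
    case True
    have "(\<integral>\<^sup>+x. W n u x \<partial>lborel) = ennreal (indicator {0..1} u * (u * (1 - u) / 2)) *
        (\<integral>\<^sup>+x. ennreal (indicator {0<..} x * (x powr (1 - a) * exp (- ((real n + u) * x)))) \<partial>lborel)"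
      unfolding W_def by (rule nn_integral_cmult) auto
    also have "(\<integral>\<^sup>+x. ennreal (indicator {0<..} x * (x powr (1 - a) * exp (- ((real n + u) * x)))) \<partial>lborel)
        = (\<integral>\<^sup>+x. ennreal (indicator {0..} x * (x powr ((2 - a) - 1) * exp (- ((real n + u) * x)))) \<partial>lborel)"
      by (intro nn_integral_cong arg_cong[where f = ennreal]) (auto simp: indicator_def)
    also have "\<dots> = ennreal (Gamma (2 - a) * (real n + u) powr (- (2 - a)))"
      using a True by (intro nn_integral_Gamma_scaled) (auto simp: add_nonneg_pos)
    also have "ennreal (indicator {0..1} u * (u * (1 - u) / 2)) * \<dots> =
        ennreal (Gamma (2 - a)) * ennreal (indicator {0..1} u * R n u)"
      using True a Gamma_real_pos[of "2 - a"] by (simp add: R_def mult_ac flip: ennreal_mult)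
    finally show ?thesis .
  next
    case False
    hence "u \<notin> {0..1} \<or> u = 0" by blast
    thus ?thesis by (auto simp: W_def R_def)
  qed
  have W_ux: "(\<integral>\<^sup>+u. (\<integral>\<^sup>+x. W n u x \<partial>lborel) \<partial>lborel) = ennreal (Gamma (2 - a) / (a * (1 - a))) * ennreal (t n)" for n
  proof -
    have m: "(\<lambda>u. ennreal (indicator {0..1} u * R n u)) \<in> borel_measurable lborel"
      unfolding R_def by measurable
    have "(\<integral>\<^sup>+u. (\<integral>\<^sup>+x. W n u x \<partial>lborel) \<partial>lborel) =
        ennreal (Gamma (2 - a)) * (\<integral>\<^sup>+u. ennreal (indicator {0..1} u * R n u) \<partial>lborel)"
      unfolding W_x by (rule nn_integral_cmult[OF m])
    also have "(\<integral>\<^sup>+u. ennreal (indicator {0..1} u * R n u) \<partial>lborel) = ennreal (t n / (a * (1 - a)))"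
      using nn_integral_has_integral_lebesgue[OF R_nn R_int] .
    also have "ennreal (Gamma (2 - a)) * \<dots> = ennreal (Gamma (2 - a) / (a * (1 - a))) * ennreal (t n)"
      using a aa t_nn[of n] Gamma_real_pos[of "2 - a"] by (simp flip: ennreal_mult)
    finally show ?thesis .
  qed
  have W_u: "(\<integral>\<^sup>+u. W n u x \<partial>lborel) = ennreal (indicator {0<..} x * (x powr (- a - 1) *
      ((1 + exp (-x)) / 2 - (1 - exp (-x)) / x))) * ennreal (exp (- x) ^ n)" for n x
  proof (cases "x > 0")
    case True
    have "(\<integral>\<^sup>+u. W n u x \<partial>lborel) = (\<integral>\<^sup>+u. ennreal (x powr (1 - a) * exp (-x) ^ n) *
        ennreal (indicator {0..1} u * (u * (1 - u) / 2 * exp (- (x * u)))) \<partial>lborel)"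
    proof (intro nn_integral_cong)
      fix u :: real
      have e: "exp (- ((real n + u) * x)) = exp (-x) ^ n * exp (- (x * u))"
      proof -
        have "- ((real n + u) * x) = of_nat n * (- x) + - (x * u)" by (simp add: algebra_simps)
        thus ?thesis by (simp only: exp_add exp_of_nat_mult)
      qed
      show "W n u x = ennreal (x powr (1 - a) * exp (-x) ^ n) *
          ennreal (indicator {0..1} u * (u * (1 - u) / 2 * exp (- (x * u))))"
        unfolding W_def e using True
        by (cases "u \<in> {0..1}") (simp_all add: mult_ac flip: ennreal_mult)
    qed
    also have "\<dots> = ennreal (x powr (1 - a) * exp (-x) ^ n) *
        (\<integral>\<^sup>+u. ennreal (indicator {0..1} u * (u * (1 - u) / 2 * exp (- (x * u)))) \<partial>lborel)"
      by (rule nn_integral_cmult) auto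
    also have "(\<integral>\<^sup>+u. ennreal (indicator {0..1} u * (u * (1 - u) / 2 * exp (- (x * u)))) \<partial>lborel)
        = ennreal (((1 + exp (-x)) / 2 - (1 - exp (-x)) / x) / x\<^sup>2)"
      by (rule nn_integral_has_integral_lebesgue[OF _ has_integral_trapezoid_exp[OF True]]) auto
    also have "ennreal (x powr (1 - a) * exp (-x) ^ n) * \<dots> =
        ennreal (x powr (- a - 1) * ((1 + exp (-x)) / 2 - (1 - exp (-x)) / x)) * ennreal (exp (- x) ^ n)"
    proof -
      have nn: "((1 + exp (-x)) / 2 - (1 - exp (-x)) / x) / x\<^sup>2 \<ge> 0"
        by (rule has_integral_nonneg[OF has_integral_trapezoid_exp[OF True]]) auto
      hence nn': "(1 + exp (-x)) / 2 - (1 - exp (-x)) / x \<ge> 0"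
        using True by (simp add: zero_le_divide_iff)
      have "x powr (1 - a) = x powr (- a - 1) * x\<^sup>2"
        using True powr_add[of x "- a - 1" 2] by (simp add: powr_numeral)
      thus ?thesis using True nn nn' by (simp add: mult_ac flip: ennreal_mult)
    qed
    finally show ?thesis using True by simp
  qed (simp add: W_def)
  have V_sum: "(\<Sum>n. \<integral>\<^sup>+u. W n u x \<partial>lborel) = (\<Sum>k. V k x)" for x
  proof (cases "x > 0")
    case True
    have nn: "(1 + exp (-x)) / 2 - (1 - exp (-x)) / x \<ge> 0"
    proof -
      have "((1 + exp (-x)) / 2 - (1 - exp (-x)) / x) / x\<^sup>2 \<ge> 0"
        by (rule has_integral_nonneg[OF has_integral_trapezoid_exp[OF True]]) auto
      thus ?thesis using True by (simp add: zero_le_divide_iff)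
    qed
    define A where "A = x powr (- a - 1) * ((1 + exp (-x)) / 2 - (1 - exp (-x)) / x)"
    have A: "A \<ge> 0" using nn by (simp add: A_def)
    have q: "norm (exp (- x)) < 1" "1 - exp (- x) > 0" using True by auto
    have "(\<lambda>n. A * exp (-x) ^ n) sums (A * (1 / (1 - exp (- x))))"
      by (intro sums_mult geometric_sums q)
    also have "A * (1 / (1 - exp (-x))) = x powr (- a - 1) * G x"
      using q by (simp add: A_def G_def field_simps)
    finally have s1: "(\<lambda>n. A * exp (-x) ^ n) sums (x powr (- a - 1) * G x)" .
    have "(\<Sum>n. \<integral>\<^sup>+u. W n u x \<partial>lborel) = (\<Sum>n. ennreal (A * exp (-x) ^ n))"
      unfolding W_u using True A by (simp add: A_def flip: ennreal_mult)
    also have "\<dots> = ennreal (x powr (- a - 1) * G x)"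
      using A by (intro suminf_ennreal_eq s1) auto
    also have "\<dots> = (\<Sum>k. ennreal (x powr (- a - 1) * (2 * x / (x\<^sup>2 + (2 * pi * real (Suc k))\<^sup>2))))"
      using True by (intro suminf_ennreal_eq[symmetric] sums_mult G_sums) auto
    also have "\<dots> = (\<Sum>k. V k x)"
    proof -
      have "x powr (- a) = x powr (- a - 1) * x" using True by (simp add: powr_diff)
      thus ?thesis using True by (simp add: V_def mult_ac)
    qed
    finally show ?thesis .
  qed (simp add: W_def V_def)
  have V_x: "(\<integral>\<^sup>+x. V k x \<partial>lborel) = ennreal ((2 * pi) powr (- a - 1) * pi / cos (pi * a / 2) * real (Suc k) powr (- a - 1))" for k
  proof -
    have "(\<integral>\<^sup>+x. V k x \<partial>lborel) = ennreal ((2 * pi * real (Suc k)) powr (- a - 1) * pi / cos (pi * a / 2))"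
      unfolding V_def by (rule nn_integral_Beta_rational) (use a in auto)
    also have "(2 * pi * real (Suc k)) powr (- a - 1) = (2 * pi) powr (- a - 1) * real (Suc k) powr (- a - 1)"
      by (rule powr_mult)
    finally show ?thesis by (simp add: mult_ac)
  qed
  have cpos: "cos (pi * a / 2) > 0"
  proof (rule cos_gt_zero_pi)
    show "- (pi / 2) < pi * a / 2" using a pi_gt_zero by (smt (verit) mult_pos_pos divide_pos_pos)
    show "pi * a / 2 < pi / 2" using a pi_gt_zero by simp
  qed
  define K where "K = (2 * pi) powr (- a - 1) * pi / cos (pi * a / 2)"
  have K: "K \<ge> 0" using cpos by (simp add: K_def)
  have z1: "(\<lambda>k. real (Suc k) powr (- a - 1)) sums Re (zeta_em (of_real (1 + a)))"
    and z1_real: "zeta_em (of_real (1 + a)) = of_real (Re (zeta_em (of_real (1 + a))))"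
  proof -
    have "1 / of_nat (Suc k) powr (of_real (1 + a)) = complex_of_real (real (Suc k) powr (- a - 1))" for k
    proof -
      have "complex_of_real (real (Suc k)) powr of_real (1 + a) = of_real (real (Suc k) powr (1 + a))"
        by (rule powr_of_real) auto
      moreover have "- a - 1 = - (1 + a)" by simp
      hence "real (Suc k) powr (- a - 1) = 1 / real (Suc k) powr (1 + a)"
        by (simp only: powr_minus_divide)
      ultimately show ?thesis by simp
    qed
    hence "(\<lambda>k. of_real (real (Suc k) powr (- a - 1))) sums zeta_em (of_real (1 + a))"
      using zeta_em_sums[of "of_real (1 + a)"] a by simp
    from sums_Re[OF this] sums_Im[OF this]
    have 1: "(\<lambda>k. real (Suc k) powr (- a - 1)) sums Re (zeta_em (of_real (1 + a)))"
      and 2: "(\<lambda>n. 0) sums Im (zeta_em (of_real (1 + a)))" by simp_all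
    show "(\<lambda>k. real (Suc k) powr (- a - 1)) sums Re (zeta_em (of_real (1 + a)))" by fact
    show "zeta_em (of_real (1 + a)) = of_real (Re (zeta_em (of_real (1 + a))))"
      using 2 by (simp add: complex_eq_iff sums_iff)
  qed
  have W_meas [measurable]: "case_prod (W n) \<in> borel_measurable (lborel \<Otimes>\<^sub>M lborel)" for n
    unfolding W_def by measurable
  have V_meas [measurable]: "V k \<in> borel_measurable lborel" for k
    unfolding V_def by measurable
  \<comment> \<open>All functions are nonnegative, so in \<open>ennreal\<close> sums and integrals
    may be exchanged freely; the two ends of the chain are finite by the convergent series
    \<open>t_sums\<close> and \<open>z1\<close>.\<close>
  have "ennreal (Gamma (2 - a) / (a * (1 - a)) * - Re (zeta_em (of_real (- a)))) =
      (\<Sum>n. ennreal (Gamma (2 - a) / (a * (1 - a)) * t n))"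
    using a aa t_nn Gamma_real_pos[of "2 - a"]
    by (intro suminf_ennreal_eq[symmetric] sums_mult t_sums) auto
  also have "\<dots> = (\<Sum>n. \<integral>\<^sup>+u. (\<integral>\<^sup>+x. W n u x \<partial>lborel) \<partial>lborel)"
    unfolding W_ux by (intro suminf_cong ennreal_mult t_nn) (use a aa Gamma_real_pos[of "2 - a"] in auto)
  also have "\<dots> = (\<Sum>n. \<integral>\<^sup>+x. (\<integral>\<^sup>+u. W n u x \<partial>lborel) \<partial>lborel)"
    by (intro suminf_cong lborel_pair.Fubini'[symmetric]) (use W_meas in \<open>simp add: case_prod_unfold\<close>)
  also have "\<dots> = (\<integral>\<^sup>+x. (\<Sum>n. \<integral>\<^sup>+u. W n u x \<partial>lborel) \<partial>lborel)"
    by (intro nn_integral_suminf[symmetric]) (simp add: W_u)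
  also have "\<dots> = (\<Sum>k. \<integral>\<^sup>+x. V k x \<partial>lborel)"
    unfolding V_sum by (intro nn_integral_suminf V_meas)
  also have "\<dots> = (\<Sum>k. ennreal (K * real (Suc k) powr (- a - 1)))"
    unfolding V_x K_def ..
  also have "\<dots> = ennreal (K * Re (zeta_em (of_real (1 + a))))"
    using K by (intro suminf_ennreal_eq sums_mult z1) auto
  finally have eq: "Gamma (2 - a) / (a * (1 - a)) * - Re (zeta_em (of_real (- a))) = K * Re (zeta_em (of_real (1 + a)))"
  proof (subst (asm) ennreal_inj)
    have "- Re (zeta_em (of_real (- a))) \<ge> 0"
      using sums_le[OF _ sums_zero t_sums] t_nn by auto
    thus "0 \<le> Gamma (2 - a) / (a * (1 - a)) * - Re (zeta_em (of_real (- a)))"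
      using a aa Gamma_real_pos[of "2 - a"] by (intro mult_nonneg_nonneg) auto
    have "Re (zeta_em (of_real (1 + a))) \<ge> 0"
      using sums_le[OF _ sums_zero z1] by auto
    thus "0 \<le> K * Re (zeta_em (of_real (1 + a)))" using K by simp
  qed
  have "Re (zeta_em (of_real (- a))) * Gamma (2 - a) =
      - (a * (1 - a) * (Gamma (2 - a) / (a * (1 - a)) * - Re (zeta_em (of_real (- a)))))"
    using a by simp
  also have "\<dots> = - (a * (1 - a) * K * Re (zeta_em (of_real (1 + a))))"
    unfolding eq by simp
  finally have "Re (zeta_em (of_real (- a))) * Gamma (2 - a) =
      - (a * (1 - a) * K * Re (zeta_em (of_real (1 + a))))" .
  thus ?thesis
    unfolding K_def
    by (subst z_real, subst z1_real) (simp only: of_real_mult[symmetric] of_real_minus[symmetric] of_real_eq_iff mult.assoc times_divide_eq_right)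
qed

section \<open>The zeta function on the whole plane\<close>

text \<open>The right side of Riemann's functional equation, read as a definition of zeta in the
  left half-plane. At \<open>s = 0\<close> the factor \<open>zeta_em (1 - s)\<close> meets its pole,
  so this point is excluded from the statements about it.\<close>

definition zeta_reflected :: "complex \<Rightarrow> complex" where
  "zeta_reflected s =
     2 * of_real (2 * pi) powr (s - 1) * sin (of_real pi * s / 2) * Gamma (1 - s) * zeta_em (1 - s)"

lemma holomorphic_zeta_reflected: "zeta_reflected holomorphic_on ({s. Re s < 1} - {0})"
proof -
  have 1: "(\<lambda>s. zeta_em (1 - s)) holomorphic_on ({s. Re s < 1} - {0})"
    by (rule holomorphic_on_compose_gen[OF _ holomorphic_zeta_em, unfolded o_def])
       (auto intro!: holomorphic_intros)
  have 2: "(\<lambda>s. Gamma (1 - s)) holomorphic_on ({s. Re s < 1} - {0})"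
    by (intro holomorphic_intros) (auto elim!: nonpos_Ints_cases simp: complex_eq_iff)
  have 3: "(\<lambda>s. 2 * of_real (2 * pi) powr (s - 1) * sin (of_real pi * s / 2)) holomorphic_on
      ({s. Re s < 1} - {0})"
    by (intro holomorphic_intros) auto
  show ?thesis
    unfolding zeta_reflected_def by (rule holomorphic_on_mult[OF holomorphic_on_mult[OF 3 2] 1])
qed

text \<open>Reflection, with \<open>sin (pi a) = 2 S C\<close>, trades \<open>cos\<close> in the
  denominator and \<open>Gamma (2 - a)\<close> on the left for \<open>sin\<close> and
  \<open>Gamma (1 + a)\<close>: the usual shape of the functional equation at
  \<open>s = - a\<close>.\<close>

lemma zeta_em_eq_reflected_real:
  fixes a :: real
  assumes a: "0 < a" "a < 1"
  shows "zeta_em (of_real (- a)) = zeta_reflected (of_real (- a))"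
proof -
  define S where "S = sin (pi * a / 2)"
  define C where "C = cos (pi * a / 2)"
  have bnd: "0 < pi * a / 2" "pi * a / 2 < pi / 2"
    using a pi_gt_zero by auto
  have S: "S > 0" unfolding S_def using bnd by (intro sin_gt_zero) auto
  have C: "C > 0" unfolding C_def using bnd by (intro cos_gt_zero) auto
  have "Gamma a * Gamma (1 - a) = pi / sin (pi * a)"
  proof -
    have "complex_of_real (Gamma a * Gamma (1 - a)) = Gamma (of_real a) * Gamma (1 - of_real a)"
      by (simp flip: Gamma_complex_of_real)
    also have "\<dots> = of_real (pi / sin (pi * a))"
      by (subst Gamma_reflection_complex) (simp flip: sin_of_real)
    finally show ?thesis by (simp only: of_real_eq_iff)
  qed
  also have "sin (pi * a) = 2 * S * C"
    using sin_double[of "pi * a / 2"] by (simp add: S_def C_def)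
  finally have refl: "Gamma a * Gamma (1 - a) = pi / (2 * S * C)" .
  have G1: "Gamma (1 + a) = a * Gamma a"
    using Gamma_plus1[of a] a nonpos_Ints_nonpos[of a] by (auto simp: add.commute)
  have G2: "Gamma (2 - a) = (1 - a) * Gamma (1 - a)"
    using Gamma_plus1[of "1 - a"] a nonpos_Ints_nonpos[of "1 - a"] by (auto simp: add.commute)
  have G2_pos: "Gamma (2 - a) > 0" using a by (intro Gamma_real_pos) auto
  have "2 * S * Gamma (1 + a) * Gamma (2 - a) = 2 * S * (a * (1 - a)) * (Gamma a * Gamma (1 - a))"
    by (simp add: G1 G2)
  also have "\<dots> = a * (1 - a) * pi / C"
    unfolding refl using S by simp
  finally have key: "a * (1 - a) * pi / C = 2 * S * Gamma (1 + a) * Gamma (2 - a)" ..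
  define P where "P = (2 * pi) powr (- a - 1)"
  have "zeta_em (of_real (- a)) * of_real (Gamma (2 - a)) =
      - (of_real (P * (a * (1 - a) * pi / C)) * zeta_em (of_real (1 + a)))"
    using zeta_em_reflection_real[OF a] by (simp add: P_def C_def mult_ac)
  also have "\<dots> = - (of_real (2 * P * S * Gamma (1 + a)) * zeta_em (of_real (1 + a))) * of_real (Gamma (2 - a))"
    unfolding key by (simp add: mult_ac)
  finally have "zeta_em (of_real (- a)) = - (of_real (2 * P * S * Gamma (1 + a)) * zeta_em (of_real (1 + a)))"
    using G2_pos by (metis less_irrefl mult_cancel_right of_real_eq_0_iff)
  also have "\<dots> = zeta_reflected (of_real (- a))"
  proof -
    have "complex_of_real (2 * pi) powr (of_real (- a) - 1) = of_real P"
      using powr_of_real[of "2 * pi" "- a - 1"] by (simp add: P_def)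
    moreover have "sin (of_real pi * of_real (- a) / 2) = - complex_of_real S"
      by (simp add: S_def flip: sin_of_real)
    moreover have "Gamma (1 - complex_of_real (- a)) = of_real (Gamma (1 + a))"
      by (simp flip: Gamma_complex_of_real)
    ultimately show ?thesis unfolding zeta_reflected_def by simp
  qed
  finally show ?thesis .
qed

text \<open>Identity theorem on the punctured strip, starting from the real segment between
  \<open>-1\<close> and \<open>0\<close>. The puncture leaves the strip connected, so the equation
  crosses over to \<open>Re s > 0\<close>.\<close>

lemma zeta_em_eq_reflected:
  assumes s: "-1 < Re s" "Re s < 1" "s \<noteq> 0"
  shows "zeta_em s = zeta_reflected s"
proof -
  define D where "D = ({s. Re s > -1} \<inter> {s. Re s < 1}) - {0::complex}"
  define U where "U = (\<lambda>x. complex_of_real x) ` {-1<..<0}"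
  have "zeta_em s - zeta_reflected s = 0"
  proof (rule analytic_continuation[of "\<lambda>s. zeta_em s - zeta_reflected s" D U "of_real (-1/2)"])
    have "zeta_em holomorphic_on D"
      by (rule holomorphic_on_subset[OF holomorphic_zeta_em]) (auto simp: D_def)
    moreover have "zeta_reflected holomorphic_on D"
      by (rule holomorphic_on_subset[OF holomorphic_zeta_reflected]) (auto simp: D_def)
    ultimately show "(\<lambda>s. zeta_em s - zeta_reflected s) holomorphic_on D"
      by (intro holomorphic_intros)
    show "open D"
      unfolding D_def by (intro open_Diff open_Int open_halfspace_Re_gt open_halfspace_Re_lt) auto
    show "connected D"
      unfolding D_def
      by (intro connected_open_delete open_Int open_halfspace_Re_gt open_halfspace_Re_lt
            convex_connected convex_Int convex_halfspace_Re_gt convex_halfspace_Re_lt) auto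
    show "U \<subseteq> D" by (auto simp: U_def D_def)
    show "complex_of_real (-1/2) \<in> D" by (auto simp: D_def)
    show "complex_of_real (-1/2) islimpt U"
    proof (rule connected_imp_perfect)
      show "connected U"
        unfolding U_def by (intro connected_continuous_image continuous_intros) auto
      show "complex_of_real (-1/2) \<in> U"
        unfolding U_def by (rule imageI) auto
      have "complex_of_real (-1/3) \<in> U"
        unfolding U_def by (rule imageI) auto
      show "U \<noteq> {x}" for x
      proof
        assume "U = {x}"
        hence "complex_of_real (-1/2) = complex_of_real (-1/3)"
          using \<open>complex_of_real (-1/2) \<in> U\<close> \<open>complex_of_real (-1/3) \<in> U\<close> by (metis singletonD)
        thus False by (simp only: of_real_eq_iff)
      qed
    qed
    show "zeta_em w - zeta_reflected w = 0" if "w \<in> U" for w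
    proof -
      from that obtain x where x: "w = of_real x" "-1 < x" "x < 0" by (auto simp: U_def)
      show ?thesis using zeta_em_eq_reflected_real[of "- x"] x by simp
    qed
    show "s \<in> D" using s by (auto simp: D_def)
  qed
  thus ?thesis by simp
qed

text \<open>The value at the pole is \<open>0\<close> because \<open>Gamma 0 = 0\<close> in \<^const>\<open>zeta_reflected\<close>.\<close>

definition zeta_glued :: "complex \<Rightarrow> complex" where
  "zeta_glued s = (if s \<in> {s. Re s > -1} - {1} then zeta_em s else zeta_reflected s)"

lemma holomorphic_zeta_glued: "zeta_glued holomorphic_on - {1}"
proof -
  \<comment> \<open>The reflected formula is glued in on \<open>Re s < 0\<close> only: its
    exceptional point \<open>0\<close> is then covered by \<open>zeta_em\<close>, and the overlap is
    a strip on which both formulas agree.\<close>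
  have "zeta_glued holomorphic_on (({s. Re s > -1} - {1}) \<union> {s. Re s < 0})"
    unfolding zeta_glued_def
  proof (rule holomorphic_on_If_Un[OF holomorphic_zeta_em])
    show "zeta_reflected holomorphic_on {s. Re s < 0}"
      by (rule holomorphic_on_subset[OF holomorphic_zeta_reflected]) auto
    show "open ({s. Re s > -1} - {1::complex})"
      by (intro open_Diff open_halfspace_Re_gt) auto
    show "open {s. Re s < 0}" by (rule open_halfspace_Re_lt)
    show "zeta_em z = zeta_reflected z"
      if "z \<in> {s. - 1 < Re s} - {1}" "z \<in> {s. Re s < 0}" for z
      using that by (intro zeta_em_eq_reflected) auto
  qed
  moreover have "(({s. Re s > -1} - {1}) \<union> {s. Re s < 0}) = - {1::complex}" by auto
  ultimately show ?thesis by simp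
qed

text \<open>Existence is the glued function; uniqueness is the identity theorem on the connected set
  \<open>- {1}\<close>, started on \<open>Re s > 1\<close> where the Dirichlet series fixes the
  values. The prescribed value \<open>0\<close> at the pole settles the last point.\<close>

lemma riemann_zeta_eq_glued: "riemann_zeta = zeta_glued"
  unfolding riemann_zeta_def
proof (rule the_equality)
  have "zeta_glued 1 = 0" by (simp add: zeta_glued_def zeta_reflected_def)
  moreover have "zeta_glued s = zeta_em s" if "Re s > 1" for s
    using that by (auto simp: zeta_glued_def)
  ultimately show "zeta_glued holomorphic_on - {1} \<and> zeta_glued 1 = 0 \<and>
      (\<forall>s. 1 < Re s \<longrightarrow> (\<lambda>n. 1 / of_nat (Suc n) powr s) sums zeta_glued s)"
    using holomorphic_zeta_glued zeta_em_sums by auto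
next
  fix f assume f: "f holomorphic_on - {1} \<and> f 1 = 0 \<and>
      (\<forall>s. 1 < Re s \<longrightarrow> (\<lambda>n. 1 / of_nat (Suc n) powr s) sums f s)"
  show "f = zeta_glued"
  proof
    fix s :: complex
    show "f s = zeta_glued s"
    proof (cases "s = 1")
      case False
      show ?thesis
      proof (rule analytic_continuation_open[of "{s. Re s > 1}" "- {1}" f zeta_glued s])
        show "open {s. Re s > 1}" by (rule open_halfspace_Re_gt)
        show "connected (- {1::complex})" by (intro connected_punctured_universe) simp
        have "2 \<in> {s::complex. Re s > 1}" by simp
        thus "{s::complex. Re s > 1} \<noteq> {}" by blast
        show "f z = zeta_glued z" if "z \<in> {s. Re s > 1}" for z
        proof -
          have "f z = zeta_em z" using that f zeta_em_sums sums_unique2 by blast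
          thus ?thesis using that by (auto simp: zeta_glued_def)
        qed
      qed (use f holomorphic_zeta_glued False in auto)
    qed (use f in \<open>simp add: zeta_glued_def zeta_reflected_def\<close>)
  qed
qed

lemma holomorphic_riemann_zeta: "riemann_zeta holomorphic_on - {1}"
  unfolding riemann_zeta_eq_glued by (rule holomorphic_zeta_glued)

lemma riemann_zeta_eq_em: "Re s > -1 \<Longrightarrow> s \<noteq> 1 \<Longrightarrow> riemann_zeta s = zeta_em s"
  by (simp add: riemann_zeta_eq_glued zeta_glued_def)

lemma riemann_zeta_sums: "Re s > 1 \<Longrightarrow> (\<lambda>n. 1 / of_nat (Suc n) powr s) sums riemann_zeta s"
proof -
  assume s: "Re s > 1"
  hence "riemann_zeta s = zeta_em s" by (intro riemann_zeta_eq_em) auto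
  thus ?thesis using zeta_em_sums[OF s] by simp
qed

text \<open>\<open>zeta_em_eq_reflected\<close>, solved for the value at \<open>1 - z\<close> by
  Euler's reflection. It is used twice: for the symmetry of the kernel, and to bring the residue at
  \<open>1\<close> into the form \<open>Gamma z * riemann_zeta z\<close>.\<close>

theorem riemann_zeta_functional_equation:
  assumes z: "-1 < Re z" "Re z < 1" "z \<noteq> 0"
  shows "riemann_zeta (1 - z) =
     2 * cos (of_real pi * z / 2) * Gamma z * riemann_zeta z / of_real (2 * pi) powr z"
proof -
  define S where "S = sin (of_real pi * z / 2)"
  define C where "C = cos (of_real pi * z / 2)"
  define P where "P = of_real (2 * pi) powr z"
  have P: "P \<noteq> 0" by (simp add: P_def)
  have z1: "z \<noteq> 1" using z by auto
  have sz: "sin (of_real pi * z) \<noteq> 0"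
  proof
    assume "sin (of_real pi * z) = 0"
    then obtain n :: int where n: "of_real pi * z = of_real (of_int n * pi)"
      unfolding sin_eq_0 by auto
    hence "z = of_int n" by simp
    thus False using z by auto
  qed
  have S2: "sin (of_real pi * z) = 2 * S * C"
    using sin_double[of "of_real pi * z / 2"] by (simp add: S_def C_def)
  have SC: "S \<noteq> 0" "C \<noteq> 0" using sz S2 by auto
  have refl: "Gamma z * Gamma (1 - z) = of_real pi / (2 * S * C)"
    using Gamma_reflection_complex[of z] by (simp add: S2)
  have "riemann_zeta z = 2 * of_real (2 * pi) powr (z - 1) * S * Gamma (1 - z) * riemann_zeta (1 - z)"
    using z z1 zeta_em_eq_reflected[of z] riemann_zeta_eq_em[of z] riemann_zeta_eq_em[of "1 - z"]
    by (simp add: zeta_reflected_def S_def)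
  also have "of_real (2 * pi) powr (z - 1) = P / of_real (2 * pi)"
    by (simp add: P_def powr_diff)
  finally have eq: "riemann_zeta z = P / of_real pi * S * Gamma (1 - z) * riemann_zeta (1 - z)"
    by simp
  have "2 * C * Gamma z * riemann_zeta z / P =
      (Gamma z * Gamma (1 - z)) * (2 * S * C) / of_real pi * riemann_zeta (1 - z)"
    unfolding eq using P by (simp add: mult_ac)
  also have "\<dots> = riemann_zeta (1 - z)"
    unfolding refl using SC by simp
  finally show ?thesis by (simp add: C_def P_def)
qed

section \<open>Growth of zeta, its pole at \<open>1\<close>, and its nonvanishing for
  \<open>Re s > 1\<close>\<close>

lemma norm_riemann_zeta_le:
  assumes c: "c > -1"
  obtains C where "C > 0"
    and "\<And>s. Re s \<ge> c \<Longrightarrow> \<bar>Im s\<bar> \<ge> 1 \<Longrightarrow> norm (riemann_zeta s) \<le> C * (1 + norm s)\<^sup>2"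
proof -
  obtain Z where Z: "Z \<ge> 0"
    "\<And>s. Re s \<ge> c \<Longrightarrow> s \<noteq> 1 \<Longrightarrow> norm (zeta_em s - (1 / 2 + 1 / (s - 1))) \<le> Z * (1 + norm s)\<^sup>2"
    using norm_zeta_em_diff_le[OF c] by blast
  show ?thesis
  proof (rule that[of "2 + Z"])
    fix s assume s: "Re s \<ge> c" "\<bar>Im s\<bar> \<ge> 1"
    have s1: "s \<noteq> 1" using s by auto
    \<comment> \<open>The condition on \<open>Im s\<close> keeps \<open>s\<close> at distance at
      least \<open>1\<close> from the pole, so the polar term is absorbed by the quadratic
      bound.\<close>
    have "1 \<le> norm (s - 1)" using s abs_Im_le_cmod[of "s - 1"] by auto
    hence "norm (1 / (s - 1)) \<le> 1" by (simp add: norm_divide divide_simps)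
    hence "norm (1 / 2 + 1 / (s - 1)) \<le> 2"
      using norm_triangle_ineq[of "1/2" "1 / (s - 1)"] by simp
    moreover have "norm (zeta_em s - (1 / 2 + 1 / (s - 1))) \<le> Z * (1 + norm s)\<^sup>2"
      using Z(2)[OF s(1) s1] .
    ultimately have "norm (zeta_em s) \<le> 2 + Z * (1 + norm s)\<^sup>2"
      using norm_triangle_sub[of "zeta_em s" "1 / 2 + 1 / (s - 1)"] by linarith
    also have "\<dots> \<le> 2 * (1 + norm s)\<^sup>2 + Z * (1 + norm s)\<^sup>2"
      by (simp add: power2_eq_square algebra_simps)
    finally show "norm (riemann_zeta s) \<le> (2 + Z) * (1 + norm s)\<^sup>2"
      using riemann_zeta_eq_em[of s] s s1 c by (simp add: algebra_simps)
  qed (use Z in auto)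
qed

text \<open>Zeta with its simple pole divided out. A residue at a simple pole of zeta becomes a
  plain value of this entire function; at a double pole its derivative enters.\<close>

definition zeta_reg :: "complex \<Rightarrow> complex" where
  "zeta_reg s = (if s = 1 then 1 else (s - 1) * riemann_zeta s)"

lemma riemann_zeta_eq_reg: "s \<noteq> 1 \<Longrightarrow> riemann_zeta s = zeta_reg s / (s - 1)"
  by (simp add: zeta_reg_def)

lemma zeta_reg_1 [simp]: "zeta_reg 1 = 1"
  by (simp add: zeta_reg_def)

text \<open>The remainder estimate holds up to the pole, so \<open>(s - 1) * riemann_zeta s\<close>
  tends to \<open>1\<close> there and the singularity is removable.\<close>

lemma holomorphic_zeta_reg: "zeta_reg holomorphic_on A"
proof -
  obtain Z where Z: "Z \<ge> 0"
    "\<And>s. Re s \<ge> 0 \<Longrightarrow> s \<noteq> 1 \<Longrightarrow> norm (zeta_em s - (1 / 2 + 1 / (s - 1))) \<le> Z * (1 + norm s)\<^sup>2"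
    using norm_zeta_em_diff_le[of 0] by auto
  have "((\<lambda>s. (s - 1) * riemann_zeta s - 1) \<longlongrightarrow> 0) (at 1)"
  proof (rule Lim_null_comparison)
    show "\<forall>\<^sub>F s in at 1. norm ((s - 1) * riemann_zeta s - 1) \<le> norm (s - 1) * (1 / 2 + Z * (1 + norm s)\<^sup>2)"
      unfolding eventually_at
    proof (intro exI[of _ 1] conjI ballI impI)
      fix s :: complex assume s: "s \<noteq> 1 \<and> dist s 1 < 1"
      have "\<bar>Re (s - 1)\<bar> < 1"
        using s abs_Re_le_cmod[of "s - 1"] by (simp add: dist_norm)
      hence Re: "Re s \<ge> 0" by auto
      have "(s - 1) * riemann_zeta s - 1 = (s - 1) * (1 / 2 + (zeta_em s - (1 / 2 + 1 / (s - 1))))"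
        using s Re riemann_zeta_eq_em[of s] by (simp add: algebra_simps)
      also have "norm \<dots> \<le> norm (s - 1) * (norm (1 / 2 :: complex) + norm (zeta_em s - (1 / 2 + 1 / (s - 1))))"
        unfolding norm_mult by (intro mult_left_mono norm_triangle_ineq) auto
      also have "\<dots> \<le> norm (s - 1) * (1 / 2 + Z * (1 + norm s)\<^sup>2)"
        by (intro mult_left_mono add_mono Z(2)[OF Re]) (use s in auto)
      finally show "norm ((s - 1) * riemann_zeta s - 1) \<le> norm (s - 1) * (1 / 2 + Z * (1 + norm s)\<^sup>2)" .
    qed auto
    have "((\<lambda>s::complex. norm (s - 1) * (1 / 2 + Z * (1 + norm s)\<^sup>2)) \<longlongrightarrow>
        norm (1 - 1 :: complex) * (1 / 2 + Z * (1 + norm (1::complex))\<^sup>2)) (at 1)"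
      by (intro tendsto_intros)
    thus "((\<lambda>s::complex. norm (s - 1) * (1 / 2 + Z * (1 + norm s)\<^sup>2)) \<longlongrightarrow> 0) (at 1)" by simp
  qed
  hence "((\<lambda>s. (s - 1) * riemann_zeta s) \<longlongrightarrow> 1) (at 1)"
    by (simp add: LIM_zero_iff)
  moreover have "(\<lambda>s. (s - 1) * riemann_zeta s) holomorphic_on UNIV - {1}"
    by (intro holomorphic_intros holomorphic_on_subset[OF holomorphic_riemann_zeta]) auto
  ultimately have "zeta_reg holomorphic_on UNIV"
    unfolding zeta_reg_def by (intro removable_singularity) auto
  thus ?thesis by (rule holomorphic_on_subset) auto
qed

text \<open>Sieving the Dirichlet series by all primes up to \<open>N\<close> leaves \<open>1\<close> plus a tail of the series.\<close>

theorem riemann_zeta_nonzero: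
  assumes s: "Re s > 1"
  shows "riemann_zeta s \<noteq> 0"
proof
  assume z0: "riemann_zeta s = 0"
  define f where "f = (\<lambda>n::nat. of_nat n powr (- s) :: complex)"
  \<comment> \<open>The numbers that survive the sieve by all primes up to \<open>N\<close>;
    \<open>1\<close> always survives.\<close>
  define A where "A = (\<lambda>N. {n::nat. n > 0 \<and> (\<forall>p. prime p \<longrightarrow> p \<le> N \<longrightarrow> \<not> p dvd n)})"
  have norm_f: "norm (f n) = real n powr (- Re s)" for n
    using norm_powr_real_powr[of "of_nat n" "- s"] s by (cases "n = 0") (auto simp: f_def)
  have summ: "summable (\<lambda>n. norm (f n))"
    unfolding norm_f using s by (simp add: summable_real_powr_iff)
  hence fU: "f summable_on UNIV" by (rule norm_summable_imp_summable_on)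
  have nfU: "(\<lambda>n. norm (f n)) summable_on UNIV"
    using summ by (intro norm_summable_imp_summable_on) auto
  have fS: "f summable_on X" for X by (rule summable_on_subset[OF fU]) auto
  have nfS: "(\<lambda>n. norm (f n)) summable_on X" for X by (rule summable_on_subset[OF nfU]) auto
  have f_mult: "f (m * n) = f m * f n" for m n
    unfolding f_def of_nat_mult using powr_times_real[of "of_nat m" "of_nat n" "- s"] by simp
  \<comment> \<open>If zeta vanishes at \<open>s\<close>, so does every sum \<open>S N\<close> over
    \<open>A N\<close>: splitting off the multiples of a prime \<open>p = N + 1\<close> gives
    \<open>S N = S (N + 1) + f p * S N\<close>, and both copies of \<open>S N\<close> are
    zero.\<close>
  have zero: "infsum f (A N) = 0" for N
  proof (induction N)
    case 0
    have "(\<lambda>n. f (Suc n)) sums riemann_zeta s"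
      using riemann_zeta_sums[OF s] by (simp add: f_def powr_minus field_simps)
    hence "f sums (riemann_zeta s + f 0)" by (simp only: sums_Suc_iff)
    hence "f sums 0" using z0 by (simp add: f_def)
    hence "infsum f UNIV = 0"
      by (intro infsumI norm_summable_imp_has_sum summ)
    also have "infsum f UNIV = infsum f (A 0)"
      by (rule infsum_cong_neutral) (auto simp: A_def f_def)
    finally show ?case .
  next
    case (Suc N)
    show ?case
    proof (cases "prime (Suc N)")
      case False
      have "A (Suc N) = A N" using False by (auto simp: A_def le_Suc_eq)
      thus ?thesis using Suc by simp
    next
      case True
      define p where "p = Suc N"
      have p: "prime p" using True by (simp add: p_def)
      have split: "A N = A (Suc N) \<union> (*) p ` A N"
      proof (intro equalityI subsetI)
        fix n assume n: "n \<in> A N"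
        show "n \<in> A (Suc N) \<union> (*) p ` A N"
        proof (cases "p dvd n")
          case True
          then obtain m where m: "n = p * m" by blast
          have "m \<in> A N" using n m by (auto simp: A_def)
          thus ?thesis using m by blast
        next
          case False
          thus ?thesis using n by (auto simp: A_def p_def le_Suc_eq)
        qed
      next
        fix n assume "n \<in> A (Suc N) \<union> (*) p ` A N"
        thus "n \<in> A N"
        proof
          assume "n \<in> A (Suc N)"
          thus ?thesis by (auto simp: A_def)
        next
          assume "n \<in> (*) p ` A N"
          then obtain m where m: "n = p * m" "m \<in> A N" by blast
          have "\<not> q dvd n" if q: "prime q" "q \<le> N" for q
          proof
            assume "q dvd n"
            hence "q dvd p \<or> q dvd m" using m q by (simp add: prime_dvd_mult_iff)
            moreover have "\<not> q dvd m" using m q by (auto simp: A_def)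
            ultimately have "q = p" using p q primes_dvd_imp_eq by blast
            thus False using q by (simp add: p_def)
          qed
          thus ?thesis using m p prime_gt_0_nat by (auto simp: A_def)
        qed
      qed
      have disj: "A (Suc N) \<inter> (*) p ` A N = {}"
      proof -
        have "p \<le> Suc N" by (simp add: p_def)
        thus ?thesis using p by (auto simp: A_def)
      qed
      have inj: "inj_on ((*) p) (A N)" using p prime_gt_0_nat by (auto simp: inj_on_def)
      have "infsum f (A N) = infsum f (A (Suc N)) + infsum f ((*) p ` A N)"
        by (subst (1) split) (intro infsum_Un_disjoint fS disj)
      also have "infsum f ((*) p ` A N) = infsum (\<lambda>n. f p * f n) (A N)"
        by (subst infsum_reindex[OF inj]) (simp add: o_def f_mult)
      also have "\<dots> = f p * infsum f (A N)" by (rule infsum_cmult_right')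
      finally show ?thesis using Suc by simp
    qed
  qed
  \<comment> \<open>A tail of norm below \<open>1\<close>. Apart from \<open>1\<close>, whose term
    is \<open>1\<close>, every member of \<open>A N\<close> has a prime factor above
    \<open>N\<close> and so exceeds \<open>N\<close>; the rest of the sieved sum is too small to
    cancel that term.\<close>
  obtain N where N: "norm (\<Sum>i. norm (f (i + N))) < 1"
    using suminf_exist_split[OF _ summ, of 1] by auto
  define B where "B = A N - {1}"
  have "A N = {1} \<union> B" by (auto simp: A_def B_def)
  hence "0 = infsum f ({1} \<union> B)" using zero[of N] by simp
  also have "\<dots> = f 1 + infsum f B"
    by (subst infsum_Un_disjoint) (auto simp: fS B_def)
  also have "f 1 = 1" by (simp add: f_def)
  finally have "infsum f B = - 1" by (simp add: eq_neg_iff_add_eq_0 add.commute)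
  hence "1 \<le> norm (infsum f B)" by simp
  also have "\<dots> \<le> infsum (\<lambda>n. norm (f n)) B"
    by (intro norm_infsum_bound nfS)
  also have "\<dots> \<le> infsum (\<lambda>n. norm (f n)) ((\<lambda>i. i + N) ` UNIV)"
  proof (rule infsum_mono_neutral[OF nfS nfS])
    have "n \<in> range (\<lambda>i. i + N)" if "n \<in> B" for n
    proof -
      have "n \<noteq> 1" "n > 0" using that by (auto simp: B_def A_def)
      then obtain q where q: "prime q" "q dvd n" using prime_factor_nat by blast
      moreover have "\<forall>p. prime p \<longrightarrow> p \<le> N \<longrightarrow> \<not> p dvd n" using that by (simp add: B_def A_def)
      ultimately have "q > N" using not_le by blast
      moreover have "q \<le> n" using q \<open>n > 0\<close> by (intro dvd_imp_le) auto
      ultimately have "n = (n - N) + N" by simp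
      thus ?thesis by blast
    qed
    thus "norm (f x) \<le> 0" if "x \<in> B - range (\<lambda>i. i + N)" for x using that by blast
  qed auto
  also have "\<dots> = (\<Sum>i. norm (f (i + N)))"
  proof -
    have "((\<lambda>i. norm (f (i + N))) has_sum (\<Sum>i. norm (f (i + N)))) UNIV"
      using summ by (intro norm_summable_imp_has_sum summable_sums) (simp_all add: summable_iff_shift[of "\<lambda>n. norm (f n)" N])
    thus ?thesis by (subst infsum_reindex) (auto simp: o_def infsumI)
  qed
  also have "\<dots> < 1" using N by simp
  finally show False by simp
qed

section \<open>The integrand and its decay\<close>

definition mellin_kernel :: "complex \<Rightarrow> complex \<Rightarrow> complex" where
  "mellin_kernel z w =
     Gamma w * riemann_zeta w * riemann_zeta (w - z) / sin (of_real pi * (w - z) / 2)"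

lemma not_nonpos_Int_if_Re_pos: "Re s > 0 \<Longrightarrow> s \<notin> \<int>\<^sub>\<le>\<^sub>0"
  by (auto elim!: nonpos_Ints_cases)

lemma no_int_between_0_1: "\<not> (0 < real_of_int k \<and> real_of_int k < 1)"
  by simp

lemma riemann_xi_eq_formula:
  assumes "Re s > 0" "s \<noteq> 1"
  shows "riemann_xi s = riemann_xi_formula s"
proof -
  have "s / 2 \<notin> \<int>\<^sub>\<le>\<^sub>0" using assms by (intro not_nonpos_Int_if_Re_pos) simp
  thus ?thesis using assms by (simp add: riemann_xi_def)
qed

text \<open>With \<open>u = w - z\<close>, the two values of \<open>riemann_Xi\<close> are those of
  the xi-function at \<open>u\<close> and \<open>w\<close>, and the denominator factors as
  \<open>4 w (1 - u)\<close>. Two linear factors of xi cancel it and the other two raise the Gamma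
  arguments by one; duplication then joins the Gamma factors in \<open>w / 2\<close> and reflection
  those in \<open>u / 2\<close>, which is where the sine comes from.\<close>

lemma xi_integrand_eq:
  fixes z :: complex and t \<alpha> :: real
  assumes z: "-1 < Re z" "Re z < 1"
  defines "w \<equiv> (1 + z + \<i> * of_real t) / 2"
  shows "xi_integrand z \<alpha> t = of_real pi powr ((z + 3) / 2) / 2 *
     (of_real (2 * pi) powr (- w) * mellin_kernel z w) * of_real (cos (1 / 2 * t * ln \<alpha>))"
proof -
  define u where "u = w - z"
  have u_eq: "u = (1 - z + \<i> * of_real t) / 2" by (simp add: u_def w_def field_simps)
  have Re: "0 < Re w" "Re w < 1" "0 < Re u" "Re u < 1"
    using z by (simp_all add: w_def u_eq)
  have ne: "w \<noteq> 0" "w \<noteq> 1" "u \<noteq> 0" "u \<noteq> 1" using Re by auto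
  have "1 / 2 + \<i> * ((of_real t + \<i> * z) / 2) = u"
    by (simp add: u_eq field_simps)
  hence X1: "riemann_Xi ((of_real t + \<i> * z) / 2) = riemann_xi_formula u"
    using riemann_xi_eq_formula[of u] Re ne by (simp add: riemann_Xi_def)
  have "1 / 2 + \<i> * ((of_real t - \<i> * z) / 2) = w"
    by (simp add: w_def field_simps)
  hence X2: "riemann_Xi ((of_real t - \<i> * z) / 2) = riemann_xi_formula w"
    using riemann_xi_eq_formula[of w] Re ne by (simp add: riemann_Xi_def)
  have G1: "(z - 1 + \<i> * of_real t) / 4 = (w - 1) / 2" by (simp add: w_def field_simps)
  have G2: "(z - 1 - \<i> * of_real t) / 4 = - u / 2" by (simp add: u_eq field_simps)
  have den: "(of_real t)\<^sup>2 + (z + 1)\<^sup>2 = 4 * w * (1 - u)"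
    by (simp add: w_def u_eq field_simps power2_eq_square)
  have nn1: "(w - 1) / 2 \<notin> \<int>\<^sub>\<le>\<^sub>0"
  proof
    assume "(w - 1) / 2 \<in> \<int>\<^sub>\<le>\<^sub>0"
    then obtain n :: int where "(w - 1) / 2 = of_int n" by (elim nonpos_Ints_cases) auto
    hence "w = of_int (2 * n + 1)" by (simp add: field_simps)
    hence "Re w = of_int (2 * n + 1)" by simp
    thus False using Re no_int_between_0_1 by metis
  qed
  have nn2: "- u / 2 \<notin> \<int>\<^sub>\<le>\<^sub>0"
  proof
    assume "- u / 2 \<in> \<int>\<^sub>\<le>\<^sub>0"
    then obtain n :: int where "- u / 2 = of_int n" by (elim nonpos_Ints_cases) auto
    hence "- u = of_int (2 * n)" by (simp add: field_simps)
    hence "Re (- u) = Re (of_int (2 * n))" by (simp only:)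
    hence "Re u = of_int (- 2 * n)" by simp
    thus False using Re no_int_between_0_1 by metis
  qed
  have "Gamma ((w - 1) / 2 + 1) = (w - 1) / 2 * Gamma ((w - 1) / 2)"
    by (rule Gamma_plus1[OF nn1])
  moreover have "(w - 1) / 2 + 1 = w / 2 + 1 / 2" by (simp add: field_simps)
  ultimately have E1: "(w - 1) * Gamma ((w - 1) / 2) = 2 * Gamma (w / 2 + 1 / 2)"
    by (simp add: mult.commute)
  have "Gamma (- u / 2 + 1) = - u / 2 * Gamma (- u / 2)"
    by (rule Gamma_plus1[OF nn2])
  hence E2: "u * Gamma (- u / 2) = - 2 * Gamma (1 - u / 2)" by simp
  have E3: "Gamma (u / 2) * Gamma (1 - u / 2) = of_real pi / sin (of_real pi * u / 2)"
    using Gamma_reflection_complex[of "u / 2"] by simp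
  have E4: "Gamma (w / 2) * Gamma (w / 2 + 1 / 2) =
      of_real 2 powr (1 - w) * of_real pi powr (1 / 2) * Gamma w"
  proof -
    have "Gamma (w / 2) * Gamma (w / 2 + 1 / 2) =
        exp ((1 - 2 * (w / 2)) * of_real (ln 2)) * of_real (sqrt pi) * Gamma (2 * (w / 2))"
      using Re by (intro Gamma_legendre_duplication not_nonpos_Int_if_Re_pos) auto
    moreover have "exp ((1 - w) * of_real (ln 2)) = of_real 2 powr (1 - w)"
      unfolding powr_def using Ln_of_real[of 2] by simp
    moreover have "complex_of_real (sqrt pi) = of_real pi powr (1 / 2)"
      using powr_of_real[of pi "1 / 2"] by (simp add: powr_half_sqrt)
    ultimately show ?thesis by simp
  qed
  have "Gamma ((w - 1) / 2) * Gamma (- u / 2) * riemann_xi_formula u * riemann_xi_formula w / (4 * w * (1 - u))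
      = - ((w - 1) * Gamma ((w - 1) / 2)) * (u * Gamma (- u / 2)) * Gamma (u / 2) * Gamma (w / 2) *
        (of_real pi powr (- u / 2) * of_real pi powr (- w / 2)) * riemann_zeta u * riemann_zeta w / 16"
  proof -
    have "w * (1 - u) \<noteq> 0" using ne by simp
    moreover have "Gamma ((w - 1) / 2) * Gamma (- u / 2) * riemann_xi_formula u * riemann_xi_formula w =
      (- ((w - 1) * Gamma ((w - 1) / 2)) * (u * Gamma (- u / 2)) * Gamma (u / 2) * Gamma (w / 2) *
        (of_real pi powr (- u / 2) * of_real pi powr (- w / 2)) * riemann_zeta u * riemann_zeta w / 4) * (w * (1 - u))"
    proof -
      have "G1 * G2 * (1 / 2 * u * (u - 1) * p1 * g1 * z1) * (1 / 2 * w * (w - 1) * p2 * g2 * z2) =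
          (- ((w - 1) * G1) * (u * G2) * g1 * g2 * (p1 * p2) * z1 * z2 / 4) * (w * (1 - u))"
        for G1 G2 p1 p2 g1 g2 z1 z2 :: complex
        by (simp add: field_simps)
      thus ?thesis unfolding riemann_xi_formula_def by simp
    qed
    ultimately show ?thesis by simp
  qed
  also have "\<dots> = (Gamma (w / 2) * Gamma (w / 2 + 1 / 2)) * (Gamma (u / 2) * Gamma (1 - u / 2)) *
        (of_real pi powr (- u / 2) * of_real pi powr (- w / 2)) * riemann_zeta u * riemann_zeta w / 4"
    unfolding E1 E2 by simp
  also have "\<dots> = (of_real 2 powr (1 - w) * (of_real pi powr (1 / 2) * of_real pi *
        (of_real pi powr (- u / 2) * of_real pi powr (- w / 2)))) * Gamma w / sin (of_real pi * u / 2)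
        * riemann_zeta u * riemann_zeta w / 4"
    unfolding E3 E4 by simp
  also have "of_real pi powr (1 / 2) * of_real pi * (of_real pi powr (- u / 2) * of_real pi powr (- w / 2))
      = of_real pi powr ((z + 3) / 2) * (of_real pi powr (- w) :: complex)"
  proof -
    have "of_real pi powr (1 / 2) * of_real pi powr 1 * (of_real pi powr (- u / 2) * of_real pi powr (- w / 2))
        = of_real pi powr (1 / 2 + 1 + (- u / 2 + - w / 2 :: complex))"
      by (simp only: powr_add)
    also have "1 / 2 + 1 + (- u / 2 + - w / 2) = (z + 3) / 2 + - w"
      by (simp add: u_def field_simps)
    finally show ?thesis by (simp only: powr_add) simp
  qed
  also have "of_real 2 powr (1 - w) * (of_real pi powr ((z + 3) / 2) * (of_real pi powr (- w) :: complex))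
      = 2 * of_real pi powr ((z + 3) / 2) * of_real (2 * pi) powr (- w)"
  proof -
    have "of_real (2 * pi) powr (- w) = of_real 2 powr (- w) * (of_real pi powr (- w) :: complex)"
      unfolding of_real_mult by (rule powr_times_real) auto
    moreover have "of_real 2 powr (1 - w) = 2 * (of_real 2 powr (- w) :: complex)"
      using powr_add[of "of_real 2 :: complex" 1 "- w"] by simp
    ultimately show ?thesis by simp
  qed
  finally have eq: "Gamma ((w - 1) / 2) * Gamma (- u / 2) * riemann_xi_formula u * riemann_xi_formula w / (4 * w * (1 - u))
      = of_real pi powr ((z + 3) / 2) / 2 * (of_real (2 * pi) powr (- w) * mellin_kernel z w)"
    by (simp add: mellin_kernel_def u_def[symmetric])
  have "xi_integrand z \<alpha> t = Gamma ((w - 1) / 2) * Gamma (- u / 2) * riemann_xi_formula u * riemann_xi_formula w /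
      (4 * w * (1 - u)) * of_real (cos (1 / 2 * t * ln \<alpha>))"
    unfolding xi_integrand_def X1 X2 G1 G2 den by simp
  thus ?thesis unfolding eq .
qed

text \<open>By the functional equation \<open>(2 pi) powr (- w) * Gamma w * riemann_zeta w\<close>
  is \<open>riemann_zeta (1 - w) / (2 cos (pi w / 2))\<close>. In the resulting product the map from
  \<open>w\<close> to \<open>1 + z - w\<close> swaps the two zeta factors and swaps the cosine with
  the sine. On the line of integration this map is \<open>t\<close> to \<open>- t\<close>.\<close>

lemma mellin_kernel_reflection:
  assumes z: "-1 < Re z" "Re z < 1" and w: "Re w = (1 + Re z) / 2"
  shows "of_real (2 * pi) powr (- (1 + z - w)) * mellin_kernel z (1 + z - w) =
         of_real (2 * pi) powr (- w) * mellin_kernel z w"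
proof -
  have cos_ne: "cos (of_real pi * v / 2) \<noteq> 0" if "0 < Re v" "Re v < 1" for v
  proof
    assume "cos (of_real pi * v / 2) = 0"
    then obtain n :: int where "of_real pi * v / 2 = of_real (of_int n * pi) + of_real pi / 2"
      unfolding cos_eq_0 by auto
    hence "of_real pi * v = of_real pi * (2 * of_int n + 1)" by (simp add: field_simps)
    hence "v = 2 * of_int n + 1" by (metis mult_cancel_left of_real_eq_0_iff pi_neq_zero)
    hence "Re v = of_int (2 * n + 1)" by simp
    thus False using that no_int_between_0_1 by metis
  qed
  have red: "of_real (2 * pi) powr (- v) * mellin_kernel z v =
      riemann_zeta (1 - v) * riemann_zeta (v - z) / (2 * cos (of_real pi * v / 2) * sin (of_real pi * (v - z) / 2))"
    if "Re v = (1 + Re z) / 2" for v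
  proof -
    have v: "0 < Re v" "Re v < 1" using that z by auto
    have "riemann_zeta (1 - v) = 2 * cos (of_real pi * v / 2) * Gamma v * riemann_zeta v / of_real (2 * pi) powr v"
      using v by (intro riemann_zeta_functional_equation) auto
    hence "riemann_zeta (1 - v) / (2 * cos (of_real pi * v / 2)) = Gamma v * riemann_zeta v / of_real (2 * pi) powr v"
      using cos_ne[OF v] by (simp add: field_simps)
    hence "(riemann_zeta (1 - v) / (2 * cos (of_real pi * v / 2))) * riemann_zeta (v - z) / sin (of_real pi * (v - z) / 2)
        = of_real (2 * pi) powr (- v) * mellin_kernel z v"
      by (simp only:) (simp add: mellin_kernel_def powr_minus field_simps)
    thus ?thesis by simp
  qed
  have "cos (of_real pi * (1 + z - w) / 2) = sin (of_real pi * (w - z) / 2)"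
  proof -
    have "of_real pi * (1 + z - w) / 2 = of_real pi / 2 - of_real pi * (w - z) / 2" by (simp add: field_simps)
    thus ?thesis by (simp only: sin_cos_eq)
  qed
  moreover have "sin (of_real pi * (1 + z - w - z) / 2) = cos (of_real pi * w / 2)"
  proof -
    have "of_real pi * (1 + z - w - z) / 2 = of_real pi / 2 - of_real pi * w / 2" by (simp add: field_simps)
    thus ?thesis by (simp only: cos_sin_eq)
  qed
  ultimately show ?thesis
    using red[of w] red[of "1 + z - w"] w by (simp add: algebra_simps)
qed

section \<open>Decay of the kernel in vertical strips\<close>

lemma norm_Gamma_le:
  assumes "Re s > 0"
  shows "norm (Gamma s) \<le> Gamma (Re s)"
proof -
  have c: "((\<lambda>t. of_real t powr (s - 1) / of_real (exp t)) has_integral Gamma s) {0..}"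
    by (rule Gamma_integral_complex[OF assms])
  have r: "((\<lambda>t. t powr (Re s - 1) / exp t) has_integral Gamma (Re s)) {0..}"
    by (rule Gamma_integral_real[OF assms])
  have "norm (integral {0..} (\<lambda>t. of_real t powr (s - 1) / of_real (exp t))) \<le>
      integral {0..} (\<lambda>t. t powr (Re s - 1) / exp t)"
  proof (rule integral_norm_bound_integral)
    fix t :: real assume "t \<in> {0..}"
    thus "norm (complex_of_real t powr (s - 1) / of_real (exp t)) \<le> t powr (Re s - 1) / exp t"
      using norm_powr_real_powr[of "of_real t" "s - 1"]
      by (cases "t = 0") (auto simp: norm_divide simp del: of_real_exp)
  qed (use c r in \<open>auto simp: has_integral_iff\<close>)
  thus ?thesis using c r by (simp add: has_integral_iff)
qed

lemma norm_sin_complex_ge: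
  fixes s :: complex
  assumes "\<bar>Im s\<bar> \<ge> 1"
  shows "norm (sin s) \<ge> exp \<bar>Im s\<bar> / 4"
proof -
  have n: "norm (exp (\<i> * s)) = exp (- Im s)" "norm (exp (- (\<i> * s))) = exp (Im s)"
    by (simp_all add: norm_exp_eq_Re)
  have "norm (sin s) = norm (exp (\<i> * s) - exp (- (\<i> * s))) / 2"
    by (simp add: sin_exp_eq norm_divide norm_mult)
  moreover have "exp \<bar>Im s\<bar> - exp (- \<bar>Im s\<bar>) \<le> norm (exp (\<i> * s) - exp (- (\<i> * s)))"
    using norm_triangle_ineq3[of "exp (\<i> * s)" "exp (- (\<i> * s))"] unfolding n
    by (cases "Im s \<ge> 0") auto
  moreover have "exp (- \<bar>Im s\<bar>) \<le> exp \<bar>Im s\<bar> / 2"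
  proof -
    have "2 \<le> exp \<bar>Im s\<bar>" using exp_ge_add_one_self[of "\<bar>Im s\<bar>"] assms by linarith
    moreover have "exp (- \<bar>Im s\<bar>) \<le> 1" by simp
    ultimately show ?thesis by linarith
  qed
  ultimately show ?thesis by linarith
qed

text \<open>\<open>46656 = 6 ^ 6\<close>, from \<open>(1 + x / 6) ^ 6 \<le> exp x\<close>. The
  kernel estimate uses six powers: four for the two quadratic zeta bounds and two to leave an
  integrable \<open>1 / (1 + (Im w)\<^sup>2)\<close>.\<close>

lemma power6_le_exp:
  fixes x :: real
  assumes "x \<ge> 0"
  shows "x ^ 6 \<le> 46656 * exp x"
proof -
  have "(x / 6) ^ 6 \<le> (1 + x / real 6) ^ 6" using assms by (intro power_mono) auto
  also have "\<dots> \<le> exp x" using assms by (intro exp_ge_one_plus_x_over_n_power_n) auto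
  finally show ?thesis by (simp add: power_divide)
qed

text \<open>Up to a constant the sine contributes \<open>exp (- \<bar>Im w\<bar>)\<close>, which
  outweighs the fourth power from the zeta factors. Since \<open>c\<close> exceeds \<open>0\<close>
  and \<open>Re z\<close>, both zeta arguments lie in \<open>Re s \<ge> 0\<close>, and the height
  \<open>1 + norm z\<close> keeps both at distance at least \<open>1\<close> from the real
  axis.\<close>

lemma norm_mellin_kernel_le:
  assumes z: "-1 < Re z" "Re z < 1" and c: "c > 0" "c > Re z" "c \<le> d"
  obtains C where "C > 0"
    and "\<And>w. c \<le> Re w \<Longrightarrow> Re w \<le> d \<Longrightarrow> \<bar>Im w\<bar> \<ge> 1 + norm z \<Longrightarrow>
           norm (mellin_kernel z w) \<le> C / (1 + (Im w)\<^sup>2)"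
proof -
  obtain C1 where C1: "C1 > 0"
    "\<And>s. Re s \<ge> 0 \<Longrightarrow> \<bar>Im s\<bar> \<ge> 1 \<Longrightarrow> norm (riemann_zeta s) \<le> C1 * (1 + norm s)\<^sup>2"
    using norm_riemann_zeta_le[of 0] by auto
  have "continuous_on {c..d} (Gamma :: real \<Rightarrow> real)"
    using c nonpos_Ints_nonpos by (intro continuous_on_Gamma) fastforce
  hence "bounded ((Gamma :: real \<Rightarrow> real) ` {c..d})"
    by (intro compact_imp_bounded compact_continuous_image) auto
  then obtain M where M: "M > 0" "\<And>x. x \<in> {c..d} \<Longrightarrow> \<bar>Gamma x :: real\<bar> \<le> M"
    unfolding bounded_pos by auto
  \<comment> \<open>Chosen so that \<open>X = D + \<bar>Im w\<bar>\<close> dominates both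
    \<open>1 + norm w\<close> and \<open>1 + norm (w - z)\<close>.\<close>
  define D where "D = 1 + d + 2 * norm z"
  have D: "D \<ge> 1" using c by (simp add: D_def)
  define C where "C = M * C1 * C1 * 4 * exp (norm z) * (exp D * 46656)"
  show ?thesis
  proof (rule that[of C])
    show "C > 0" using M(1) C1(1) by (simp add: C_def)
    fix w assume w: "c \<le> Re w" "Re w \<le> d" "\<bar>Im w\<bar> \<ge> 1 + norm z"
    define y where "y = \<bar>Im w\<bar>"
    define X where "X = D + y"
    have X: "X \<ge> 1 + y" "y \<ge> 0" using D by (auto simp: X_def y_def)
    have b0: "\<bar>Im w\<bar> \<ge> 1" using w norm_ge_zero[of z] by linarith
    have Imz: "\<bar>Im z\<bar> \<le> norm z" by (rule abs_Im_le_cmod)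
    have b: "\<bar>Im (w - z)\<bar> \<ge> 1" "\<bar>Im (w - z)\<bar> \<ge> y - norm z" using w Imz by (auto simp: y_def)
    have nw: "norm w \<le> d + y"
      using cmod_le[of w] w c by (auto simp: y_def)
    have nwz: "norm (w - z) \<le> d + y + norm z"
      using nw norm_triangle_ineq4[of w z] by linarith
    have n1: "1 + norm w \<le> X" and n2: "1 + norm (w - z) \<le> X"
      using nw nwz norm_ge_zero[of z] unfolding X_def D_def by linarith+
    have b1: "norm (Gamma w) \<le> M"
      using norm_Gamma_le[of w] M(2)[of "Re w"] w c by auto
    have b2: "norm (riemann_zeta w) \<le> C1 * X\<^sup>2"
    proof -
      have "norm (riemann_zeta w) \<le> C1 * (1 + norm w)\<^sup>2"
        using w c b0 by (intro C1(2)) auto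
      also have "\<dots> \<le> C1 * X\<^sup>2"
        using n1 C1(1) by (intro mult_left_mono power_mono) auto
      finally show ?thesis .
    qed
    have b3: "norm (riemann_zeta (w - z)) \<le> C1 * X\<^sup>2"
    proof -
      have "norm (riemann_zeta (w - z)) \<le> C1 * (1 + norm (w - z))\<^sup>2"
        using w c b by (intro C1(2)) auto
      also have "\<dots> \<le> C1 * X\<^sup>2"
        using n2 C1(1) by (intro mult_left_mono power_mono) auto
      finally show ?thesis .
    qed
    define s where "s = of_real pi * (w - z) / 2"
    \<comment> \<open>The rate \<open>pi / 2\<close> of the sine is lowered to \<open>1\<close>,
      which is still enough.\<close>
    have s: "\<bar>Im s\<bar> \<ge> \<bar>Im (w - z)\<bar>"
    proof -
      have "\<bar>Im s\<bar> = pi / 2 * \<bar>Im (w - z)\<bar>" by (simp add: s_def abs_mult)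
      moreover have "1 * \<bar>Im (w - z)\<bar> \<le> pi / 2 * \<bar>Im (w - z)\<bar>"
        using pi_ge_two by (intro mult_right_mono) auto
      ultimately show ?thesis by simp
    qed
    have "exp (y - norm z) / 4 \<le> exp \<bar>Im s\<bar> / 4" using s b by simp
    also have "\<dots> \<le> norm (sin s)" using s b by (intro norm_sin_complex_ge) linarith
    finally have b4: "exp (y - norm z) / 4 \<le> norm (sin s)" .
    have "norm (mellin_kernel z w) = norm (Gamma w) * norm (riemann_zeta w) * norm (riemann_zeta (w - z)) / norm (sin s)"
      by (simp add: mellin_kernel_def s_def norm_mult norm_divide)
    also have "\<dots> \<le> (M * (C1 * X\<^sup>2) * (C1 * X\<^sup>2)) / (exp (y - norm z) / 4)"
      using M(1) C1(1) by (intro frac_le mult_mono b1 b2 b3 b4) auto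
    also have "\<dots> = M * C1 * C1 * 4 * exp (norm z) * (X ^ 4 * exp (- y))"
      by (simp add: exp_diff exp_minus field_simps power2_eq_square power4_eq_xxxx)
    also have "\<dots> \<le> M * C1 * C1 * 4 * exp (norm z) * (exp D * 46656 / X\<^sup>2)"
    proof (intro mult_left_mono)
      have "X ^ 6 \<le> 46656 * exp X" using X by (intro power6_le_exp) auto
      hence "X ^ 4 * X\<^sup>2 \<le> 46656 * exp D * exp y"
        by (simp add: X_def exp_add mult_ac flip: power_add)
      hence "X ^ 4 * exp (- y) * X\<^sup>2 \<le> exp D * 46656"
        by (simp add: exp_minus field_simps)
      thus "X ^ 4 * exp (- y) \<le> exp D * 46656 / X\<^sup>2"
        using X by (simp add: pos_le_divide_eq)
    qed (use M(1) C1(1) in auto)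
    also have "\<dots> = C / X\<^sup>2" by (simp add: C_def)
    also have "\<dots> \<le> C / (1 + (Im w)\<^sup>2)"
    proof (rule divide_left_mono)
      have "1 + (Im w)\<^sup>2 \<le> (1 + y)\<^sup>2" by (simp add: y_def power2_eq_square algebra_simps)
      also have "\<dots> \<le> X\<^sup>2" using X by (intro power_mono) auto
      finally show "1 + (Im w)\<^sup>2 \<le> X\<^sup>2" .
      show "0 \<le> C" using M(1) C1(1) by (simp add: C_def)
      show "0 < X\<^sup>2 * (1 + (Im w)\<^sup>2)" using X by (intro mult_pos_pos add_pos_nonneg) auto
    qed
    finally show "norm (mellin_kernel z w) \<le> C / (1 + (Im w)\<^sup>2)" .
  qed
qed

text \<open>Comparison with the Beta integral at \<open>a = 0\<close>, mirrored to the negative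
  axis. The extra \<open>indicator {0..0}\<close> pays for the point \<open>0\<close>, which neither
  half covers.\<close>

lemma integrable_Cauchy_density: "integrable lborel (\<lambda>y::real. 1 / (1 + y\<^sup>2))"
proof -
  define f where "f = (\<lambda>x::real. indicator {0<..} x * (2 * x powr (- 0) / (x\<^sup>2 + 1\<^sup>2)))"
  have f: "integrable lborel f"
  proof (rule integrableI_nonneg)
    have "(\<integral>\<^sup>+x. ennreal (f x) \<partial>lborel) = ennreal (1 powr (- 0 - 1) * pi / cos (pi * 0 / 2))"
      unfolding f_def by (rule nn_integral_Beta_rational) auto
    thus "(\<integral>\<^sup>+x. ennreal (f x) \<partial>lborel) < \<infinity>" by simp
  qed (auto simp: f_def)
  have f': "integrable lborel (\<lambda>x. f (0 + (- 1) * x))"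
    by (rule lborel_integrable_real_affine[OF f]) simp
  have g: "integrable lborel (\<lambda>x. f x + f (0 + (- 1) * x) + indicator {0..0::real} x)"
    by (intro Bochner_Integration.integrable_add f f' integrable_real_indicator) auto
  show ?thesis
  proof (rule Bochner_Integration.integrable_bound[OF g])
    show "AE x in lborel. norm (1 / (1 + x\<^sup>2)) \<le> norm (f x + f (0 + (- 1) * x) + indicator {0..0} x)"
    proof (rule AE_I2)
      fix x :: real
      have "1 + x\<^sup>2 > 0" by (simp add: add_pos_nonneg)
      thus "norm (1 / (1 + x\<^sup>2)) \<le> norm (f x + f (0 + (- 1) * x) + indicator {0..0} x)"
        by (cases "x = 0"; cases "x > 0") (auto simp: f_def add.commute divide_right_mono)
    qed
  qed auto
qed

lemma integrable_vertical_line: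
  assumes z: "-1 < Re z" "Re z < 1" and c: "c > 0" "c > Re z"
    and cont: "continuous_on {w. Re w = c} (mellin_kernel z)"
  shows "integrable lborel (\<lambda>y. mellin_kernel z (Complex c y))"
proof -
  obtain C where C: "C > 0"
    "\<And>w. c \<le> Re w \<Longrightarrow> Re w \<le> c \<Longrightarrow> \<bar>Im w\<bar> \<ge> 1 + norm z \<Longrightarrow>
           norm (mellin_kernel z w) \<le> C / (1 + (Im w)\<^sup>2)"
    using norm_mellin_kernel_le[OF z c order.refl] by blast
  define Y where "Y = 1 + norm z"
  have Y: "Y \<ge> 0" by (simp add: Y_def)
  let ?f = "\<lambda>y. mellin_kernel z (Complex c y)"
  have cont': "continuous_on UNIV ?f"
    by (rule continuous_on_compose2[OF cont]) (auto simp: Complex_eq intro!: continuous_intros)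
  have "bounded (?f ` {- Y..Y})"
    by (intro compact_imp_bounded compact_continuous_image continuous_on_subset[OF cont']) auto
  then obtain B where B: "B > 0" "\<And>y. y \<in> {- Y..Y} \<Longrightarrow> norm (?f y) \<le> B"
    unfolding bounded_pos by auto
  \<comment> \<open>The decay bound serves outside \<open>[- Y, Y]\<close>; inside,
    \<open>1 + y^2 \<le> 1 + Y^2\<close> brings the bound \<open>B\<close> from compactness into the
    same shape.\<close>
  define E where "E = max C (B * (1 + Y\<^sup>2))"
  show ?thesis
  proof (rule Bochner_Integration.integrable_bound)
    show "integrable lborel (\<lambda>y::real. E * (1 / (1 + y\<^sup>2)))"
      by (intro integrable_mult_right integrable_Cauchy_density)
    show "?f \<in> borel_measurable lborel"
      using borel_measurable_continuous_onI[OF cont'] by simp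
    show "AE y in lborel. norm (?f y) \<le> norm (E * (1 / (1 + y\<^sup>2)))"
    proof (rule AE_I2)
      fix y :: real
      have pos: "1 + y\<^sup>2 > 0" by (simp add: add_pos_nonneg)
      have E: "E > 0" using C by (simp add: E_def)
      have "norm (?f y) \<le> E / (1 + y\<^sup>2)"
      proof (cases "\<bar>y\<bar> \<ge> Y")
        case True
        hence "norm (?f y) \<le> C / (1 + y\<^sup>2)" using C(2)[of "Complex c y"] by (simp add: Y_def)
        also have "\<dots> \<le> E / (1 + y\<^sup>2)" using pos by (intro divide_right_mono) (auto simp: E_def)
        finally show ?thesis .
      next
        case False
        hence "norm (?f y) \<le> B" by (intro B(2)) auto
        also have "\<dots> \<le> B * (1 + Y\<^sup>2) / (1 + y\<^sup>2)"
        proof -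
          have "y\<^sup>2 \<le> Y\<^sup>2" using False by (simp add: abs_le_square_iff[symmetric])
          hence "B * (1 + y\<^sup>2) \<le> B * (1 + Y\<^sup>2)" using B by (intro mult_left_mono) auto
          thus ?thesis using pos by (simp add: pos_le_divide_eq)
        qed
        also have "\<dots> \<le> E / (1 + y\<^sup>2)" using pos by (intro divide_right_mono) (auto simp: E_def)
        finally show ?thesis .
      qed
      thus "norm (?f y) \<le> norm (E * (1 / (1 + y\<^sup>2)))" using E pos by simp
    qed
  qed
qed

section \<open>Vertical line integrals\<close>

lemma sin_half_pi_times_eq_0:
  fixes v :: complex
  shows "sin (of_real pi * v / 2) = 0 \<longleftrightarrow> (\<exists>n::int. v = 2 * of_int n)"
proof -
  have "of_real pi * v / 2 = of_real (of_int n * pi) \<longleftrightarrow> v = 2 * of_int n" for n :: int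
  proof
    assume "of_real pi * v / 2 = of_real (of_int n * pi)"
    hence "of_real pi * v = of_real pi * (2 * of_int n)" by (simp add: field_simps)
    thus "v = 2 * of_int n" by (metis mult_cancel_left of_real_eq_0_iff pi_neq_zero)
  qed (simp add: field_simps)
  thus ?thesis unfolding sin_eq_0 by simp
qed

lemma holomorphic_mellin_kernel:
  assumes "\<And>w. w \<in> A \<Longrightarrow> Re w > 0 \<and> w \<noteq> 1 \<and> w - z \<noteq> 1 \<and> (\<forall>n::int. w - z \<noteq> 2 * of_int n)"
  shows "mellin_kernel z holomorphic_on A"
proof -
  have 1: "riemann_zeta holomorphic_on A"
    by (rule holomorphic_on_subset[OF holomorphic_riemann_zeta]) (use assms in auto)
  have 2: "(\<lambda>w. riemann_zeta (w - z)) holomorphic_on A"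
    by (rule holomorphic_on_compose_gen[OF _ holomorphic_riemann_zeta, unfolded o_def])
       (use assms in \<open>auto intro!: holomorphic_intros\<close>)
  have 3: "Gamma holomorphic_on A"
    using assms not_nonpos_Int_if_Re_pos by (intro holomorphic_Gamma) blast
  have 4: "(\<lambda>w. sin (of_real pi * (w - z) / 2)) holomorphic_on A"
    by (intro holomorphic_intros) auto
  have "sin (of_real pi * (w - z) / 2) \<noteq> 0" if "w \<in> A" for w
    using assms[OF that] by (simp add: sin_half_pi_times_eq_0)
  thus ?thesis
    unfolding mellin_kernel_def
    by (intro holomorphic_on_divide[OF holomorphic_on_mult[OF holomorphic_on_mult[OF 3 1] 2] 4])
qed

lemma integrable_powr_mellin_kernel:
  assumes z: "-1 < Re z" "Re z < 1" and c: "c > 0" "c > Re z" and x: "x > 0"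
    and cont: "continuous_on {w. Re w = c} (mellin_kernel z)"
  shows "integrable lborel (\<lambda>y. of_real x powr (- Complex c y) * mellin_kernel z (Complex c y))"
proof (rule Bochner_Integration.integrable_bound)
  show "integrable lborel (\<lambda>y. x powr (- c) *\<^sub>R mellin_kernel z (Complex c y))"
    by (intro integrable_scaleR_right integrable_vertical_line z c cont)
  have "continuous_on UNIV (\<lambda>y. mellin_kernel z (Complex c y))"
    by (rule continuous_on_compose2[OF cont]) (auto simp: Complex_eq intro!: continuous_intros)
  moreover have "continuous_on UNIV (\<lambda>y. of_real x powr (- Complex c y) :: complex)"
    unfolding powr_def Complex_eq using x by (auto intro!: continuous_intros)
  ultimately have "continuous_on UNIV (\<lambda>y. of_real x powr (- Complex c y) * mellin_kernel z (Complex c y))"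
    by (intro continuous_on_mult)
  thus "(\<lambda>y. of_real x powr (- Complex c y) * mellin_kernel z (Complex c y)) \<in> borel_measurable lborel"
    using borel_measurable_continuous_onI by simp
  show "AE y in lborel. norm (of_real x powr (- Complex c y) * mellin_kernel z (Complex c y))
      \<le> norm (x powr (- c) *\<^sub>R mellin_kernel z (Complex c y))"
    using x by (intro AE_I2) (simp add: norm_mult norm_powr_real_powr)
qed

lemma integral_even_half_line:
  fixes f :: "real \<Rightarrow> complex"
  assumes f: "integrable lborel f" and even: "\<And>x. f (- x) = f x"
  shows "(LBINT x:{0..}. f x) = (LBINT x. f x) / 2"
proof -
  have i1: "integrable lborel (\<lambda>x. indicator {0..} x *\<^sub>R f x)"
    and i2: "integrable lborel (\<lambda>x. indicator {..<0} x *\<^sub>R f x)"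
    by (intro integrable_mult_indicator f; simp)+
  have "(LBINT x. f x) = (LBINT x. indicator {0..} x *\<^sub>R f x + indicator {..<0} x *\<^sub>R f x)"
    by (intro Bochner_Integration.integral_cong) (auto simp: indicator_def)
  also have "\<dots> = (LBINT x. indicator {0..} x *\<^sub>R f x) + (LBINT x. indicator {..<0} x *\<^sub>R f x)"
    by (rule Bochner_Integration.integral_add[OF i1 i2])
  also have "(LBINT x. indicator {..<0} x *\<^sub>R f x) =
      \<bar>- 1\<bar> *\<^sub>R (LBINT x. indicator {..<0} (0 + (- 1) * x) *\<^sub>R f (0 + (- 1) * x))"
    by (rule lborel_integral_real_affine) simp
  also have "\<dots> = (LBINT x. indicator {0<..} x *\<^sub>R f x)"
    by (simp add: even) (intro Bochner_Integration.integral_cong, auto simp: indicator_def)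
  also have "\<dots> = (LBINT x. indicator {0..} x *\<^sub>R f x)"
  proof (rule integral_cong_AE)
    show "AE x in lborel. indicator {0<..} x *\<^sub>R f x = indicator {0..} x *\<^sub>R f x"
      using AE_lborel_singleton[of 0] by eventually_elim (auto simp: indicator_def)
  qed (use f in auto)
  finally show ?thesis by (simp add: set_lebesgue_integral_def)
qed

text \<open>Evenness in \<open>t\<close> allows the cosine to be replaced by a single exponential,
  and on the line that exponential is \<open>\<alpha> powr ((z + 1) / 2 - w)\<close>. Merging its
  \<open>w\<close>-part with \<open>(2 pi) powr (- w)\<close> gives the Mellin-Barnes form.\<close>

lemma xi_integral_eq_vertical_integral:
  fixes z :: complex and \<alpha> :: real
  assumes z: "-1 < Re z" "Re z < 1" and \<alpha>: "\<alpha> > 0"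
  defines "c \<equiv> (1 + Re z) / 2"
  shows "set_integrable lborel {0..} (xi_integrand z \<alpha>)"
    and "xi_integral z \<alpha> = of_real \<alpha> powr ((z + 1) / 2) / 2 *
      (LBINT y. of_real (2 * pi * \<alpha>) powr (- Complex c y) * mellin_kernel z (Complex c y))"
proof -
  have c: "0 < c" "c < 1" "Re z < c" "c < 1 + Re z" using z by (simp_all add: c_def)
  have cont: "continuous_on {w. Re w = c} (mellin_kernel z)"
  proof (rule holomorphic_on_imp_continuous_on[OF holomorphic_mellin_kernel])
    fix w assume "w \<in> {w. Re w = c}"
    hence w: "Re w = c" by simp
    have Re: "0 < Re (w - z)" "Re (w - z) < 1" using w z by (simp_all add: c_def)
    have "w - z \<noteq> 2 * of_int n" for n :: int
    proof
      assume "w - z = 2 * of_int n"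
      hence "Re (w - z) = of_int (2 * n)" by simp
      thus False using Re no_int_between_0_1 by metis
    qed
    moreover have "w \<noteq> 1" using w c by auto
    moreover have "w - z \<noteq> 1" using Re(2) by (metis less_irrefl one_complex.sel(1))
    ultimately show "Re w > 0 \<and> w \<noteq> 1 \<and> w - z \<noteq> 1 \<and> (\<forall>n::int. w - z \<noteq> 2 * of_int n)"
      using w c by simp
  qed
  define F where "F = (\<lambda>x y. of_real x powr (- Complex c y) * mellin_kernel z (Complex c y))"
  have F: "integrable lborel (F x)" if "x > 0" for x
    unfolding F_def using integrable_powr_mellin_kernel[OF z c(1,3) that cont] .
  \<comment> \<open>The shift by \<open>Im z / 2\<close> places \<open>t = 0\<close> at the centre
    \<open>w = (1 + z) / 2\<close> of the reflection, which makes \<open>E\<close> even.\<close>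
  define E where "E = (\<lambda>t. F (2 * pi) (Im z / 2 + 1 / 2 * t))"
  have E: "integrable lborel E"
    unfolding E_def by (intro lborel_integrable_real_affine F) auto
  have w_eq: "Complex c (Im z / 2 + 1 / 2 * t) = (1 + z + \<i> * of_real t) / 2" for t
    by (simp add: complex_eq_iff c_def)
  define A where "A = complex_of_real pi powr ((z + 3) / 2)"
  have A: "A \<noteq> 0" by (simp add: A_def)
  have integrand: "xi_integrand z \<alpha> t = A / 2 * (E t * of_real (cos (1 / 2 * t * ln \<alpha>)))" for t
    unfolding xi_integrand_eq[OF z] E_def F_def w_eq A_def by simp
  have E_even: "E (- t) = E t" for t
  proof -
    define w where "w = (1 + z + \<i> * of_real t) / 2"
    have w': "(1 + z + \<i> * of_real (- t)) / 2 = 1 + z - w" by (simp add: w_def field_simps)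
    have "Re w = (1 + Re z) / 2" by (simp add: w_def)
    thus ?thesis
      unfolding E_def F_def w_eq w' w_def[symmetric] by (rule mellin_kernel_reflection[OF z])
  qed
  have bounded_mult: "integrable lborel (\<lambda>t. E t * g t)"
    if "g \<in> borel_measurable lborel" "\<And>t. norm (g t) \<le> 1" for g :: "real \<Rightarrow> complex"
  proof (rule Bochner_Integration.integrable_bound[OF E])
    show "(\<lambda>t. E t * g t) \<in> borel_measurable lborel"
      using E that by (intro borel_measurable_times) auto
    show "AE t in lborel. norm (E t * g t) \<le> norm (E t)"
      using that(2) by (intro AE_I2) (simp add: norm_mult mult_left_le)
  qed
  have Ecos: "integrable lborel (\<lambda>t. E t * of_real (cos (1 / 2 * t * ln \<alpha>)))"
    by (intro bounded_mult) (auto simp: norm_mult)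
  have int: "integrable lborel (xi_integrand z \<alpha>)"
    unfolding integrand by (intro integrable_mult_right Ecos)
  thus "set_integrable lborel {0..} (xi_integrand z \<alpha>)"
    unfolding set_integrable_def by (intro integrable_mult_indicator) auto
  define G where "G = (\<lambda>t. E t * exp (- (\<i> * of_real (1 / 2 * t * ln \<alpha>))))"
  have G: "integrable lborel G"
    unfolding G_def by (intro bounded_mult) (auto simp: norm_exp_eq_Re)
  have G': "integrable lborel (\<lambda>t. G (0 + (- 1) * t))"
    by (rule lborel_integrable_real_affine[OF G]) simp
  have "(LBINT t. E t * of_real (cos (1 / 2 * t * ln \<alpha>))) = (LBINT t. (G t + G (0 + (- 1) * t)) / 2)"
  proof (intro Bochner_Integration.integral_cong refl)
    fix t :: real
    show "E t * of_real (cos (1 / 2 * t * ln \<alpha>)) = (G t + G (0 + (- 1) * t)) / 2"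
      by (simp add: G_def E_even cos_exp_eq algebra_simps flip: cos_of_real)
  qed
  also have "\<dots> = ((LBINT t. G t) + (LBINT t. G (0 + (- 1) * t))) / 2"
    by (simp only: Bochner_Integration.integral_add[OF G G'] integral_divide_zero)
  also have "(LBINT t. G (0 + (- 1) * t)) = (LBINT t. G t)"
    using lborel_integral_real_affine[of "- 1" G 0] by simp
  finally have cosG: "(LBINT t. E t * of_real (cos (1 / 2 * t * ln \<alpha>))) = (LBINT t. G t)" by simp
  have G_eq: "G t = of_real \<alpha> powr ((z + 1) / 2) * F (2 * pi * \<alpha>) (Im z / 2 + 1 / 2 * t)" for t
  proof -
    define w where "w = (1 + z + \<i> * of_real t) / 2"
    have "exp (- (\<i> * of_real (1 / 2 * t * ln \<alpha>))) = of_real \<alpha> powr ((z + 1) / 2 - w)"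
      using \<alpha> by (simp add: powr_def w_def Ln_of_real field_simps)
    also have "\<dots> = of_real \<alpha> powr ((z + 1) / 2) * of_real \<alpha> powr (- w)"
      using powr_add[of "of_real \<alpha>" "(z + 1) / 2" "- w"] by simp
    finally have 1: "exp (- (\<i> * of_real (1 / 2 * t * ln \<alpha>))) =
        of_real \<alpha> powr ((z + 1) / 2) * of_real \<alpha> powr (- w)" .
    have 2: "of_real (2 * pi * \<alpha>) powr (- w) = of_real (2 * pi) powr (- w) * (of_real \<alpha> powr (- w) :: complex)"
      unfolding of_real_mult[of "2 * pi"] using \<alpha> by (intro powr_times_real) auto
    show ?thesis
      unfolding G_def 1 E_def F_def w_eq unfolding w_def[symmetric] 2 by (simp add: mult_ac)
  qed
  have "(LBINT t. G t) = of_real \<alpha> powr ((z + 1) / 2) * (LBINT t. F (2 * pi * \<alpha>) (Im z / 2 + 1 / 2 * t))"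
    unfolding G_eq by (rule integral_mult_right_zero)
  also have "(LBINT t. F (2 * pi * \<alpha>) (Im z / 2 + 1 / 2 * t)) = 2 * (LBINT y. F (2 * pi * \<alpha>) y)"
    using lborel_integral_real_affine[of "1 / 2" "F (2 * pi * \<alpha>)" "Im z / 2"]
    by (simp add: scaleR_conv_of_real mult.commute)
  finally have G_int: "(LBINT t. G t) = of_real \<alpha> powr ((z + 1) / 2) * (2 * (LBINT y. F (2 * pi * \<alpha>) y))" .
  have "(LBINT t:{0..}. xi_integrand z \<alpha> t) = (LBINT t. xi_integrand z \<alpha> t) / 2"
    by (rule integral_even_half_line[OF int]) (simp add: integrand E_even)
  also have "(LBINT t. xi_integrand z \<alpha> t) = A / 2 * (LBINT t. G t)"
    unfolding integrand cosG[symmetric] by (rule integral_mult_right_zero)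
  finally have "(LBINT t:{0..}. xi_integrand z \<alpha> t) =
      A * (of_real \<alpha> powr ((z + 1) / 2) / 2 * (LBINT y. F (2 * pi * \<alpha>) y))"
    unfolding G_int by simp
  hence "xi_integral z \<alpha> = of_real \<alpha> powr ((z + 1) / 2) / 2 * (LBINT y. F (2 * pi * \<alpha>) y)"
    using A by (simp add: xi_integral_def A_def)
  thus "xi_integral z \<alpha> = of_real \<alpha> powr ((z + 1) / 2) / 2 *
      (LBINT y. of_real (2 * pi * \<alpha>) powr (- Complex c y) * mellin_kernel z (Complex c y))"
    by (simp add: F_def)
qed

section \<open>Moving a vertical line of integration across poles\<close>

lemma tendsto_symmetric_integral:
  fixes f :: "real \<Rightarrow> complex"
  assumes f: "integrable lborel f"
  shows "(\<lambda>n. integral {- real n..real n} f) \<longlonglongrightarrow> (LBINT x. f x)"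
proof -
  have "(\<lambda>n. LBINT x. indicator {- real n..real n} x *\<^sub>R f x) \<longlonglongrightarrow> (LBINT x. f x)"
  proof (rule integral_dominated_convergence[where w = "\<lambda>x. norm (f x)"])
    show "AE x in lborel. (\<lambda>n. indicator {- real n..real n} x *\<^sub>R f x) \<longlonglongrightarrow> f x"
    proof (rule AE_I2)
      fix x :: real
      obtain N :: nat where N: "\<bar>x\<bar> \<le> real N" using real_arch_simple by blast
      have "eventually (\<lambda>n. f x = indicator {- real n..real n} x *\<^sub>R f x) sequentially"
        using eventually_ge_at_top[of N]
      proof eventually_elim
        case (elim n)
        hence "x \<in> {- real n..real n}" using N by (auto simp: abs_le_iff)
        thus ?case by simp
      qed
      thus "(\<lambda>n. indicator {- real n..real n} x *\<^sub>R f x) \<longlonglongrightarrow> f x"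
        by (rule Lim_transform_eventually[OF tendsto_const])
    qed
  qed (use f in \<open>auto simp: indicator_def\<close>)
  moreover have "(LBINT x. indicator {- real n..real n} x *\<^sub>R f x) = integral {- real n..real n} f" for n
  proof -
    have "set_integrable lborel {- real n..real n} f"
      unfolding set_integrable_def by (intro integrable_mult_indicator f) auto
    from set_borel_integral_eq_integral(2)[OF this] show ?thesis
      by (simp add: set_lebesgue_integral_def)
  qed
  ultimately show ?thesis by simp
qed

text \<open>The residue theorem on rectangles of growing height. The horizontal sides vanish by the
  decay, the upward side at \<open>d\<close> and the downward side at \<open>c\<close> tend to the
  two line integrals, and \<open>dw = \<i> dy\<close> leaves \<open>2 pi\<close> in place of
  \<open>2 pi \<i>\<close>. The margins \<open>a\<close> and \<open>b\<close> provide an open set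
  around the closed strip.\<close>

lemma vertical_line_shift:
  fixes H :: "complex \<Rightarrow> complex" and a b c d :: real
  assumes ab: "a < c" "c < d" "d < b" and fin: "finite P"
    and hol: "H holomorphic_on {w. a < Re w \<and> Re w < b} - P"
    and P: "\<And>p. p \<in> P \<Longrightarrow> c < Re p \<and> Re p < d"
    and decay: "\<And>w. c \<le> Re w \<Longrightarrow> Re w \<le> d \<Longrightarrow> \<bar>Im w\<bar> \<ge> Y \<Longrightarrow> norm (H w) \<le> C / (1 + (Im w)\<^sup>2)"
    and int_c: "integrable lborel (\<lambda>y. H (Complex c y))"
    and int_d: "integrable lborel (\<lambda>y. H (Complex d y))"
  shows "(LBINT y. H (Complex c y)) = (LBINT y. H (Complex d y)) - 2 * of_real pi * (\<Sum>p\<in>P. residue H p)"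
proof -
  define S where "S = {w. a < Re w \<and> Re w < b}"
  have S: "open S" "connected S"
  proof -
    have S_eq: "S = {w. Re w > a} \<inter> {w. Re w < b}" by (auto simp: S_def)
    show "open S" unfolding S_eq by (intro open_Int open_halfspace_Re_gt open_halfspace_Re_lt)
    show "connected S" unfolding S_eq
      by (intro convex_connected convex_Int convex_halfspace_Re_gt convex_halfspace_Re_lt)
  qed
  define r where "r = (\<Sum>p\<in>P. residue H p)"
  \<comment> \<open>From height \<open>Y0\<close> on, the decay estimate holds and all poles lie
    inside the rectangle, so its horizontal sides avoid them.\<close>
  obtain Y0 where Y0: "Y0 > 0" "Y0 \<ge> Y" "\<And>p. p \<in> P \<Longrightarrow> \<bar>Im p\<bar> < Y0"
  proof -
    have "finite ((\<lambda>p. \<bar>Im p\<bar>) ` P)" using fin by simp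
    then obtain M where M: "\<And>p. p \<in> P \<Longrightarrow> \<bar>Im p\<bar> \<le> M"
      using bdd_above_finite unfolding bdd_above_def by (metis imageI)
    show ?thesis by (rule that[of "max (max 1 Y) (M + 1)"]) (use M in fastforce)+
  qed
  \<comment> \<open>Nonnegativity of the bound is read off from its holding for a norm at one
    point.\<close>
  have C0: "0 \<le> C / (1 + T\<^sup>2)" if "T \<ge> Y0" for T
    using decay[of "Complex c T"] that Y0 ab by (smt (verit) complex.sel norm_ge_zero)
  define hor where "hor = (\<lambda>T. contour_integral (linepath (Complex c T) (Complex d T)) H)"
  have cont: "continuous_on X H" if "X \<subseteq> S - P" for X
    using holomorphic_on_imp_continuous_on[OF hol] that unfolding S_def[symmetric]
    by (rule continuous_on_subset)
  have seg_hor: "closed_segment (Complex c T) (Complex d T) = {w. Im w = T \<and> c \<le> Re w \<and> Re w \<le> d}" for T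
    using ab by (subst closed_segment_same_Im) (auto simp: closed_segment_eq_real_ivl)
  have seg_ver: "closed_segment (Complex x (- T)) (Complex x T) = {w. Re w = x \<and> - T \<le> Im w \<and> Im w \<le> T}"
    if "T > 0" for x T
    using that by (subst closed_segment_same_Re) (auto simp: closed_segment_eq_real_ivl)
  have hor_sub: "closed_segment (Complex c T) (Complex d T) \<subseteq> S - P" if "\<bar>T\<bar> \<ge> Y0" for T
    unfolding seg_hor using ab that Y0(3) by (fastforce simp: S_def)
  have ver_sub: "closed_segment (Complex x (- T)) (Complex x T) \<subseteq> S - P" if "x = c \<or> x = d" "T > 0" for x T
    unfolding seg_ver[OF that(2)] using ab that(1) P by (fastforce simp: S_def)
  have hor_int: "H contour_integrable_on (linepath (Complex c T) (Complex d T))" if "\<bar>T\<bar> \<ge> Y0" for T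
    by (intro contour_integrable_continuous_linepath cont hor_sub that)
  have ver_int: "H contour_integrable_on (linepath (Complex x (- T)) (Complex x T))"
    if "x = c \<or> x = d" "T > 0" for x T
    by (intro contour_integrable_continuous_linepath cont ver_sub that)
  have hor_le: "norm (hor T) \<le> C / (1 + T\<^sup>2) * (d - c)" if "\<bar>T\<bar> \<ge> Y0" for T
  proof -
    have "norm (hor T) \<le> C / (1 + T\<^sup>2) * norm (Complex d T - Complex c T)"
      unfolding hor_def
    proof (rule contour_integral_bound_linepath[OF hor_int[OF that]])
      show "0 \<le> C / (1 + T\<^sup>2)" using C0[of "\<bar>T\<bar>"] that by simp
      show "norm (H w) \<le> C / (1 + T\<^sup>2)" if "w \<in> closed_segment (Complex c T) (Complex d T)" for w
        using that decay[of w] \<open>\<bar>T\<bar> \<ge> Y0\<close> Y0 unfolding seg_hor by auto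
    qed
    also have "Complex d T - Complex c T = of_real (d - c)" by (simp add: complex_eq_iff)
    also have "norm (complex_of_real (d - c)) = d - c" using ab by (simp only: norm_of_real)
    finally show ?thesis .
  qed
  have rect: "hor (- T) + \<i> * integral {-T..T} (\<lambda>y. H (Complex d y)) - hor T
      - \<i> * integral {-T..T} (\<lambda>y. H (Complex c y)) = 2 * of_real pi * \<i> * r" if T: "T \<ge> Y0" for T
  proof -
    have T0: "T > 0" using T Y0 by simp
    let ?l1 = "linepath (Complex c (- T)) (Complex d (- T))"
    let ?l2 = "linepath (Complex d (- T)) (Complex d T)"
    let ?l3 = "linepath (Complex d T) (Complex c T)"
    let ?l4 = "linepath (Complex c T) (Complex c (- T))"
    define g where "g = rectpath (Complex c (- T)) (Complex d T)"
    have g_eq: "g = ?l1 +++ ?l2 +++ ?l3 +++ ?l4"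
      by (simp add: g_def rectpath_def Let_def)
    have i1: "H contour_integrable_on ?l1" using hor_int[of "- T"] T T0 by simp
    have i2: "H contour_integrable_on ?l2" using ver_int[of d T] T0 by simp
    have i3: "H contour_integrable_on ?l3"
      by (intro contour_integrable_continuous_linepath cont)
         (use hor_sub[of T] T T0 in \<open>simp add: closed_segment_commute\<close>)
    have i4: "H contour_integrable_on ?l4"
      by (intro contour_integrable_continuous_linepath cont)
         (use ver_sub[of c T] T0 in \<open>simp add: closed_segment_commute\<close>)
    have r3: "contour_integral ?l3 H = - hor T"
      unfolding hor_def
      by (intro contour_integral_reverse_linepath cont)
         (use hor_sub[of T] T T0 in \<open>simp add: closed_segment_commute\<close>)
    have r4: "contour_integral ?l4 H = - contour_integral (linepath (Complex c (- T)) (Complex c T)) H"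
      by (intro contour_integral_reverse_linepath cont)
         (use ver_sub[of c T] T0 in \<open>simp add: closed_segment_commute\<close>)
    have v: "contour_integral (linepath (Complex x (- T)) (Complex x T)) H =
        \<i> * integral {-T..T} (\<lambda>y. H (Complex x y))" for x
      using T0 by (intro contour_integral_linepath_same_Re) auto
    have "contour_integral g H = hor (- T) + \<i> * integral {-T..T} (\<lambda>y. H (Complex d y)) - hor T
      - \<i> * integral {-T..T} (\<lambda>y. H (Complex c y))"
      unfolding g_eq using i1 i2 i3 i4 by (simp add: r3 r4 v hor_def)
    moreover have "contour_integral g H = 2 * pi * \<i> * (\<Sum>p\<in>P. winding_number g p * residue H p)"
    proof (rule Residue_theorem[OF S fin])
      show "H holomorphic_on S - P" using hol by (simp add: S_def)
      show "valid_path g" "pathfinish g = pathstart g" by (simp_all add: g_def)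
      show "path_image g \<subseteq> S - P"
      proof -
        have "closed_segment (Complex d T) (Complex c T) \<subseteq> S - P"
          "closed_segment (Complex c T) (Complex c (- T)) \<subseteq> S - P"
          using hor_sub[of T] ver_sub[of c T] T T0 by (simp_all add: closed_segment_commute)
        moreover have "closed_segment (Complex c (- T)) (Complex d (- T)) \<subseteq> S - P"
          "closed_segment (Complex d (- T)) (Complex d T) \<subseteq> S - P"
          using hor_sub[of "- T"] ver_sub[of d T] T T0 by simp_all
        ultimately show ?thesis
          unfolding g_eq by (simp add: path_image_join)
      qed
      show "\<forall>w. w \<notin> S \<longrightarrow> winding_number g w = 0"
      proof (intro allI impI)
        fix w assume "w \<notin> S"
        hence "w \<notin> cbox (Complex c (- T)) (Complex d T)"
          using ab by (auto simp: S_def in_cbox_complex_iff)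
        thus "winding_number g w = 0"
          unfolding g_def using ab T0 by (intro winding_number_rectpath_outside) auto
      qed
    qed
    moreover have "(\<Sum>p\<in>P. winding_number g p * residue H p) = r"
      unfolding r_def
    proof (rule sum.cong[OF refl])
      fix p assume p: "p \<in> P"
      have "p \<in> box (Complex c (- T)) (Complex d T)"
        using P[OF p] Y0(3)[OF p] T by (auto simp: in_box_complex_iff)
      thus "winding_number g p * residue H p = residue H p"
        unfolding g_def by (simp add: winding_number_rectpath)
    qed
    ultimately show ?thesis by simp
  qed
  have bnd_lim: "(\<lambda>n. C / (1 + (real n)\<^sup>2) * (d - c)) \<longlonglongrightarrow> 0"
  proof -
    have "filterlim (\<lambda>n. 1 + (real n)\<^sup>2) at_top sequentially"
      by (intro filterlim_tendsto_add_at_top[OF tendsto_const] filterlim_pow_at_top filterlim_real_sequentially) auto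
    hence "(\<lambda>n. C / (1 + (real n)\<^sup>2)) \<longlonglongrightarrow> 0"
      by (intro tendsto_divide_0[OF tendsto_const] filterlim_at_top_imp_at_infinity)
    from tendsto_mult_left_zero[OF this] show ?thesis .
  qed
  have ev: "eventually (\<lambda>n. real n \<ge> Y0) sequentially"
    using filterlim_real_sequentially by (simp add: filterlim_at_top)
  have l1: "(\<lambda>n. hor (real n)) \<longlonglongrightarrow> 0"
    by (rule Lim_null_comparison[OF _ bnd_lim])
       (use ev in eventually_elim, use hor_le in auto)
  have l2: "(\<lambda>n. hor (- real n)) \<longlonglongrightarrow> 0"
  proof (rule Lim_null_comparison[OF _ bnd_lim])
    show "\<forall>\<^sub>F n in sequentially. norm (hor (- real n)) \<le> C / (1 + (real n)\<^sup>2) * (d - c)"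
      using ev
    proof eventually_elim
      case (elim n)
      thus ?case using hor_le[of "- real n"] by auto
    qed
  qed
  have "(\<lambda>n. hor (- real n) + \<i> * integral {-real n..real n} (\<lambda>y. H (Complex d y)) - hor (real n)
      - \<i> * integral {-real n..real n} (\<lambda>y. H (Complex c y))) \<longlonglongrightarrow>
      0 + \<i> * (LBINT y. H (Complex d y)) - 0 - \<i> * (LBINT y. H (Complex c y))"
    by (intro tendsto_intros l1 l2 tendsto_symmetric_integral int_c int_d)
  moreover have "(\<lambda>n. hor (- real n) + \<i> * integral {-real n..real n} (\<lambda>y. H (Complex d y)) - hor (real n)
      - \<i> * integral {-real n..real n} (\<lambda>y. H (Complex c y))) \<longlonglongrightarrow> 2 * of_real pi * \<i> * r"
    by (rule Lim_transform_eventually[OF tendsto_const]) (use ev in eventually_elim, use rect in auto)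
  ultimately have "0 + \<i> * (LBINT y. H (Complex d y)) - 0 - \<i> * (LBINT y. H (Complex c y)) = 2 * of_real pi * \<i> * r"
    by (rule LIMSEQ_unique)
  hence "\<i> * ((LBINT y. H (Complex d y)) - (LBINT y. H (Complex c y))) = \<i> * (2 * of_real pi * r)"
    by (simp add: algebra_simps)
  hence "(LBINT y. H (Complex d y)) - (LBINT y. H (Complex c y)) = 2 * of_real pi * r"
    by simp
  thus ?thesis by (simp add: r_def algebra_simps)
qed

section \<open>Residues and the expansion\<close>

definition mellin_integrand :: "real \<Rightarrow> complex \<Rightarrow> complex \<Rightarrow> complex" where
  "mellin_integrand x z w = of_real x powr (- w) * mellin_kernel z w"

text \<open>The pole comes from a simple zero of the sine, with derivative
  \<open>pi / 2 * (- 1) ^ (m + 1)\<close>. The rule for simple poles also asks for a nonzero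
  numerator, hence the appeal to the nonvanishing of zeta.\<close>

lemma residue_mellin_integrand_series:
  fixes z :: complex and x :: real and m :: nat
  assumes z: "-1 < Re z" and x: "x > 0"
  defines "p \<equiv> z + 2 * of_nat (Suc m)"
  shows "residue (mellin_integrand x z) p =
     of_real x powr (- p) * Gamma p * riemann_zeta p * riemann_zeta (2 * of_nat (Suc m)) *
       (2 / of_real pi * (- 1) ^ Suc m)"
proof -
  \<comment> \<open>To the right of the poles \<open>1\<close> and \<open>1 + z\<close> of the zeta
    factors, where the numerator is holomorphic.\<close>
  define S where "S = {w. Re w > 1} \<inter> {w. Re w > 1 + Re z}"
  define f where "f = (\<lambda>w. of_real x powr (- w) * Gamma w * riemann_zeta w * riemann_zeta (w - z))"
  define g where "g = (\<lambda>w. sin (of_real pi * (w - z) / 2))"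
  have p: "Re p > 1" "p - z = 2 * of_nat (Suc m)" using z by (simp_all add: p_def)
  have c: "cos (of_real pi * of_nat (Suc m)) = ((- 1) ^ Suc m :: complex)"
  proof -
    have "cos (complex_of_real (pi * real (Suc m))) = of_real ((- 1) ^ Suc m)"
      unfolding cos_of_real by (simp only: cos_npi2)
    thus ?thesis by simp
  qed
  have "residue (\<lambda>w. f w / g w) p = f p / (of_real pi / 2 * (- 1) ^ Suc m)"
  proof (rule residue_simple_pole_deriv)
    show "open S" unfolding S_def by (intro open_Int open_halfspace_Re_gt)
    show "connected S" unfolding S_def
      by (intro convex_connected convex_Int convex_halfspace_Re_gt)
    show "p \<in> S" using p(1) by (auto simp: S_def p_def)
    have 1: "riemann_zeta holomorphic_on S"
      by (rule holomorphic_on_subset[OF holomorphic_riemann_zeta]) (auto simp: S_def)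
    have 2: "(\<lambda>w. riemann_zeta (w - z)) holomorphic_on S"
      by (rule holomorphic_on_compose_gen[OF _ holomorphic_riemann_zeta, unfolded o_def])
         (auto intro!: holomorphic_intros simp: S_def complex_eq_iff)
    have 3: "(\<lambda>w. of_real x powr (- w) * Gamma w) holomorphic_on S"
      by (intro holomorphic_intros) (use not_nonpos_Int_if_Re_pos in \<open>force simp: S_def\<close>)
    show "f holomorphic_on S"
      unfolding f_def by (rule holomorphic_on_mult[OF holomorphic_on_mult[OF 3 1] 2])
    show "g holomorphic_on S" unfolding g_def by (intro holomorphic_intros) auto
    have "(g has_field_derivative cos (of_real pi * (p - z) / 2) * (of_real pi / 2)) (at p)"
      unfolding g_def by (auto intro!: derivative_eq_intros)
    thus "(g has_field_derivative of_real pi / 2 * (- 1) ^ Suc m) (at p)"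
    proof -
      have "of_real pi * (p - z) / 2 = of_real pi * of_nat (Suc m)" unfolding p(2) by simp
      with \<open>(g has_field_derivative _) _\<close> show ?thesis by (simp only: c mult.commute)
    qed
    have "g p = 0"
      unfolding g_def p(2) sin_half_pi_times_eq_0 by (metis of_int_of_nat_eq)
    thus "g p = 0" .
    show "complex_of_real pi / 2 * (- 1) ^ Suc m \<noteq> 0" by simp
    have "Gamma p \<noteq> 0"
      using not_nonpos_Int_if_Re_pos[of p] p(1) by (simp add: Gamma_eq_zero_iff)
    moreover have "riemann_zeta p \<noteq> 0" by (rule riemann_zeta_nonzero[OF p(1)])
    moreover have "riemann_zeta (p - z) \<noteq> 0"
      unfolding p(2) by (rule riemann_zeta_nonzero) simp
    ultimately show "f p \<noteq> 0" using x by (simp add: f_def)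
  qed
  moreover have "(\<lambda>w. f w / g w) = mellin_integrand x z"
    by (simp add: fun_eq_iff f_def g_def mellin_integrand_def mellin_kernel_def)
  moreover have "f p = of_real x powr (- p) * Gamma p * riemann_zeta p * riemann_zeta (2 * of_nat (Suc m))"
    by (simp only: f_def p(2))
  moreover have "f p / (of_real pi / 2 * (- 1) ^ Suc m) = f p * (2 / of_real pi * (- 1) ^ Suc m)"
  proof -
    have "f p / (of_real pi / 2 * s) = f p * (2 / of_real pi * (1 / s))" for s by simp
    moreover have "1 / ((- 1) ^ Suc m :: complex) = (- 1) ^ Suc m" by (cases "even m") auto
    ultimately show ?thesis by metis
  qed
  ultimately show ?thesis by simp
qed

text \<open>Writing \<open>riemann_zeta w\<close> as \<open>zeta_reg w / (w - 1)\<close> isolates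
  the pole; \<open>sin (pi (1 - z) / 2) = cos (pi z / 2)\<close> does not vanish in the strip. For
  \<open>z \<noteq> 0\<close> the other pole \<open>1 + z\<close> stays apart.\<close>

lemma residue_mellin_integrand_at_1:
  fixes z :: complex and x :: real
  assumes z: "-1 < Re z" "Re z < 1" "z \<noteq> 0" and x: "x > 0"
  shows "residue (mellin_integrand x z) 1 = riemann_zeta (1 - z) / (of_real x * cos (of_real pi * z / 2))"
proof -
  define A where "A = ({w. Re w > 0} - {1 + z}) \<inter> {w. sin (of_real pi * (w - z) / 2) \<noteq> 0}"
  define f where "f = (\<lambda>w. of_real x powr (- w) * Gamma w * zeta_reg w * riemann_zeta (w - z)
      / sin (of_real pi * (w - z) / 2))"
  have sin1: "sin (of_real pi * (1 - z) / 2) = cos (of_real pi * z / 2)"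
  proof -
    have "of_real pi * (1 - z) / 2 = of_real pi / 2 - of_real pi * z / 2" by (simp add: field_simps)
    thus ?thesis by (simp only: cos_sin_eq)
  qed
  have "sin (of_real pi * (1 - z) / 2) \<noteq> 0"
  proof
    assume "sin (of_real pi * (1 - z) / 2) = 0"
    then obtain n :: int where "1 - z = 2 * of_int n" unfolding sin_half_pi_times_eq_0 by auto
    hence "Re (1 - z) = Re (2 * of_int n)" by (simp only:)
    hence "1 - Re z = 2 * of_int n" by simp
    hence "0 < real_of_int n \<and> real_of_int n < 1" using z by linarith
    thus False using no_int_between_0_1 by blast
  qed
  hence A1: "1 \<in> A" using z by (auto simp: A_def)
  have A: "open A"
    unfolding A_def
    by (intro open_Int open_Diff open_halfspace_Re_gt open_Collect_neq continuous_intros) auto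
  have "f holomorphic_on A"
  proof -
    have 1: "(\<lambda>w. riemann_zeta (w - z)) holomorphic_on A"
      by (rule holomorphic_on_compose_gen[OF _ holomorphic_riemann_zeta, unfolded o_def])
         (auto intro!: holomorphic_intros simp: A_def algebra_simps)
    have 2: "(\<lambda>w. of_real x powr (- w) * Gamma w * zeta_reg w) holomorphic_on A"
      by (intro holomorphic_intros holomorphic_zeta_reg)
         (use not_nonpos_Int_if_Re_pos in \<open>force simp: A_def\<close>)
    have 3: "(\<lambda>w. sin (of_real pi * (w - z) / 2)) holomorphic_on A"
      by (intro holomorphic_intros) auto
    show ?thesis
      unfolding f_def
      by (rule holomorphic_on_divide[OF holomorphic_on_mult[OF 2 1] 3]) (simp add: A_def)
  qed
  hence "residue (\<lambda>w. f w / (w - 1)) 1 = f 1" by (rule residue_simple[OF A A1])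
  moreover have "residue (mellin_integrand x z) 1 = residue (\<lambda>w. f w / (w - 1)) 1"
  proof (rule residue_cong)
    show "\<forall>\<^sub>F w in at 1. mellin_integrand x z w = f w / (w - 1)"
      using eventually_neq_at_within[of 1]
      by eventually_elim
         (simp add: mellin_integrand_def mellin_kernel_def f_def riemann_zeta_eq_reg mult_ac)
  qed simp
  moreover have "f 1 = riemann_zeta (1 - z) / (of_real x * cos (of_real pi * z / 2))"
    unfolding f_def sin1 using x by (simp add: powr_minus field_simps)
  ultimately show ?thesis by simp
qed

lemma residue_mellin_integrand_at_1_plus:
  fixes z :: complex and x :: real
  assumes z: "-1 < Re z" "Re z < 1" "z \<noteq> 0" and x: "x > 0"
  shows "residue (mellin_integrand x z) (1 + z) =
     of_real x powr (- (1 + z)) * Gamma (1 + z) * riemann_zeta (1 + z)"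
proof -
  define A where "A = ({w. Re w > 0} - {1}) \<inter> {w. sin (of_real pi * (w - z) / 2) \<noteq> 0}"
  define f where "f = (\<lambda>w. of_real x powr (- w) * Gamma w * riemann_zeta w * zeta_reg (w - z)
      / sin (of_real pi * (w - z) / 2))"
  have sin1: "sin (of_real pi * ((1 + z) - z) / 2) = 1" by simp
  have A1: "1 + z \<in> A" using z sin1 by (auto simp: A_def)
  have A: "open A"
    unfolding A_def
    by (intro open_Int open_Diff open_halfspace_Re_gt open_Collect_neq continuous_intros) auto
  have "f holomorphic_on A"
  proof -
    have 1: "riemann_zeta holomorphic_on A"
      by (rule holomorphic_on_subset[OF holomorphic_riemann_zeta]) (auto simp: A_def)
    have 2: "(\<lambda>w. of_real x powr (- w) * Gamma w) holomorphic_on A"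
      by (intro holomorphic_intros)
         (use not_nonpos_Int_if_Re_pos in \<open>force simp: A_def\<close>)
    have 3: "(\<lambda>w. sin (of_real pi * (w - z) / 2)) holomorphic_on A"
      by (intro holomorphic_intros) auto
    have 4: "(\<lambda>w. zeta_reg (w - z)) holomorphic_on A"
      by (rule holomorphic_on_compose_gen[OF _ holomorphic_zeta_reg[of UNIV], unfolded o_def])
         (auto intro!: holomorphic_intros)
    show ?thesis
      unfolding f_def
      by (rule holomorphic_on_divide[OF holomorphic_on_mult[OF holomorphic_on_mult[OF 2 1] 4] 3])
         (simp add: A_def)
  qed
  hence "residue (\<lambda>w. f w / (w - (1 + z))) (1 + z) = f (1 + z)" by (rule residue_simple[OF A A1])
  moreover have "residue (mellin_integrand x z) (1 + z) = residue (\<lambda>w. f w / (w - (1 + z))) (1 + z)"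
  proof (rule residue_cong)
    show "\<forall>\<^sub>F w in at (1 + z). mellin_integrand x z w = f w / (w - (1 + z))"
      using eventually_neq_at_within[of "1 + z"]
    proof eventually_elim
      case (elim w)
      hence "w - z \<noteq> 1" by (auto simp: algebra_simps)
      hence "riemann_zeta (w - z) = zeta_reg (w - z) / (w - z - 1)" by (rule riemann_zeta_eq_reg)
      thus ?case by (simp add: mellin_integrand_def mellin_kernel_def f_def algebra_simps)
    qed
  qed simp
  moreover have "f (1 + z) = of_real x powr (- (1 + z)) * Gamma (1 + z) * riemann_zeta (1 + z)"
    by (simp add: f_def)
  ultimately show ?thesis by simp
qed

text \<open>The prefactor is \<open>\<alpha> powr ((z + 1) / 2) / 2\<close> from the vertical
  integral times \<open>- 2 pi\<close> from the shift of the line. The functional equation absorbs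
  the cosine in the residue at \<open>1\<close>.\<close>

lemma leading_formula_eq_residues:
  fixes z :: complex and \<alpha> :: real
  assumes z: "-1 < Re z" "Re z < 1" "z \<noteq> 0" and \<alpha>: "\<alpha> > 0"
  shows "leading_formula \<alpha> z = - (of_real pi * of_real \<alpha> powr ((z + 1) / 2)) *
     (riemann_zeta (1 - z) / (of_real (2 * pi * \<alpha>) * cos (of_real pi * z / 2)) +
      of_real (2 * pi * \<alpha>) powr (- (1 + z)) * Gamma (1 + z) * riemann_zeta (1 + z))"
proof -
  define P where "P = of_real (2 * pi) powr z"
  define a where "a = complex_of_real \<alpha>"
  have a: "a \<noteq> 0" using \<alpha> by (simp add: a_def)
  have P: "P \<noteq> 0" by (simp add: P_def)
  have C: "cos (of_real pi * z / 2) \<noteq> 0"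
  proof
    assume "cos (of_real pi * z / 2) = 0"
    hence "sin (of_real pi * (1 - z) / 2) = 0"
      using cos_sin_eq[of "of_real pi * z / 2"] by (simp add: field_simps)
    then obtain n :: int where "1 - z = 2 * of_int n" unfolding sin_half_pi_times_eq_0 by auto
    hence "Re (1 - z) = Re (2 * of_int n)" by (simp only:)
    hence "1 - Re z = 2 * of_int n" by simp
    hence "0 < real_of_int n \<and> real_of_int n < 1" using z by linarith
    thus False using no_int_between_0_1 by blast
  qed
  have 1: "of_real pi * a powr ((z + 1) / 2) * (riemann_zeta (1 - z) / (of_real (2 * pi * \<alpha>) * cos (of_real pi * z / 2)))
      = Gamma z * riemann_zeta z * a powr ((z - 1) / 2) / P"
  proof -
    have "a powr ((z + 1) / 2) = a powr ((z - 1) / 2) * a"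
      using a powr_add[of a "(z - 1) / 2" 1] by (simp add: field_simps)
    moreover have "complex_of_real (2 * pi * \<alpha>) = 2 * of_real pi * a" by (simp add: a_def)
    moreover have "riemann_zeta (1 - z) = 2 * cos (of_real pi * z / 2) * Gamma z * riemann_zeta z / P"
      unfolding P_def by (rule riemann_zeta_functional_equation[OF z])
    ultimately show ?thesis using a P C by (simp add: field_simps)
  qed
  have 2: "of_real pi * a powr ((z + 1) / 2) * (of_real (2 * pi * \<alpha>) powr (- (1 + z)) * Gamma (1 + z) * riemann_zeta (1 + z))
      = Gamma (z + 1) * riemann_zeta (z + 1) / (2 * a powr ((z + 1) / 2) * P)"
  proof -
    have "of_real (2 * pi * \<alpha>) powr (- (1 + z)) = of_real (2 * pi) powr (- (1 + z)) * a powr (- (1 + z))"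
      unfolding of_real_mult[of "2 * pi"] a_def using \<alpha> by (intro powr_times_real) auto
    also have "of_real (2 * pi) powr (- (1 + z)) = 1 / (2 * of_real pi * P)"
      unfolding powr_minus_divide by (simp add: powr_add P_def)
    also have "a powr (- (1 + z)) = 1 / (a powr ((z + 1) / 2) * a powr ((z + 1) / 2))"
      unfolding powr_minus_divide powr_add[symmetric]
      using mult_2[of "(z + 1) / 2"] by (simp add: add.commute)
    finally show ?thesis using a P by (simp add: add.commute)
  qed
  have "leading_formula \<alpha> z = - (Gamma z * riemann_zeta z * a powr ((z - 1) / 2) / P) -
      Gamma (z + 1) * riemann_zeta (z + 1) / (2 * a powr ((z + 1) / 2) * P)"
    by (simp add: leading_formula_def a_def P_def)
  thus ?thesis unfolding 1[symmetric] 2[symmetric] by (simp add: a_def algebra_simps)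
qed

text \<open>
  At \<open>z = 0\<close> the poles at \<open>1\<close> and \<open>1 + z\<close> merge into a double pole, whose residue is the limit of
  the sum of the two residues: both are the derivative at \<open>0\<close> of a difference \<open>p - q\<close> with
  \<open>p 0 = q 0\<close>.
\<close>

lemma leading_terms_eq_residues_0:
  fixes \<alpha> :: real
  assumes \<alpha>: "\<alpha> > 0"
  shows "leading_terms 0 \<alpha> = - (of_real pi * of_real \<alpha> powr (1 / 2)) * residue (mellin_integrand (2 * pi * \<alpha>) 0) 1"
proof -
  define x where "x = 2 * pi * \<alpha>"
  have x: "x > 0" using \<alpha> by (simp add: x_def)
  define B where "B = (\<lambda>w. of_real x powr (- w) * Gamma w * zeta_reg w)"
  define Q where "Q = (\<lambda>w. B w * zeta_reg w / sin (of_real pi * w / 2))"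
  define A where "A = {w::complex. Re w > 0} \<inter> {w. sin (of_real pi * w / 2) \<noteq> 0}"
  have A: "open A"
    unfolding A_def by (intro open_Int open_halfspace_Re_gt open_Collect_neq continuous_intros) auto
  have A1: "1 \<in> A" by (simp add: A_def)
  have B: "B holomorphic_on A"
    unfolding B_def by (intro holomorphic_intros holomorphic_zeta_reg)
      (use not_nonpos_Int_if_Re_pos in \<open>force simp: A_def\<close>)
  have Q: "Q holomorphic_on A"
    unfolding Q_def by (intro holomorphic_intros B holomorphic_zeta_reg) (auto simp: A_def)
  have dB: "(B has_field_derivative deriv B 1) (at 1)"
    by (rule holomorphic_derivI[OF B A A1])
  have dZ: "(zeta_reg has_field_derivative deriv zeta_reg 1) (at 1)"
    by (rule holomorphic_derivI[OF holomorphic_zeta_reg open_UNIV]) simp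
  have B1: "B 1 = 1 / of_real x" using x by (simp add: B_def powr_minus field_simps)
  \<comment> \<open>The sine is stationary at \<open>1\<close> with value \<open>1\<close>, so only
    \<open>B\<close> and the explicit factor \<open>zeta_reg\<close>, weighted by
    \<open>B 1 = 1 / x\<close>, contribute.\<close>
  have "(Q has_field_derivative deriv B 1 + deriv zeta_reg 1 / of_real x) (at 1)"
    unfolding Q_def by (auto intro!: derivative_eq_intros dB dZ simp: B1)
  hence dQ: "deriv Q 1 = deriv B 1 + deriv zeta_reg 1 / of_real x" by (rule DERIV_imp_deriv)
  have "residue (mellin_integrand x 0) 1 = residue (\<lambda>w. Q w / (w - 1) ^ Suc 1) 1"
  proof (rule residue_cong)
    show "\<forall>\<^sub>F w in at 1. mellin_integrand x 0 w = Q w / (w - 1) ^ Suc 1"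
      using eventually_neq_at_within[of 1]
      by eventually_elim
         (simp add: mellin_integrand_def mellin_kernel_def Q_def B_def riemann_zeta_eq_reg power2_eq_square mult_ac)
  qed simp
  also have "\<dots> = (deriv ^^ 1) Q 1 / fact 1"
    by (rule residue_holomorphic_over_power[OF A A1 Q])
  finally have res: "residue (mellin_integrand x 0) 1 = deriv B 1 + deriv zeta_reg 1 / of_real x"
    by (simp add: dQ)
  \<comment> \<open>For small \<open>z \<noteq> 0\<close> the sum of the two residues is
    \<open>(p z - q z) / z\<close>, since zeta at \<open>1 + z\<close> and \<open>1 - z\<close> has
    the polar factors \<open>1 / z\<close> and \<open>- 1 / z\<close>. The cosine is stationary at
    \<open>0\<close>, so \<open>q\<close> contributes only the derivative of
    \<open>zeta_reg\<close>, with the sign from \<open>1 - z\<close>.\<close>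
  define p where "p = (\<lambda>z. B (1 + z))"
  define q where "q = (\<lambda>z. zeta_reg (1 - z) / (of_real x * cos (of_real pi * z / 2)))"
  have "(p has_field_derivative deriv B 1) (at 0)"
  proof -
    have "((\<lambda>z::complex. 1 + z) has_field_derivative 1) (at 0)"
      by (auto intro!: derivative_eq_intros)
    from DERIV_chain2[OF _ this, of B "deriv B 1"] show ?thesis
      using dB by (simp add: p_def)
  qed
  moreover have "(q has_field_derivative - (deriv zeta_reg 1 / of_real x)) (at 0)"
  proof -
    have "((\<lambda>z. zeta_reg (1 - z)) has_field_derivative (deriv zeta_reg 1 * (- 1))) (at 0)"
      by (rule DERIV_chain2[of zeta_reg]) (use dZ in \<open>auto intro!: derivative_eq_intros\<close>)
    thus ?thesis
      unfolding q_def using x by (auto intro!: derivative_eq_intros simp: field_simps)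
  qed
  ultimately have "((\<lambda>z. p z - q z) has_field_derivative residue (mellin_integrand x 0) 1) (at 0)"
    unfolding res by (auto intro!: derivative_eq_intros)
  moreover have "p 0 - q 0 = 0" by (simp add: p_def q_def B1)
  ultimately have lim: "((\<lambda>z. (p z - q z) / z) \<longlongrightarrow> residue (mellin_integrand x 0) 1) (at 0)"
    by (simp add: DERIV_def)
  have "((\<lambda>z. - (of_real pi * of_real \<alpha> powr ((z + 1) / 2)) * ((p z - q z) / z)) \<longlongrightarrow>
      - (of_real pi * of_real \<alpha> powr ((0 + 1) / 2)) * residue (mellin_integrand x 0) 1) (at 0)"
  proof (intro tendsto_mult lim tendsto_minus tendsto_const)
    have "isCont (\<lambda>z. of_real \<alpha> powr ((z + 1) / 2) :: complex) 0"
      unfolding powr_def using \<alpha> by (auto intro!: continuous_intros)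
    thus "((\<lambda>z. of_real \<alpha> powr ((z + 1) / 2) :: complex) \<longlongrightarrow> of_real \<alpha> powr ((0 + 1) / 2)) (at 0)"
      by (simp add: isCont_def)
  qed
  moreover have "\<forall>\<^sub>F z in at 0. - (of_real pi * of_real \<alpha> powr ((z + 1) / 2)) * ((p z - q z) / z) = leading_formula \<alpha> z"
  proof -
    have "\<forall>\<^sub>F z in at (0::complex). z \<in> ball 0 1 - {0}"
      by (intro eventually_at_in_open) auto
    thus ?thesis
    proof eventually_elim
      case (elim z)
      hence z0: "z \<noteq> 0" and "norm z < 1" by auto
      hence z: "-1 < Re z" "Re z < 1" using abs_Re_le_cmod[of z] by linarith+
      have "riemann_zeta (1 - z) = - zeta_reg (1 - z) / z" "riemann_zeta (1 + z) = zeta_reg (1 + z) / z"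
        using z0 riemann_zeta_eq_reg[of "1 - z"] riemann_zeta_eq_reg[of "1 + z"] by simp_all
      hence "riemann_zeta (1 - z) / (of_real x * cos (of_real pi * z / 2)) +
          of_real x powr (- (1 + z)) * Gamma (1 + z) * riemann_zeta (1 + z) = (p z - q z) / z"
        by (simp add: p_def q_def B_def diff_divide_distrib)
      thus ?case
        using leading_formula_eq_residues[OF z z0 \<alpha>] unfolding x_def by simp
    qed
  qed
  ultimately have "(leading_formula \<alpha> \<longlongrightarrow>
      - (of_real pi * of_real \<alpha> powr ((0 + 1) / 2)) * residue (mellin_integrand x 0) 1) (at 0)"
    by (rule Lim_transform_eventually)
  hence "Lim (at 0) (leading_formula \<alpha>) =
      - (of_real pi * of_real \<alpha> powr ((0 + 1) / 2)) * residue (mellin_integrand x 0) 1"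
    by (intro tendsto_Lim) auto
  thus ?thesis by (simp add: leading_terms_def x_def)
qed

text \<open>For \<open>z = 0\<close> the index set \<open>{1, 1 + z}\<close> has one element, in
  agreement with the merged double pole, so one formula covers both cases.\<close>

lemma leading_terms_eq_residues:
  fixes z :: complex and \<alpha> :: real
  assumes z: "-1 < Re z" "Re z < 1" and \<alpha>: "\<alpha> > 0"
  shows "leading_terms z \<alpha> = - (of_real pi * of_real \<alpha> powr ((z + 1) / 2)) *
     (\<Sum>p\<in>{1, 1 + z}. residue (mellin_integrand (2 * pi * \<alpha>) z) p)"
proof (cases "z = 0")
  case True
  thus ?thesis using leading_terms_eq_residues_0[OF \<alpha>] by simp
next
  case False
  have x: "2 * pi * \<alpha> > 0" using \<alpha> by simp
  have "leading_terms z \<alpha> = leading_formula \<alpha> z" using False by (simp add: leading_terms_def)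
  also have "\<dots> = - (of_real pi * of_real \<alpha> powr ((z + 1) / 2)) *
     (residue (mellin_integrand (2 * pi * \<alpha>) z) 1 + residue (mellin_integrand (2 * pi * \<alpha>) z) (1 + z))"
    unfolding residue_mellin_integrand_at_1[OF z False x] residue_mellin_integrand_at_1_plus[OF z False x]
    by (rule leading_formula_eq_residues[OF z False \<alpha>])
  finally show ?thesis using False by simp
qed

text \<open>\<open>- pi\<close> times the factor \<open>2 / pi * (- 1) ^ (m + 1)\<close> of the
  residue is the factor \<open>2 * (- 1) ^ m\<close> of the series.\<close>

lemma series_term_eq_residue:
  fixes z :: complex and \<alpha> :: real
  assumes z: "-1 < Re z" and \<alpha>: "\<alpha> > 0"
  shows "series_term z m \<alpha> = - (of_real pi * of_real \<alpha> powr ((z + 1) / 2)) *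
     residue (mellin_integrand (2 * pi * \<alpha>) z) (z + 2 * of_nat (Suc m))"
proof -
  have x: "2 * pi * \<alpha> > 0" using \<alpha> by simp
  have e: "z + 2 * of_nat (Suc m) = 2 * of_nat m + z + 2" "2 * of_nat (Suc m) = 2 * of_nat m + (2::complex)"
     "2 * of_nat m + 2 + z = 2 * of_nat m + z + 2"
    by simp_all
  show ?thesis
    unfolding residue_mellin_integrand_series[OF z x] series_term_def
    unfolding e(1) unfolding e(2,3) powr_minus_divide by simp
qed

text \<open>\<open>d\<close> lies halfway between the real parts of the last collected pole
  \<open>z + 2 N + 2\<close> and the next one \<open>z + 2 N + 4\<close>, so the line avoids all
  poles and its exponent exceeds that of the last term by exactly one.\<close>

lemma xi_integral_expansion:
  fixes z :: complex and \<alpha> :: real and N :: nat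
  assumes z: "-1 < Re z" "Re z < 1" and \<alpha>: "\<alpha> > 0"
  defines "d \<equiv> Re z + 2 * real N + 3"
  shows "integrable lborel (\<lambda>y. mellin_kernel z (Complex d y))"
    and "xi_integral z \<alpha> - (leading_terms z \<alpha> + (\<Sum>m\<le>N. series_term z m \<alpha>)) =
      of_real \<alpha> powr ((z + 1) / 2) / 2 *
      (LBINT y. of_real (2 * pi * \<alpha>) powr (- Complex d y) * mellin_kernel z (Complex d y))"
proof -
  define x where "x = 2 * pi * \<alpha>"
  have x: "x > 0" using \<alpha> by (simp add: x_def)
  \<comment> \<open>This margin excludes the sine zero \<open>w = z\<close> and the poles of
    \<open>Gamma\<close>; the right margin \<open>b\<close> stops at the first sine zero that is not
    collected.\<close>
  define a where "a = max 0 (Re z)"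
  define b where "b = Re z + 2 * real N + 4"
  define c where "c = (1 + Re z) / 2"
  define L where "L = (\<lambda>m. z + 2 * of_nat (Suc m)) ` {..N}"
  define P where "P = {1, 1 + z} \<union> L"
  have ab: "a < c" "c < d" "d < b" using z by (auto simp: a_def b_def c_def d_def)
  have c: "c > 0" "c > Re z" and d: "d > 0" "d > Re z" "d > 1" using z by (auto simp: c_def d_def)
  have finP: "finite P" by (simp add: P_def L_def)
  have P: "c < Re p \<and> Re p < d" if "p \<in> P" for p
    using that z by (auto simp: P_def L_def c_def d_def)
  have K: "mellin_kernel z holomorphic_on {w. a < Re w \<and> Re w < b} - P"
  proof (rule holomorphic_mellin_kernel, intro conjI allI)
    fix w assume w: "w \<in> {w. a < Re w \<and> Re w < b} - P"
    show "Re w > 0" "w \<noteq> 1" using w by (auto simp: a_def P_def)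
    show "w - z \<noteq> 1" using w by (auto simp: P_def algebra_simps)
    fix n :: int
    show "w - z \<noteq> 2 * of_int n"
    proof
      assume eq: "w - z = 2 * of_int n"
      hence "Re (w - z) = Re (2 * of_int n)" by (simp only:)
      hence "Re w - Re z = 2 * of_int n" by simp
      \<comment> \<open>Between the margins only \<open>n = 1, ..., N + 1\<close> remain, and these
        zeros are the members of \<open>L\<close>.\<close>
      hence "0 < 2 * real_of_int n" "2 * real_of_int n < 2 * real N + 4"
        using w by (auto simp: a_def b_def)
      hence n: "0 < n" "n < int N + 2" by linarith+
      define m where "m = nat (n - 1)"
      have m: "n = int (Suc m)" "m \<le> N" using n by (auto simp: m_def)
      have "w = z + 2 * of_nat (Suc m)" using eq m(1) by (simp add: algebra_simps)
      hence "w \<in> P" using m(2) by (auto simp: P_def L_def)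
      thus False using w by simp
    qed
  qed
  have H: "mellin_integrand x z holomorphic_on {w. a < Re w \<and> Re w < b} - P"
    unfolding mellin_integrand_def by (intro holomorphic_on_mult K holomorphic_intros)
  have cont: "continuous_on {w. Re w = r} (mellin_kernel z)" if "r = c \<or> r = d" for r
    by (rule continuous_on_subset[OF holomorphic_on_imp_continuous_on[OF K]]) (use that ab P in auto)
  show "integrable lborel (\<lambda>y. mellin_kernel z (Complex d y))"
    by (rule integrable_vertical_line[OF z d(1,2) cont]) simp
  obtain C where C: "C > 0"
    "\<And>w. c \<le> Re w \<Longrightarrow> Re w \<le> d \<Longrightarrow> \<bar>Im w\<bar> \<ge> 1 + norm z \<Longrightarrow>
           norm (mellin_kernel z w) \<le> C / (1 + (Im w)\<^sup>2)"
    using norm_mellin_kernel_le[OF z c less_imp_le[OF ab(2)]] by blast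
  have shift: "(LBINT y. mellin_integrand x z (Complex c y)) =
      (LBINT y. mellin_integrand x z (Complex d y)) - 2 * of_real pi * (\<Sum>p\<in>P. residue (mellin_integrand x z) p)"
  proof (rule vertical_line_shift[OF ab finP H P])
    fix w assume w: "c \<le> Re w" "Re w \<le> d" "\<bar>Im w\<bar> \<ge> 1 + norm z"
    \<comment> \<open>The power is monotone in its exponent, in a direction that depends on whether
      \<open>x \<ge> 1\<close>; so one end of the strip always dominates, and the sum covers both
      cases.\<close>
    have "x powr (- Re w) \<le> x powr (- c) + x powr (- d)"
    proof (cases "x \<ge> 1")
      case True
      hence "x powr (- Re w) \<le> x powr (- c)" using w by (intro powr_mono) auto
      thus ?thesis by (simp add: add_increasing2)
    next
      case False
      hence "x powr (- Re w) \<le> x powr (- d)" using w x by (intro powr_mono') auto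
      thus ?thesis by (simp add: add_increasing)
    qed
    hence "norm (mellin_integrand x z w) \<le> (x powr (- c) + x powr (- d)) * (C / (1 + (Im w)\<^sup>2))"
      unfolding mellin_integrand_def norm_mult using x w
      by (intro mult_mono C(2)) (auto simp: norm_powr_real_powr)
    thus "norm (mellin_integrand x z w) \<le> ((x powr (- c) + x powr (- d)) * C) / (1 + (Im w)\<^sup>2)" by simp
  next
    show "integrable lborel (\<lambda>y. mellin_integrand x z (Complex c y))"
      unfolding mellin_integrand_def by (rule integrable_powr_mellin_kernel[OF z c x cont]) simp
    show "integrable lborel (\<lambda>y. mellin_integrand x z (Complex d y))"
      unfolding mellin_integrand_def by (rule integrable_powr_mellin_kernel[OF z d(1,2) x cont]) simp
  qed
  define R where "R = residue (mellin_integrand x z)"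
  define q where "q = of_real pi * complex_of_real \<alpha> powr ((z + 1) / 2)"
  have L_disj: "{1, 1 + z} \<inter> L = {}"
  proof -
    have "z + 2 * of_nat (Suc m) \<noteq> 1" for m
    proof
      assume "z + 2 * of_nat (Suc m) = 1"
      hence "Re (z + 2 * of_nat (Suc m)) = Re 1" by (simp only:)
      thus False using z by simp
    qed
    moreover have "z + 2 * of_nat (Suc m) \<noteq> 1 + z" for m
    proof
      assume "z + 2 * of_nat (Suc m) = 1 + z"
      hence "Re (z + 2 * of_nat (Suc m)) = Re (1 + z)" by (simp only:)
      thus False by simp
    qed
    ultimately show ?thesis by (fastforce simp: L_def)
  qed
  have "(\<Sum>p\<in>P. R p) = (\<Sum>p\<in>{1, 1 + z}. R p) + (\<Sum>p\<in>L. R p)"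
    unfolding P_def by (intro sum.union_disjoint L_disj) (auto simp: L_def)
  also have "(\<Sum>p\<in>L. R p) = (\<Sum>m\<le>N. R (z + 2 * of_nat (Suc m)))"
    unfolding L_def by (subst sum.reindex) (auto simp: inj_on_def)
  finally have sumP: "(\<Sum>p\<in>P. R p) = (\<Sum>p\<in>{1, 1 + z}. R p) + (\<Sum>m\<le>N. R (z + 2 * of_nat (Suc m)))" .
  have lead: "leading_terms z \<alpha> = - q * (\<Sum>p\<in>{1, 1 + z}. R p)"
    using leading_terms_eq_residues[OF z \<alpha>] by (simp only: q_def R_def x_def)
  have ser: "(\<Sum>m\<le>N. series_term z m \<alpha>) = - q * (\<Sum>m\<le>N. R (z + 2 * of_nat (Suc m)))"
    unfolding sum_distrib_left
    by (intro sum.cong refl) (use series_term_eq_residue[OF z(1) \<alpha>] in \<open>simp only: q_def R_def x_def\<close>)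
  have "xi_integral z \<alpha> = of_real \<alpha> powr ((z + 1) / 2) / 2 * (LBINT y. mellin_integrand x z (Complex c y))"
    using xi_integral_eq_vertical_integral(2)[OF z \<alpha>] by (simp only: mellin_integrand_def x_def c_def)
  also have "\<dots> = of_real \<alpha> powr ((z + 1) / 2) / 2 * (LBINT y. mellin_integrand x z (Complex d y)) +
      (leading_terms z \<alpha> + (\<Sum>m\<le>N. series_term z m \<alpha>))"
    unfolding shift R_def[symmetric] sumP lead ser by (simp add: q_def algebra_simps)
  finally show "xi_integral z \<alpha> - (leading_terms z \<alpha> + (\<Sum>m\<le>N. series_term z m \<alpha>)) =
      of_real \<alpha> powr ((z + 1) / 2) / 2 *
      (LBINT y. of_real (2 * pi * \<alpha>) powr (- Complex d y) * mellin_kernel z (Complex d y))"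
    by (simp add: mellin_integrand_def x_def)
qed

text \<open>Integrability is a separate claim because the integral of a non-integrable function is
  \<open>0\<close> by convention, so the expansion alone would not certify that
  \<open>xi_integral\<close> is a genuine integral.\<close>

theorem theorem1p10:
  fixes z :: complex
  assumes "-1 < Re z" and "Re z < 1"
  shows "(\<forall>\<alpha>>0. set_integrable lborel {0..} (xi_integrand z \<alpha>)) \<and>
         has_asymptotic_expansion (xi_integral z) (leading_terms z) (series_term z)"
proof (intro conjI allI impI)
  fix \<alpha> :: real assume "\<alpha> > 0"
  thus "set_integrable lborel {0..} (xi_integrand z \<alpha>)"
    by (rule xi_integral_eq_vertical_integral(1)[OF assms])
next
  show "has_asymptotic_expansion (xi_integral z) (leading_terms z) (series_term z)"
    unfolding has_asymptotic_expansion_def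
  proof
    fix N :: nat
    define d where "d = Re z + 2 * real N + 3"
    \<comment> \<open>Independent of \<open>\<alpha>\<close>, which enters the norm of the shifted
      integrand only through \<open>x powr (- d)\<close>.\<close>
    define M where "M = (LBINT y. norm (mellin_kernel z (Complex d y)))"
    define k where "k = norm (Gamma (2 * of_nat N + 2 + z) * riemann_zeta (2 * of_nat N + 2) *
      riemann_zeta (2 * of_nat N + z + 2))"
    \<comment> \<open>The last term kept is never \<open>0\<close> for \<open>\<alpha> > 0\<close>,
      so it can serve as the yardstick for the error.\<close>
    have k: "k > 0"
    proof -
      have "Gamma (2 * of_nat N + 2 + z) \<noteq> 0"
        unfolding Gamma_eq_zero_iff by (rule not_nonpos_Int_if_Re_pos) (use assms in simp)
      moreover have "riemann_zeta (2 * of_nat N + 2) \<noteq> 0"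
        by (rule riemann_zeta_nonzero) simp
      moreover have "riemann_zeta (2 * of_nat N + z + 2) \<noteq> 0"
        by (rule riemann_zeta_nonzero) (use assms in simp)
      ultimately show ?thesis by (simp add: k_def)
    qed
    have bound: "norm (xi_integral z \<alpha> - (leading_terms z \<alpha> + (\<Sum>m\<le>N. series_term z m \<alpha>)))
        \<le> M / (4 * k) / (2 * pi * \<alpha>) * norm (series_term z N \<alpha>)" if \<alpha>: "\<alpha> > 0" for \<alpha>
    proof -
      define x where "x = 2 * pi * \<alpha>"
      have x: "x > 0" using \<alpha> by (simp add: x_def)
      define A where "A = \<alpha> powr ((Re z + 1) / 2)"
      have nA: "norm (of_real \<alpha> powr ((z + 1) / 2) :: complex) = A"
        using \<alpha> by (simp add: norm_powr_real_powr A_def)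
      have "norm (LBINT y. of_real x powr (- Complex d y) * mellin_kernel z (Complex d y)) \<le>
          (LBINT y. norm (of_real x powr (- Complex d y) * mellin_kernel z (Complex d y)))"
        by (rule integral_norm_bound)
      also have "\<dots> = (LBINT y. x powr (- d) * norm (mellin_kernel z (Complex d y)))"
        using x by (simp add: norm_mult norm_powr_real_powr)
      also have "\<dots> = x powr (- d) * M"
        unfolding M_def by (rule integral_mult_right_zero)
      finally have I: "norm (LBINT y. of_real x powr (- Complex d y) * mellin_kernel z (Complex d y)) \<le> x powr (- d) * M" .
      have "norm (xi_integral z \<alpha> - (leading_terms z \<alpha> + (\<Sum>m\<le>N. series_term z m \<alpha>))) =
          A / 2 * norm (LBINT y. of_real x powr (- Complex d y) * mellin_kernel z (Complex d y))"
        unfolding xi_integral_expansion(2)[OF assms \<alpha>] norm_mult norm_divide nA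
        by (simp add: x_def d_def)
      also have "\<dots> \<le> A / 2 * (x powr (- d) * M)"
        by (intro mult_left_mono I) (simp add: A_def)
      \<comment> \<open>\<open>x powr (- d)\<close> is the power in the last term times one more
        \<open>1 / x\<close>; the \<open>4\<close> combines the \<open>1 / 2\<close> of the integral
        with the \<open>2\<close> of the series term.\<close>
      also have "\<dots> = M / (4 * k) / x * (2 * A * (k / x powr (2 * real N + Re z + 2)))"
      proof -
        have "x powr (- d) = 1 / (x * x powr (2 * real N + Re z + 2))"
          using x powr_add[of x 1 "2 * real N + Re z + 2"] powr_minus_divide[of x d]
          by (simp add: d_def algebra_simps)
        thus ?thesis using k x by simp
      qed
      also have "2 * A * (k / x powr (2 * real N + Re z + 2)) = norm (series_term z N \<alpha>)"
      proof -
        have "norm (of_real x powr (2 * of_nat N + z + 2) :: complex) = x powr (2 * real N + Re z + 2)"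
          using x by (simp add: norm_powr_real_powr)
        thus ?thesis
          unfolding series_term_def norm_mult norm_divide nA k_def x_def[symmetric]
          by (simp add: norm_power)
      qed
      finally show ?thesis by (simp add: x_def)
    qed
    show "(\<lambda>x. xi_integral z x - (leading_terms z x + (\<Sum>m\<le>N. series_term z m x))) \<in> o(series_term z N)"
    proof (rule landau_o.smallI)
      fix e :: real assume e: "e > 0"
      have "((\<lambda>\<alpha>::real. M / (4 * k) / (2 * pi * \<alpha>)) \<longlongrightarrow> 0) at_top"
        by (intro tendsto_divide_0[OF tendsto_const] filterlim_at_top_imp_at_infinity
            filterlim_tendsto_pos_mult_at_top[OF tendsto_const] filterlim_ident) simp
      hence "eventually (\<lambda>\<alpha>. M / (4 * k) / (2 * pi * \<alpha>) < e) at_top"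
        using e by (rule order_tendstoD)
      thus "\<forall>\<^sub>F \<alpha> in at_top. norm (xi_integral z \<alpha> - (leading_terms z \<alpha> + (\<Sum>m\<le>N. series_term z m \<alpha>)))
          \<le> e * norm (series_term z N \<alpha>)"
        using eventually_gt_at_top[of 0]
      proof eventually_elim
        case (elim \<alpha>)
        note bound[OF elim(2)]
        also have "M / (4 * k) / (2 * pi * \<alpha>) * norm (series_term z N \<alpha>) \<le> e * norm (series_term z N \<alpha>)"
          using elim(1) by (intro mult_right_mono) auto
        finally show ?case .
      qed
    qed
  qed
qed

end
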